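(* Consider the multistage stochastic program, the ISDDP algorithm, and the sequences of decisions $(x_n^k)_{n\in\mathcal{N}}$ and of functions $(\mathcal{Q}_t^k)$ generated in the simulation of ISDDP, all described in the context. Assume (H), (H1) and (H2) of the context hold, and that the errors are bounded: $0\le\varepsilon_t^k\le\bar\varepsilon$, $0\le\delta_t^k\le\bar\delta$ for finite $\bar\delta,\bar\varepsilon$. Then: (i) for $t=2,\dots,T+1$ and every node $n$ of stage $t-1$, almost surely $$0\le\liminf_{k\to+\infty}\mathcal{Q}_t(x_n^k)-\mathcal{Q}_t^k(x_n^k)\le\limsup_{k\to+\infty}\mathcal{Q}_t(x_n^k)-\mathcal{Q}_t^k(x_n^k)\le(\bar\delta+2\bar\varepsilon)(T-t+1);$$ (ii) for every $t=2,\dots,T$ and every node $n$ of stage $t-1$, almost surely $$0\le\liminf_{k\to+\infty}\sum_{m\in C(n)}p_m\big[f_t(x_m^k,x_n^k,\xi_m)+\mathcal{Q}_{t+1}(x_m^k)\big]-\mathcal{Q}_t(x_n^k),$$ $$\limsup_{k\to+\infty}\sum_{m\in C(n)}p_m\big[f_t(x_m^k,x_n^k,\xi_m)+\mathcal{Q}_{t+1}(x_m^k)\big]-\mathcal{Q}_t(x_n^k)\le(\bar\delta+2\bar\varepsilon)(T-t+1);$$ (iii) the sequence $\underline{\mathfrak{Q}}_1^{k-1}(x_0,\xi_1)$ of lower bounds on the optimal value $\mathcal{Q}_1(x_0)$ satisfies almost surely $$\mathcal{Q}_1(x_0)-\bar\delta T-2\bar\varepsilon(T-1)\le\liminf_{k\to+\infty}\underline{\mathfrak{Q}}_1^{k-1}(x_0,\xi_1)\le\limsup_{k\to+\infty}\underline{\mathfrak{Q}}_1^{k-1}(x_0,\xi_1)\le\mathcal{Q}_1(x_0);$$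 (iv) for $t=2,\dots,T$, almost surely the sequence $(\mathcal{Q}_t^k)_k$ converges uniformly to a continuous function $\mathcal{Q}_t^*$ which is at most at distance $(\bar\delta+2\bar\varepsilon)(T-t+1)$ from $\mathcal{Q}_t$ (i.e. $|\mathcal{Q}_t^*(\bar x_n)-\mathcal{Q}_t(\bar x_n)|\le(\bar\delta+2\bar\varepsilon)(T-t+1)$) at every accumulation point $\bar x_n$ of the sequence $(x_n^k)_k$, for every node $n$ of stage $t-1$.
   Context: **Problem.** $T$ stages, $x_0\in\mathbb{R}^n$ given, $(\xi_t)_{t=1}^T$ a stochastic process with $\xi_1$ deterministic; $\xi_t$ contains in particular the random matrices and vector $A_t,B_t,b_t$. Feasible sets: $X_t(x_{t-1},\xi_t)=\{x_t\in\mathbb{R}^n: A_tx_t+B_tx_{t-1}=b_t,\ g_t(x_t,x_{t-1},\xi_t)\le0,\ x_t\in\mathcal{X}_t\}$, with $g_t=(g_{t1},\dots,g_{tp})$. Dynamic programming equations: $\mathcal{Q}_{T+1}\equiv0$; for $t=2,\dots,T$, $\mathcal{Q}_t(x_{t-1})=\mathbb{E}_{\xi_t}[\mathfrak{Q}_t(x_{t-1},\xi_t)]$ with $\mathfrak{Q}_t(x_{t-1},\xi_t)=\min\{f_t(x_t,x_{t-1},\xi_t)+\mathcal{Q}_{t+1}(x_t): x_t\in X_t(x_{t-1},\xi_t)\}$; the optimal value of the problem is $\mathcal{Q}_1(x_0)=\min\{f_1(x_1,x_0,\xi_1)+\mathcal{Q}_2(x_1): x_1\in X_1(x_0,\xi_1)\}$.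 **(H)** $(\xi_t)$ is interstage independent; for $t=2,\dots,T$, $\xi_t$ takes values in $\mathbb{R}^K$ with finite support $\Theta_t=\{\xi_{t1},\dots,\xi_{tN_t}\}$ and $p_{ti}=\mathbb{P}(\xi_t=\xi_{ti})>0$; $\xi_1$ is deterministic ($N_1=1$, $\xi_{11}=\xi_1$). $A_{tj},B_{tj},b_{tj}$ are the realizations of $A_t,B_t,b_t$ in $\xi_{tj}$. **(H1)** Set $\mathcal{X}_0=\{x_0\}$ and $\mathcal{X}^\varepsilon=\mathcal{X}+\{x:\|x\|\le\varepsilon\}$. There is $\varepsilon>0$ such that for $t=1,\dots,T$: 1) $\mathcal{X}_t$ is nonempty, compact, convex. 2) For every $j$, $f_t(\cdot,\cdot,\xi_{tj})$ is convex, proper, lower semicontinuous on $\mathcal{X}_t\times\mathcal{X}_{t-1}$, and $\mathcal{X}_t\subset\mathrm{dom}(f_t(\cdot,x_{t-1},\xi_{tj}))$ for every $x_{t-1}\in\mathcal{X}_{t-1}^\varepsilon$. 3) For every $j$, each $g_{ti}(\cdot,\cdot,\xi_{tj})$, $i=1,\dots,p$, is convex, lower semicontinuous and finite on $\mathcal{X}_t\times\mathcal{X}_{t-1}$. 4) $X_1(x_0,\xi_1)\ne\emptyset$, and for every $t=2,\dots,T$, every $j$ and every $x_{t-1}\in\mathcal{X}_{t-1}^\varepsilon$, $\mathrm{ri}(\mathcal{X}_t)\cap X_t(x_{t-1},\xi_{tj})\ne\emptyset$. 5) For every $t\ge2$ and every $j$ there is $(x_{tj},x_{t-1\,j})\in\mathrm{ri}(\mathcal{X}_t)\times\mathcal{X}_{t-1}$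 with $g_t(x_{tj},x_{t-1\,j},\xi_{tj})<0$. **ISDDP algorithm.** Error levels $\delta_t^k,\varepsilon_t^k\ge0$ are given. A $\delta$-optimal solution is a feasible point whose objective value is within $\delta$ of the optimal value. Step 0: choose affine $\mathcal{Q}_t^0:\mathcal{X}_{t-1}\to\mathbb{R}$ with $\mathcal{Q}_t^0\le\mathcal{Q}_t$, $t=2,\dots,T+1$; $\mathcal{Q}_{T+1}^k\equiv0$ for all $k$. Set $k=1$. Step 1 (forward pass): $x_0^k=x_0$; sample $(\tilde\xi_1^k,\dots,\tilde\xi_T^k)$ from the distribution of $(\xi_1,\dots,\xi_T)$; for $t=1,\dots,T$ compute a $\delta_t^k$-optimal solution $x_t^k$ of $\min\{f_t(x_t,x_{t-1}^k,\tilde\xi_t^k)+\mathcal{Q}_{t+1}^{k-1}(x_t): x_t\in X_t(x_{t-1}^k,\tilde\xi_t^k)\}$. Step 2 (backward pass): for $t=T,\dots,2$: for $j=1,\dots,N_t$ compute an $\varepsilon_t^k$-optimal solution $x_{tj}^k$ (with $z=x_{t-1}^k$) of $$\underline{\mathfrak{Q}}_t^k(x_{t-1}^k,\xi_{tj})=\min_{x_t,z}\{f_t(x_t,z,\xi_{tj})+\mathcal{Q}_{t+1}^k(x_t): A_{tj}x_t+B_{tj}z=b_{tj},\ g_t(x_t,z,\xi_{tj})\le0,\ x_t\in\mathcal{X}_t,\ z=x_{t-1}^k\}$$ and an $\varepsilon_t^k$-optimal solution $\lambda_{tj}^k$ of the dual obtained by dualizing $z=x_{t-1}^k$, i.e.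 of maximizing over $\lambda$ the infimum of $f_t(x_t,z,\xi_{tj})+\mathcal{Q}_{t+1}^k(x_t)+\langle\lambda,x_{t-1}^k-z\rangle$ over $(x_t,z)$ satisfying the other constraints. Set $\beta_t^k=\sum_jp_{tj}\lambda_{tj}^k$, $\theta_t^k=\sum_jp_{tj}\big(f_t(x_{tj}^k,x_{t-1}^k,\xi_{tj})+\mathcal{Q}_{t+1}^k(x_{tj}^k)-\langle\lambda_{tj}^k,x_{t-1}^k\rangle\big)$, $\mathcal{C}_t^k(x_{t-1})=\theta_t^k-2\varepsilon_t^k+\langle\beta_t^k,x_{t-1}\rangle$, and $\mathcal{Q}_t^k=\max\{\mathcal{Q}_t^{k-1},\mathcal{C}_t^k\}$. Then $k\leftarrow k+1$ and return to Step 1. **Scenario tree and simulation.** The realizations of $(\xi_t)$ form a scenario tree with root $n_0$ (stage $0$), whose only child is a node $n_1$ of stage 1; $\mathcal{N}$ is the set of nodes, $C(n)$ the set of children of $n$, $p_n$ the transition probability from the parent of $n$ to $n$, $\xi_n$ the realization at $n$ (containing $A_n,B_n,b_n$). In the simulation of iteration $k$ (policy obtained at the end of iteration $k-1$): $x_{n_0}^k=x_0$ and, for $t=1,\dots,T$, every node $n$ of stage $t-1$ and every $m\in C(n)$, $x_m^k$ is a $\delta_t^k$-optimal solution of $$\underline{\mathfrak{Q}}_t^{k-1}(x_n^k,\xi_m)=\inf_{x_m}\{f_t(x_m,x_n^k,\xi_m)+\mathcal{Q}_{t+1}^{k-1}(x_m): A_mx_m+B_mx_n^k=b_m,\ g_t(x_m,x_n^k,\xi_m)\le0,\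 x_m\in\mathcal{X}_t\}.$$ The decisions $x_n^k$ are determined before the scenario of iteration $k$ is sampled, and along the sampled scenario they are the forward-pass decisions: $x_t^k=x_n^k$ if the sampled scenario passes through node $n$ of stage $t$. **(H2)** $(\tilde\xi_2^k,\dots,\tilde\xi_T^k)$ is a realization of $\xi^k=(\xi_2^k,\dots,\xi_T^k)\sim(\xi_2,\dots,\xi_T)$, and $\xi^1,\xi^2,\dots$ are independent.
   Formalization: In (H1), convexity and properness of f_t and convexity of g_ti are assumed on all of R^n×R^n, not only on X_t×X_{t-1}; otherwise the dual over free z may have a gap, cuts may be invalid and (iii) can fail (e.g. cost |z| on [-1,1], max(0,2-|z|) outside). *)

theory Defs
  imports "HOL-Probability.Probability"
begin

section \<open>Extended-real convex analysis\<close>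

definition convex_fun :: "('a::real_vector \<Rightarrow> ereal) \<Rightarrow> bool" where
  "convex_fun h \<longleftrightarrow> convex {(x, r::real). h x \<le> ereal r}"

definition proper_fun :: "('a \<Rightarrow> ereal) \<Rightarrow> bool" where
  "proper_fun h \<longleftrightarrow> (\<forall>x. h x \<noteq> -\<infinity>) \<and> (\<exists>x. h x \<noteq> \<infinity>)"

definition lsc_on :: "'a::topological_space set \<Rightarrow> ('a \<Rightarrow> ereal) \<Rightarrow> bool" where
  "lsc_on S h \<longleftrightarrow> (\<forall>x\<in>S. h x \<le> Liminf (at x within S) h)"

definition approx_min :: "real \<Rightarrow> 'a set \<Rightarrow> ('a \<Rightarrow> ereal) \<Rightarrow> 'a \<Rightarrow> bool" where
  "approx_min d S h x \<longleftrightarrow> x \<in> S \<and> h x \<le> (INF y\<in>S. h y) + ereal d"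

definition approx_max :: "real \<Rightarrow> ('a \<Rightarrow> ereal) \<Rightarrow> 'a \<Rightarrow> bool" where
  "approx_max d h x \<longleftrightarrow> (SUP y. h y) \<le> h x + ereal d"


section \<open>The multistage stochastic program\<close>

text \<open>
  The matrices and the right-hand side of the linear constraints are part of the random vector
  \<open>\<xi>\<^sub>t\<close>; \<open>matA\<close>, \<open>matB\<close>, \<open>rhs\<close> read them off a realization. The objective
  \<open>cost t x\<^sub>t x\<^sub>t\<^sub>-\<^sub>1 \<xi>\<^sub>t\<close> and the constraint functions
  \<open>cons t i x\<^sub>t x\<^sub>t\<^sub>-\<^sub>1 \<xi>\<^sub>t\<close>, \<open>1 \<le> i \<le> ncons\<close>, are extended-real valued functions on the
  whole space.
\<close>

record ('n, 'q, 'k, 'w) msp =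
  horizon :: nat
  x_init :: "real^'n::finite"
  base :: "'w measure"
  xi :: "nat \<Rightarrow> 'w \<Rightarrow> real^'k::finite"
  xi_first :: "real^'k::finite"
  matA :: "nat \<Rightarrow> real^'k::finite \<Rightarrow> real^'n::finite^'q::finite"
  matB :: "nat \<Rightarrow> real^'k::finite \<Rightarrow> real^'n::finite^'q::finite"
  rhs :: "nat \<Rightarrow> real^'k::finite \<Rightarrow> real^'q::finite"
  cost :: "nat \<Rightarrow> real^'n::finite \<Rightarrow> real^'n::finite \<Rightarrow> real^'k::finite \<Rightarrow> ereal"
  ncons :: nat
  cons :: "nat \<Rightarrow> nat \<Rightarrow> real^'n::finite \<Rightarrow> real^'n::finite \<Rightarrow> real^'k::finite \<Rightarrow> ereal"
  Xset :: "nat \<Rightarrow> (real^'n::finite) set"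

definition dec_set :: "('n::finite, 'q::finite, 'k::finite, 'w) msp \<Rightarrow> nat \<Rightarrow> (real^'n) set" where
  "dec_set P t = (if t = 0 then {x_init P} else Xset P t)"

definition fatten :: "real \<Rightarrow> (real^'n::finite) set \<Rightarrow> (real^'n) set" where
  "fatten e S = {x + y | x y. x \<in> S \<and> norm y \<le> e}"

definition rprob :: "('n::finite, 'q::finite, 'k::finite, 'w) msp \<Rightarrow> nat \<Rightarrow> real^'k \<Rightarrow> real" where
  "rprob P t \<zeta> = measure (base P) {\<omega> \<in> space (base P). xi P t \<omega> = \<zeta>}"

definition Theta :: "('n::finite, 'q::finite, 'k::finite, 'w) msp \<Rightarrow> nat \<Rightarrow> (real^'k) set" where
  "Theta P t = {\<zeta>. rprob P t \<zeta> > 0}"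

text \<open>The constraints of stage \<open>t\<close> on pairs \<open>(x\<^sub>t, z)\<close>; the copy \<open>z\<close> of
  \<open>x\<^sub>t\<^sub>-\<^sub>1\<close> is not restricted to \<open>dec_set P (t - 1)\<close>.\<close>

definition joint_feas ::
  "('n::finite, 'q::finite, 'k::finite, 'w) msp \<Rightarrow> nat \<Rightarrow> real^'k \<Rightarrow> ((real^'n) \<times> (real^'n)) set" where
  "joint_feas P t \<zeta> = {(y, z). matA P t \<zeta> *v y + matB P t \<zeta> *v z = rhs P t \<zeta>
      \<and> (\<forall>i\<in>{1..ncons P}. cons P t i y z \<zeta> \<le> 0) \<and> y \<in> dec_set P t}"

definition feas ::
  "('n::finite, 'q::finite, 'k::finite, 'w) msp \<Rightarrow> nat \<Rightarrow> real^'n \<Rightarrow> real^'k \<Rightarrow> (real^'n) set" where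
  "feas P t x \<zeta> = {y. (y, x) \<in> joint_feas P t \<zeta>}"

definition stage_obj ::
  "('n::finite, 'q::finite, 'k::finite, 'w) msp \<Rightarrow> nat \<Rightarrow> (real^'n \<Rightarrow> ereal) \<Rightarrow> real^'n \<Rightarrow> real^'k
    \<Rightarrow> real^'n \<Rightarrow> ereal" where
  "stage_obj P t V x \<zeta> y = cost P t y x \<zeta> + V y"

definition stage_val ::
  "('n::finite, 'q::finite, 'k::finite, 'w) msp \<Rightarrow> nat \<Rightarrow> (real^'n \<Rightarrow> ereal) \<Rightarrow> real^'n \<Rightarrow> real^'k
    \<Rightarrow> ereal" where
  "stage_val P t V x \<zeta> = (INF y\<in>feas P t x \<zeta>. stage_obj P t V x \<zeta> y)"

text \<open>The expectation over \<open>\<xi>\<^sub>t\<close> is written as the sum over its (finite) support, so that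
  it makes sense for extended-real values.\<close>

function cost_to_go ::
  "('n::finite, 'q::finite, 'k::finite, 'w) msp \<Rightarrow> nat \<Rightarrow> real^'n \<Rightarrow> ereal" where
  "cost_to_go P t x =
    (if horizon P < t then 0
     else (\<Sum>\<zeta>\<in>Theta P t. ereal (rprob P t \<zeta>)
             * stage_val P t (\<lambda>y. cost_to_go P (Suc t) y) x \<zeta>))"
  by pat_completeness auto
termination
  by (relation "Wellfounded.measure (\<lambda>(P, t, x). Suc (horizon P) - t)") auto

declare cost_to_go.simps [simp del]

definition opt_value :: "('n::finite, 'q::finite, 'k::finite, 'w) msp \<Rightarrow> ereal" where
  "opt_value P = stage_val P 1 (cost_to_go P 2) (x_init P) (xi_first P)"

definition process_assms :: "('n::finite, 'q::finite, 'k::finite, 'w) msp \<Rightarrow> bool" where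
  "process_assms P \<longleftrightarrow>
     prob_space (base P)
   \<and> prob_space.indep_vars (base P) (\<lambda>_. borel) (xi P) {1..horizon P}
   \<and> (AE \<omega> in base P. xi P 1 \<omega> = xi_first P)
   \<and> (\<forall>t\<in>{2..horizon P}. finite (Theta P t) \<and> (AE \<omega> in base P. xi P t \<omega> \<in> Theta P t))"

text \<open>Convexity and properness are those of extended-real valued functions on the whole space
  (the dual problems below let \<open>z\<close> range over the whole space); lower semicontinuity and
  finiteness are only required on \<open>dec_set P t \<times> dec_set P (t - 1)\<close>.\<close>

definition regularity_assms :: "('n::finite, 'q::finite, 'k::finite, 'w) msp \<Rightarrow> bool" where
  "regularity_assms P \<longleftrightarrow> (\<exists>e>0.
     (\<forall>t\<in>{1..horizon P}.
         dec_set P t \<noteq> {} \<and> compact (dec_set P t) \<and> convex (dec_set P t)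
       \<and> (\<forall>\<zeta>\<in>Theta P t.
             convex_fun (\<lambda>(y, z). cost P t y z \<zeta>)
           \<and> proper_fun (\<lambda>(y, z). cost P t y z \<zeta>)
           \<and> lsc_on (dec_set P t \<times> dec_set P (t - 1)) (\<lambda>(y, z). cost P t y z \<zeta>)
           \<and> (\<forall>z\<in>fatten e (dec_set P (t - 1)). dec_set P t \<subseteq> {y. cost P t y z \<zeta> < \<infinity>})
           \<and> (\<forall>i\<in>{1..ncons P}.
                 convex_fun (\<lambda>(y, z). cons P t i y z \<zeta>)
               \<and> lsc_on (dec_set P t \<times> dec_set P (t - 1)) (\<lambda>(y, z). cons P t i y z \<zeta>)
               \<and> (\<forall>y\<in>dec_set P t. \<forall>z\<in>dec_set P (t - 1). \<bar>cons P t i y z \<zeta>\<bar> \<noteq> \<infinity>))))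
   \<and> feas P 1 (x_init P) (xi_first P) \<noteq> {}
   \<and> (\<forall>t\<in>{2..horizon P}. \<forall>\<zeta>\<in>Theta P t.
         (\<forall>z\<in>fatten e (dec_set P (t - 1)). rel_interior (dec_set P t) \<inter> feas P t z \<zeta> \<noteq> {})
       \<and> (\<exists>y\<in>rel_interior (dec_set P t). \<exists>z\<in>dec_set P (t - 1).
             \<forall>i\<in>{1..ncons P}. cons P t i y z \<zeta> < 0)))"


section \<open>Scenario tree\<close>

text \<open>A node of stage \<open>t\<close> is the list \<open>[\<zeta>\<^sub>1, \<dots>, \<zeta>\<^sub>t]\<close> of realizations leading to it; the
  root is the empty list, and the realization at a node is the last entry.\<close>

definition path_prob :: "('n::finite, 'q::finite, 'k::finite, 'w) msp \<Rightarrow> (real^'k) list \<Rightarrow> real" where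
  "path_prob P n =
     measure (base P) {\<omega> \<in> space (base P). \<forall>i<length n. xi P (Suc i) \<omega> = n ! i}"

definition nodes :: "('n::finite, 'q::finite, 'k::finite, 'w) msp \<Rightarrow> nat \<Rightarrow> (real^'k) list set" where
  "nodes P t = {n. length n = t \<and> path_prob P n > 0}"

definition children ::
  "('n::finite, 'q::finite, 'k::finite, 'w) msp \<Rightarrow> (real^'k) list \<Rightarrow> (real^'k) list set" where
  "children P n = {m \<in> nodes P (Suc (length n)). butlast m = n}"

definition trans_prob :: "('n::finite, 'q::finite, 'k::finite, 'w) msp \<Rightarrow> (real^'k) list \<Rightarrow> real" where
  "trans_prob P m = path_prob P m / path_prob P (butlast m)"


section \<open>The ISDDP algorithm\<close>

text \<open>Value at \<open>l\<close> of the dual function of the stage-\<open>t\<close> problem obtained by dualizing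
  the copying constraint \<open>z = x\<close>.\<close>

definition dual_fun ::
  "('n::finite, 'q::finite, 'k::finite, 'w) msp \<Rightarrow> nat \<Rightarrow> (real^'n \<Rightarrow> ereal) \<Rightarrow> real^'n \<Rightarrow> real^'k
    \<Rightarrow> real^'n \<Rightarrow> ereal" where
  "dual_fun P t V x \<zeta> l =
     (INF (y, z)\<in>joint_feas P t \<zeta>. stage_obj P t V z \<zeta> y + ereal (l \<bullet> (x - z)))"

definition initial_approx ::
  "('n::finite, 'q::finite, 'k::finite, 'w) msp \<Rightarrow> (nat \<Rightarrow> real^'n \<Rightarrow> real) \<Rightarrow> bool" where
  "initial_approx P Q0 \<longleftrightarrow> (\<forall>t\<in>{2..Suc (horizon P)}.
     (\<exists>c v. \<forall>x\<in>dec_set P (t - 1). Q0 t x = c + v \<bullet> x)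
   \<and> (\<forall>x\<in>dec_set P (t - 1). ereal (Q0 t x) \<le> cost_to_go P t x))"

text \<open>Forward pass of iteration \<open>k\<close> along the scenario \<open>s\<close>, with trial points \<open>x t\<close> and
  current approximations \<open>Q t\<close>.\<close>

definition forward_pass ::
  "('n::finite, 'q::finite, 'k::finite, 'w) msp \<Rightarrow> (nat \<Rightarrow> real) \<Rightarrow> (nat \<Rightarrow> real^'n \<Rightarrow> real)
    \<Rightarrow> (nat \<Rightarrow> real^'k) \<Rightarrow> (nat \<Rightarrow> real^'n) \<Rightarrow> bool" where
  "forward_pass P \<delta> Q s x \<longleftrightarrow> x 0 = x_init P \<and>
     (\<forall>t\<in>{1..horizon P}.
        approx_min (\<delta> t) (feas P t (x (t - 1)) (s t))
          (stage_obj P t (\<lambda>y. ereal (Q (Suc t) y)) (x (t - 1)) (s t)) (x t))"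

definition simulation ::
  "('n::finite, 'q::finite, 'k::finite, 'w) msp \<Rightarrow> (nat \<Rightarrow> real) \<Rightarrow> (nat \<Rightarrow> real^'n \<Rightarrow> real)
    \<Rightarrow> ((real^'k) list \<Rightarrow> real^'n) \<Rightarrow> bool" where
  "simulation P \<delta> Q X \<longleftrightarrow> X [] = x_init P \<and>
     (\<forall>t\<in>{1..horizon P}. \<forall>n\<in>nodes P (t - 1). \<forall>m\<in>children P n.
        approx_min (\<delta> t) (feas P t (X n) (last m))
          (stage_obj P t (\<lambda>y. ereal (Q (Suc t) y)) (X n) (last m)) (X m))"

text \<open>The affine cut of stage \<open>t\<close> built from the trial point \<open>x\<close>, the approximation \<open>V\<close> of
  the next stage, and, for every realization \<open>\<zeta>\<close>, approximate primal and dual solutions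
  \<open>y \<zeta>\<close> and \<open>l \<zeta>\<close>.\<close>

definition cut ::
  "('n::finite, 'q::finite, 'k::finite, 'w) msp \<Rightarrow> nat \<Rightarrow> real \<Rightarrow> (real^'n \<Rightarrow> real) \<Rightarrow> real^'n
    \<Rightarrow> (real^'k \<Rightarrow> real^'n) \<Rightarrow> (real^'k \<Rightarrow> real^'n) \<Rightarrow> real^'n \<Rightarrow> real" where
  "cut P t e V x y l u =
    (let \<beta> = (\<Sum>\<zeta>\<in>Theta P t. rprob P t \<zeta> *\<^sub>R l \<zeta>);
         \<theta> = (\<Sum>\<zeta>\<in>Theta P t. rprob P t \<zeta>
                * (real_of_ereal (cost P t (y \<zeta>) x \<zeta>) + V (y \<zeta>) - l \<zeta> \<bullet> x))
     in \<theta> - 2 * e + \<beta> \<bullet> u)"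

text \<open>Backward pass of one iteration, turning the approximations \<open>Q\<close> into \<open>Q'\<close>.\<close>

definition backward_pass ::
  "('n::finite, 'q::finite, 'k::finite, 'w) msp \<Rightarrow> (nat \<Rightarrow> real) \<Rightarrow> (nat \<Rightarrow> real^'n)
    \<Rightarrow> (nat \<Rightarrow> real^'k \<Rightarrow> real^'n) \<Rightarrow> (nat \<Rightarrow> real^'k \<Rightarrow> real^'n)
    \<Rightarrow> (nat \<Rightarrow> real^'n \<Rightarrow> real) \<Rightarrow> (nat \<Rightarrow> real^'n \<Rightarrow> real) \<Rightarrow> bool" where
  "backward_pass P \<epsilon> x y l Q Q' \<longleftrightarrow>
     (\<forall>t\<in>{2..horizon P}.
        (\<forall>\<zeta>\<in>Theta P t.
            approx_min (\<epsilon> t) (feas P t (x (t - 1)) \<zeta>)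
              (stage_obj P t (\<lambda>w. ereal (Q' (Suc t) w)) (x (t - 1)) \<zeta>) (y t \<zeta>)
          \<and> approx_max (\<epsilon> t)
              (dual_fun P t (\<lambda>w. ereal (Q' (Suc t) w)) (x (t - 1)) \<zeta>) (l t \<zeta>))
      \<and> (\<forall>u\<in>dec_set P (t - 1).
            Q' t u = max (Q t u) (cut P t (\<epsilon> t) (Q' (Suc t)) (x (t - 1)) (y t) (l t) u)))"

text \<open>A run of the algorithm, together with its simulation on the scenario tree, for the sampled
  scenarios \<open>s k = (s k 1, \<dots>, s k T)\<close>, \<open>k \<ge> 1\<close>. Here \<open>Q k t\<close> is the approximation of
  \<open>cost_to_go P t\<close> after iteration \<open>k\<close>, \<open>x k t\<close> are the forward decisions, \<open>X k n\<close> the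
  decisions at the nodes, and \<open>y k t \<zeta>\<close>, \<open>l k t \<zeta>\<close> the approximate primal and dual
  solutions of the backward pass.\<close>

definition isddp_run ::
  "('n::finite, 'q::finite, 'k::finite, 'w) msp \<Rightarrow> (nat \<Rightarrow> nat \<Rightarrow> real) \<Rightarrow> (nat \<Rightarrow> nat \<Rightarrow> real)
    \<Rightarrow> (nat \<Rightarrow> real^'n \<Rightarrow> real) \<Rightarrow> (nat \<Rightarrow> nat \<Rightarrow> real^'k) \<Rightarrow> (nat \<Rightarrow> nat \<Rightarrow> real^'n)
    \<Rightarrow> (nat \<Rightarrow> (real^'k) list \<Rightarrow> real^'n)
    \<Rightarrow> (nat \<Rightarrow> nat \<Rightarrow> real^'k \<Rightarrow> real^'n) \<Rightarrow> (nat \<Rightarrow> nat \<Rightarrow> real^'k \<Rightarrow> real^'n)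
    \<Rightarrow> (nat \<Rightarrow> nat \<Rightarrow> real^'n \<Rightarrow> real) \<Rightarrow> bool" where
  "isddp_run P \<delta> \<epsilon> Q0 s x X y l Q \<longleftrightarrow>
     (\<forall>t\<in>{2..Suc (horizon P)}. \<forall>u\<in>dec_set P (t - 1). Q 0 t u = Q0 t u)
   \<and> (\<forall>k. \<forall>u\<in>dec_set P (horizon P). Q k (Suc (horizon P)) u = 0)
   \<and> (\<forall>k\<ge>1.
         forward_pass P (\<delta> k) (Q (k - 1)) (s k) (x k)
       \<and> backward_pass P (\<epsilon> k) (x k) (y k) (l k) (Q (k - 1)) (Q k)
       \<and> simulation P (\<delta> k) (Q (k - 1)) (X k)
       \<and> (\<forall>t\<in>{1..horizon P}. \<forall>n\<in>nodes P t. n = map (s k) [1..<Suc t] \<longrightarrow> x k t = X k n))"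

text \<open>Stage 1 is deterministic, so a scenario consists of the realizations of the stages
  \<open>2, \<dots>, T\<close>.\<close>

definition scenario ::
  "('n::finite, 'q::finite, 'k::finite, 'w) msp \<Rightarrow> (nat \<Rightarrow> 'v \<Rightarrow> real^'k) \<Rightarrow> 'v \<Rightarrow> nat \<Rightarrow> real^'k" where
  "scenario P \<eta> \<omega> = (\<lambda>t\<in>{2..horizon P}. \<eta> t \<omega>)"

text \<open>\<open>S k t \<omega>\<close> is the realization of stage \<open>t\<close> sampled in iteration \<open>k\<close>.\<close>

definition sampling_assms ::
  "('n::finite, 'q::finite, 'k::finite, 'w) msp \<Rightarrow> 'v measure \<Rightarrow> (nat \<Rightarrow> nat \<Rightarrow> 'v \<Rightarrow> real^'k)
    \<Rightarrow> bool" where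
  "sampling_assms P M S \<longleftrightarrow>
     prob_space M
   \<and> (\<forall>k\<ge>1. AE \<omega> in M. S k 1 \<omega> = xi_first P)
   \<and> prob_space.indep_vars M (\<lambda>_. PiM {2..horizon P} (\<lambda>_. borel)) (\<lambda>k. scenario P (S k)) {1..}
   \<and> (\<forall>k\<ge>1. distr M (PiM {2..horizon P} (\<lambda>_. borel)) (scenario P (S k))
          = distr (base P) (PiM {2..horizon P} (\<lambda>_. borel)) (scenario P (xi P)))"

text \<open>The node decisions of iteration \<open>k\<close> are determined before its scenario is sampled: the
  scenario of iteration \<open>k\<close> is independent of some \<open>\<sigma>\<close>-algebra \<open>F\<close> for which the
  earlier scenarios and all node decisions up to iteration \<open>k\<close> are measurable. If the algorithm
  has no randomness besides the sampling, \<open>F\<close> is generated by the earlier scenarios.\<close>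

definition nonanticipative ::
  "('n::finite, 'q::finite, 'k::finite, 'w) msp \<Rightarrow> 'v measure \<Rightarrow> (nat \<Rightarrow> nat \<Rightarrow> 'v \<Rightarrow> real^'k)
    \<Rightarrow> (nat \<Rightarrow> (real^'k) list \<Rightarrow> 'v \<Rightarrow> real^'n) \<Rightarrow> bool" where
  "nonanticipative P M S X \<longleftrightarrow> (\<forall>k\<ge>1. \<exists>F. subalgebra M F
     \<and> (\<forall>j\<in>{1..<k}. scenario P (S j) \<in> measurable F (PiM {2..horizon P} (\<lambda>_. borel)))
     \<and> (\<forall>j\<in>{1..k}. \<forall>t\<in>{1..horizon P}. \<forall>n\<in>nodes P t. X j n \<in> borel_measurable F)
     \<and> prob_space.indep_set M (sets F)
         (sets (vimage_algebra (space M) (scenario P (S k)) (PiM {2..horizon P} (\<lambda>_. borel)))))"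

end

theory Submission
  imports Defs
begin

text \<open>
  The stage value \<open>v(z) = stage_val P t W z \<zeta>\<close> of a convex approximation \<open>W\<close> is a convex
  function of the previous decision \<open>z\<close>. It is finite on the decision set and, by the
  feasibility assumption, below \<open>\<infinity>\<close> on a whole fattening of it, so every decision lies in the interior
  of its domain. Everything that is needed from duality follows from this. There is a subgradient at
  each decision, hence no duality gap for the copying constraint, and a dual solution that is optimal up to an error
  \<open>d\<close> is a subgradient up to \<open>d\<close> (\<open>approx_dual_subgradient\<close>). Consequently the cuts are valid
  (\<open>cut_le_expected\<close>), they are nearly tight at the trial point
  (\<open>expected_le_cut_at_trial_point\<close>), and their slopes are bounded uniformly over all iterations
  (\<open>cut_slope_bounded\<close>), because a steep approximate subgradient would push \<open>v\<close> above its
  bound on the fattening. The approximations of one stage are therefore monotone in \<open>k\<close>, bounded by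
  the cost-to-go function and equi-Lipschitz on a compact set, and they converge uniformly to a
  continuous limit (\<open>Qlim\<close>). This part of the argument holds whatever scenarios are sampled.

  Let \<open>g\<^sub>t\<close> be the continuous function cost-to-go minus limit at stage \<open>t\<close>. If the scenario of
  iteration \<open>k\<close> passes through a node \<open>n\<close>, then a cut is added exactly at the decision of \<open>n\<close>,
  and the gap there is at most \<open>\<delta>bar + 2 * \<epsilon>bar\<close> plus the expected gap of the previous
  approximations at the children of \<open>n\<close> (\<open>gap_at_sampled_node\<close>). One unit of \<open>\<delta>bar\<close> is lost
  because the decisions of the children are only approximately optimal, and \<open>2 * \<epsilon>bar\<close> is the
  amount by which the cut is lowered. Backward induction over the stages would give the asserted
  bounds on the iterations that sample \<open>n\<close>.

  The other iterations are reached by a statement about accumulation points: almost surely, every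
  accumulation point of the decisions at \<open>n\<close> is an accumulation point of those decisions along the
  iterations that sample \<open>n\<close> (\<open>accumulation_at_sampled_iterations\<close>). Since \<open>g\<^sub>t\<close> is continuous,
  the bound passes to all accumulation points (\<open>limit_gap_at_accumulation_point\<close>), and by
  compactness to the upper limit over all iterations. The probabilistic statement follows from a
  conditional Borel--Cantelli argument (\<open>infinitely_often_hit\<close>) for the events that the decision
  lies in a set of a countable base of the topology. It is phrased through the decisions, because these
  are the random quantities that are known before the scenario of an iteration is sampled.
\<close>


section \<open>Convex extended-real valued functions\<close>

lemma convex_funD:
  assumes "convex_fun h" "h x \<le> ereal r" "h x' \<le> ereal r'" "0 \<le> u" "0 \<le> w" "u + w = 1"
  shows "h (u *\<^sub>R x + w *\<^sub>R x') \<le> ereal (u * r + w * r')"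
  using convexD[OF assms(1)[unfolded convex_fun_def], of "(x, r)" "(x', r')" u w] assms by simp

lemma convex_funI:
  assumes "\<And>x r x' r' u w. h x \<le> ereal r \<Longrightarrow> h x' \<le> ereal r' \<Longrightarrow> 0 \<le> u \<Longrightarrow> 0 \<le> w \<Longrightarrow> u + w = 1
     \<Longrightarrow> h (u *\<^sub>R x + w *\<^sub>R x') \<le> ereal (u * r + w * r')"
  shows "convex_fun h"
  unfolding convex_fun_def by (rule convexI) (auto intro!: assms)

text \<open>
  The open half-line below \<open>(x, h x)\<close> and the epigraph of \<open>h\<close> are disjoint convex sets, and
  the normal of a separating hyperplane provides the subgradient. Finiteness on a ball excludes a
  vertical hyperplane. The inequality also shows that \<open>h\<close> nowhere takes the value \<open>-\<infinity>\<close>.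
\<close>

lemma convex_fun_subgradient:
  fixes h :: "'a::euclidean_space \<Rightarrow> ereal"
  assumes h: "convex_fun h" and x: "h x = ereal v" and e: "e > 0"
    and fin: "\<And>z. z \<in> ball x e \<Longrightarrow> h z < \<infinity>"
  obtains l where "\<And>z. ereal (v + l \<bullet> (z - x)) \<le> h z"
proof -
  define A where "A = {x} \<times> {..<v}"
  define B where "B = {(z, r::real). h z \<le> ereal r}"
  have "convex A" "A \<noteq> {}" unfolding A_def by (auto intro!: convex_Times lt_ex)
  moreover have "(x, v) \<in> B" using x by (simp add: B_def)
  moreover have "convex B" using h by (simp add: B_def convex_fun_def)
  moreover have "A \<inter> B = {}" using x by (auto simp: A_def B_def)
  ultimately obtain a b where a: "a \<noteq> 0" "\<forall>p\<in>A. a \<bullet> p \<le> b" "\<forall>p\<in>B. a \<bullet> p \<ge> b"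
    using separating_hyperplane_sets[of A B] by blast
  obtain \<alpha> \<tau> where at: "a = (\<alpha>, \<tau>)" by (cases a)
  have low: "\<alpha> \<bullet> x + \<tau> * s \<le> b" if "s < v" for s
    using a(2) that by (auto simp: A_def at inner_Pair)
  have up: "b \<le> \<alpha> \<bullet> z + \<tau> * r" if "h z \<le> ereal r" for z r
    using a(3) that by (force simp: B_def at inner_Pair)
  have lim: "\<alpha> \<bullet> x + \<tau> * v \<le> b"
  proof (rule tendsto_upperbound)
    show "((\<lambda>s. \<alpha> \<bullet> x + \<tau> * s) \<longlongrightarrow> \<alpha> \<bullet> x + \<tau> * v) (at_left v)" by (intro tendsto_intros)
    show "\<forall>\<^sub>F s in at_left v. \<alpha> \<bullet> x + \<tau> * s \<le> b"
      by (rule eventually_at_leftI[of "v - 1"]) (auto intro: low)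
  qed simp
  have "\<tau> \<ge> 0" using up[of x "v + 1"] lim x by (auto simp: algebra_simps)
  moreover have "\<tau> \<noteq> 0"
  proof
    assume t0: "\<tau> = 0"
    then have "\<alpha> \<noteq> 0" using a(1) at by (auto simp: zero_prod_def)
    \<comment> \<open>a vertical hyperplane would cut through the ball: move against its normal\<close>
    define z where "z = x - (e / 2 / norm \<alpha>) *\<^sub>R \<alpha>"
    have "z \<in> ball x e" using e \<open>\<alpha> \<noteq> 0\<close> by (auto simp: z_def dist_norm)
    then obtain r where "h z \<le> ereal r" using fin[of z] by (cases "h z") auto
    from up[OF this] lim t0 have "\<alpha> \<bullet> x \<le> \<alpha> \<bullet> z" by simp
    then have "(e / 2 / norm \<alpha>) * (\<alpha> \<bullet> \<alpha>) \<le> 0" by (simp add: z_def inner_diff_right)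
    moreover have "(e / 2 / norm \<alpha>) * (\<alpha> \<bullet> \<alpha>) > 0" using e \<open>\<alpha> \<noteq> 0\<close> by simp
    ultimately show False by linarith
  qed
  ultimately have tau: "\<tau> > 0" by simp
  show thesis
  proof (rule that[of "- (1 / \<tau>) *\<^sub>R \<alpha>"])
    fix z
    show "ereal (v + (- (1 / \<tau>) *\<^sub>R \<alpha>) \<bullet> (z - x)) \<le> h z"
    proof (rule ereal_le_real)
      fix r assume "h z \<le> ereal r"
      from up[OF this] lim have "\<tau> * v - \<alpha> \<bullet> (z - x) \<le> \<tau> * r" by (simp add: inner_diff_right)
      then have "v - (\<alpha> \<bullet> (z - x)) / \<tau> \<le> r" using tau by (simp add: field_simps)
      then show "ereal (v + (- (1 / \<tau>) *\<^sub>R \<alpha>) \<bullet> (z - x)) \<le> ereal r" by simp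
    qed
  qed
qed

lemma convex_on_real_of_ereal:
  assumes h: "convex_fun h" and S: "convex S" and fin: "\<And>x. x \<in> S \<Longrightarrow> \<bar>h x\<bar> \<noteq> \<infinity>"
  shows "convex_on S (\<lambda>x. real_of_ereal (h x))"
proof (rule convex_onI[OF _ S])
  fix t x y assume a: "0 < (t::real)" "t < 1" "x \<in> S" "y \<in> S"
  let ?r = "\<lambda>x. real_of_ereal (h x)"
  have e: "h x = ereal (?r x)" if "x \<in> S" for x using fin[OF that] by (simp add: ereal_real)
  have "h ((1 - t) *\<^sub>R x + t *\<^sub>R y) \<le> ereal ((1 - t) * ?r x + t * ?r y)"
    by (rule convex_funD[OF h]) (use a e in auto)
  moreover have "(1 - t) *\<^sub>R x + t *\<^sub>R y \<in> S" using a S by (simp add: convexD)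
  ultimately show "?r ((1 - t) *\<^sub>R x + t *\<^sub>R y) \<le> (1 - t) * ?r x + t * ?r y"
    using e by (metis ereal_less_eq(3))
qed

text \<open>
  A convex function is continuous on the interior of the set where it is finite. The open fattening
  \<open>U\<close> of \<open>C\<close> is such a set, and it contains the compact fattening of half the radius, on which
  \<open>h\<close> is therefore bounded.
\<close>

lemma convex_fun_near_compact:
  fixes h :: "real^'n \<Rightarrow> ereal"
  assumes h: "convex_fun h" and C: "compact C" "convex C" "C \<noteq> {}" and e: "e > 0"
    and fin: "\<And>z. z \<in> fatten e C \<Longrightarrow> h z < \<infinity>"
    and low: "\<And>x. x \<in> C \<Longrightarrow> h x > -\<infinity>"
  shows "continuous_on C (\<lambda>x. real_of_ereal (h x))"
    and "\<exists>B. \<forall>z\<in>fatten (e / 2) C. h z \<le> ereal B"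
proof -
  define U where "U = {x + y | x y. x \<in> C \<and> y \<in> ball 0 e}"
  define K where "K = {x + y | x y. x \<in> C \<and> y \<in> cball 0 (e / 2)}"
  have UF: "U \<subseteq> fatten e C" by (force simp: U_def fatten_def)
  have CU: "C \<subseteq> U" using e by (force simp: U_def intro: exI[of _ 0])
  have KU: "K \<subseteq> U" using e by (force simp: U_def K_def)
  have KF: "K = fatten (e / 2) C" by (force simp: K_def fatten_def)
  have U_eq: "U = (\<Union>x\<in>C. \<Union>y\<in>ball 0 e. {x + y})" unfolding U_def by blast
  have "convex U" unfolding U_eq by (rule convex_sums[OF C(2) convex_ball])
  have "open U" unfolding U_eq by (rule open_sums) simp
  have "compact K" unfolding K_def by (rule compact_sums[OF C(1) compact_cball])
  have fC: "\<exists>v. h x = ereal v" if "x \<in> C" for x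
    using low[OF that] fin[of x] CU UF that by (cases "h x") auto
  obtain x0 where x0: "x0 \<in> C" using C(3) by blast
  have fU: "\<bar>h z\<bar> \<noteq> \<infinity>" if "z \<in> U" for z
  proof -
    obtain v where v: "h x0 = ereal v" using fC x0 by blast
    have "h w < \<infinity>" if "w \<in> ball x0 e" for w
    proof (rule fin)
      show "w \<in> fatten e C" unfolding fatten_def mem_Collect_eq using that x0
        by (intro exI[of _ x0] exI[of _ "w - x0"]) (auto simp: dist_norm norm_minus_commute)
    qed
    then obtain l where "\<And>z. ereal (v + l \<bullet> (z - x0)) \<le> h z"
      using convex_fun_subgradient[OF h v e] by metis
    from this[of z] fin[of z] that UF show ?thesis by (cases "h z") auto
  qed
  have cU: "continuous_on U (\<lambda>x. real_of_ereal (h x))"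
    by (rule convex_on_continuous[OF \<open>open U\<close> convex_on_real_of_ereal[OF h \<open>convex U\<close> fU]])
  then show "continuous_on C (\<lambda>x. real_of_ereal (h x))" using CU continuous_on_subset by blast
  have "compact ((\<lambda>x. real_of_ereal (h x)) ` K)"
    using compact_continuous_image[OF continuous_on_subset[OF cU KU] \<open>compact K\<close>] .
  then have "bdd_above ((\<lambda>x. real_of_ereal (h x)) ` K)"
    by (intro bounded_imp_bdd_above compact_imp_bounded)
  then obtain B where "\<forall>z\<in>K. real_of_ereal (h z) \<le> B" by (auto simp: bdd_above_def)
  then have "\<forall>z\<in>K. h z \<le> ereal B" using fU KU
    by (metis (no_types, lifting) ereal_less_eq(3) ereal_real subsetD)
  then show "\<exists>B. \<forall>z\<in>fatten (e / 2) C. h z \<le> ereal B" using KF by auto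
qed

text \<open>
  Lower semicontinuity gives a real lower bound near each point, and compactness makes finitely many
  of them sufficient.
\<close>

lemma lsc_on_compact_bounded_below:
  fixes h :: "'a::metric_space \<Rightarrow> ereal"
  assumes lsc: "lsc_on S h" and S: "compact S" and low: "\<And>x. x \<in> S \<Longrightarrow> h x \<noteq> -\<infinity>"
  obtains b where "\<And>x. x \<in> S \<Longrightarrow> ereal b \<le> h x"
proof -
  have "\<exists>c::real. \<exists>V. open V \<and> x \<in> V \<and> (\<forall>y\<in>S \<inter> V. ereal c < h y)" if x: "x \<in> S" for x
  proof -
    obtain c where c: "ereal c < h x"
      using low[OF x] by (metis ereal_infty_less(2) ereal_dense2)
    then have "ereal c < Liminf (at x within S) h" using lsc x unfolding lsc_on_def
      by (meson order_less_le_trans)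
    then have "\<forall>\<^sub>F y in at x within S. ereal c < h y" by (rule less_LiminfD)
    then obtain V where "open V" "x \<in> V" "\<forall>y\<in>V. y \<noteq> x \<longrightarrow> y \<in> S \<longrightarrow> ereal c < h y"
      unfolding eventually_at_topological by auto
    then show ?thesis using c by (intro exI[of _ c] exI[of _ V]) auto
  qed
  then obtain c V where cV: "\<And>x. x \<in> S \<Longrightarrow> open (V x) \<and> x \<in> V x \<and> (\<forall>y\<in>S \<inter> V x. ereal (c x) < h y)"
    by metis
  have "S \<subseteq> (\<Union>x\<in>S. V x)" using cV by blast
  then obtain F where F: "F \<subseteq> S" "finite F" "S \<subseteq> (\<Union>x\<in>F. V x)"
    using compactE_image[OF S, of S V] cV by metis
  show thesis
  proof (rule that[of "Min (insert 0 (c ` F))"])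
    fix x assume x: "x \<in> S"
    then obtain z where z: "z \<in> F" "x \<in> V z" using F by blast
    then have "Min (insert 0 (c ` F)) \<le> c z" using F(2) by (intro Min_le) auto
    moreover have "ereal (c z) < h x" using cV[of z] F z x by blast
    ultimately show "ereal (Min (insert 0 (c ` F))) \<le> h x" by (meson ereal_less_eq(3) order.strict_implies_order order_trans)
  qed
qed


section \<open>Limits on compact sets\<close>

text \<open>
  Turns a bound at accumulation points into an asymptotic bound along the whole sequence: a violating
  subsequence would accumulate at a point where \<open>g\<close> is still too large.
\<close>

lemma eventually_le_if_accumulation_le:
  fixes g :: "'a::metric_space \<Rightarrow> real"
  assumes K: "compact K" and g: "continuous_on K g" and x: "\<forall>\<^sub>F k in sequentially. x k \<in> K"
    and acc: "\<And>z. z \<in> K \<Longrightarrow> (\<And>\<epsilon>. \<epsilon> > 0 \<Longrightarrow> \<exists>\<^sub>F k in sequentially. dist (x k) z < \<epsilon>) \<Longrightarrow> g z \<le> c"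
    and \<eta>: "\<eta> > 0"
  shows "\<forall>\<^sub>F k in sequentially. g (x k) \<le> c + \<eta>"
proof (rule ccontr)
  assume "\<not> ?thesis"
  then have "\<exists>\<^sub>F k in sequentially. \<not> g (x k) \<le> c + \<eta>" by (simp add: not_eventually)
  then have "\<exists>\<^sub>F k in sequentially. x k \<in> K \<and> \<not> g (x k) \<le> c + \<eta>"
    using x by (rule frequently_eventually_conj)
  then have inf: "infinite {k. x k \<in> K \<and> \<not> g (x k) \<le> c + \<eta>}"
    unfolding cofinite_eq_sequentially[symmetric] frequently_cofinite .
  define r where "r = enumerate {k. x k \<in> K \<and> \<not> g (x k) \<le> c + \<eta>}"
  have r: "strict_mono r" "\<And>i. \<not> g (x (r i)) \<le> c + \<eta>" "\<And>i. x (r i) \<in> K"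
    using enumerate_in_set[OF inf] strict_mono_enumerate[OF inf] by (auto simp: r_def)
  obtain z s where z: "z \<in> K" "strict_mono s" "((\<lambda>i. x (r i)) \<circ> s) \<longlonglongrightarrow> z"
    using K r(3) unfolding compact_def by metis
  have "g z \<le> c"
  proof (rule acc[OF z(1)])
    fix \<epsilon> :: real assume "\<epsilon> > 0"
    then have ev: "\<forall>\<^sub>F i in sequentially. dist (x (r (s i))) z < \<epsilon>"
      using z(3) by (auto simp: tendsto_iff)
    have "strict_mono (r \<circ> s)" using r z by (simp add: strict_mono_o)
    show "\<exists>\<^sub>F k in sequentially. dist (x k) z < \<epsilon>"
      unfolding frequently_sequentially
    proof
      fix N
      obtain i where "i \<ge> N" "dist (x (r (s i))) z < \<epsilon>"
        using ev unfolding eventually_sequentially by (metis nat_le_linear)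
      moreover have "r (s i) \<ge> i" using seq_suble[OF \<open>strict_mono (r \<circ> s)\<close>, of i] by simp
      ultimately show "\<exists>n\<ge>N. dist (x n) z < \<epsilon>" by (meson le_trans)
    qed
  qed
  moreover have "(\<lambda>i. g (x (r (s i)))) \<longlonglongrightarrow> g z"
    using continuous_on_tendsto_compose[OF g z(3) z(1)] r(3) by (simp add: o_def)
  then have "c + \<eta> \<le> g z"
    by (rule tendsto_lowerbound) (use r(2) in \<open>auto intro!: always_eventually less_imp_le simp: not_le\<close>)
  ultimately show False using \<eta> by linarith
qed

lemma frequently_dist_subseq:
  assumes "strict_mono (r :: nat \<Rightarrow> nat)" "(\<lambda>i. x (r i)) \<longlonglongrightarrow> z" "\<epsilon> > 0"
  shows "\<exists>\<^sub>F k in sequentially. dist (x k) z < \<epsilon>"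
  unfolding frequently_sequentially
proof
  fix N
  obtain i where "i \<ge> N" "dist (x (r i)) z < \<epsilon>"
    using assms(2,3) unfolding tendsto_iff eventually_sequentially by (metis nat_le_linear)
  moreover have "r i \<ge> i" using seq_suble[OF assms(1), of i] .
  ultimately show "\<exists>n\<ge>N. dist (x n) z < \<epsilon>" by (meson le_trans)
qed

text \<open>
  The limit inherits the Lipschitz constant, so closeness on a finite \<open>\<rho>\<close>-net controls the
  distance everywhere.
\<close>

lemma uniform_limit_mono_lipschitz:
  fixes f :: "nat \<Rightarrow> 'a::metric_space \<Rightarrow> real"
  assumes K: "compact K" and mono: "\<And>x k. x \<in> K \<Longrightarrow> f k x \<le> f (Suc k) x"
    and bd: "\<And>x k. x \<in> K \<Longrightarrow> f k x \<le> B x"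
    and lip: "\<And>k. L-lipschitz_on K (f k)"
  shows "uniform_limit K f (\<lambda>x. SUP k. f k x) sequentially"
    and "continuous_on K (\<lambda>x. SUP k. f k x)"
    and "\<And>x k. x \<in> K \<Longrightarrow> f k x \<le> (SUP k. f k x)"
proof -
  define F where "F x = (SUP k. f k x)" for x
  have inc: "incseq (\<lambda>k. f k x)" if "x \<in> K" for x using mono[OF that] by (rule incseq_SucI)
  have bdd: "bdd_above (range (\<lambda>k. f k x))" if "x \<in> K" for x using bd[OF that] by (auto simp: bdd_above_def)
  have lim: "(\<lambda>k. f k x) \<longlonglongrightarrow> F x" if "x \<in> K" for x
    unfolding F_def by (rule LIMSEQ_incseq_SUP[OF bdd[OF that] inc[OF that]])
  have le: "f k x \<le> F x" if "x \<in> K" for x k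
    unfolding F_def by (rule cSUP_upper[OF _ bdd[OF that]]) simp
  have L0: "L \<ge> 0" using lip[of 0] by (simp add: lipschitz_on_def)
  have lipF: "\<bar>F x - F y\<bar> \<le> L * dist x y" if "x \<in> K" "y \<in> K" for x y
  proof (rule tendsto_upperbound)
    show "(\<lambda>k. \<bar>f k x - f k y\<bar>) \<longlonglongrightarrow> \<bar>F x - F y\<bar>" by (intro tendsto_intros lim that)
    show "\<forall>\<^sub>F k in sequentially. \<bar>f k x - f k y\<bar> \<le> L * dist x y"
      using lipschitz_onD[OF lip that] by (simp add: dist_real_def)
  qed simp
  show "uniform_limit K f (\<lambda>x. SUP k. f k x) sequentially"
    unfolding F_def[symmetric]
  proof (rule uniform_limitI)
    fix \<epsilon> :: real assume \<epsilon>: "\<epsilon> > 0"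
    define \<rho> where "\<rho> = \<epsilon> / (4 * (L + 1))"
    have \<rho>: "\<rho> > 0" "L * \<rho> < \<epsilon> / 3"
      using \<epsilon> L0 by (auto simp: \<rho>_def field_simps intro: add_nonneg_pos)
    obtain N where N: "finite N" "N \<subseteq> K" "K \<subseteq> (\<Union>x\<in>N. ball x \<rho>)"
      using compactE_image[OF K, of K "\<lambda>x. ball x \<rho>"] \<rho>(1) by force
    have "\<forall>\<^sub>F k in sequentially. \<forall>x\<in>N. dist (f k x) (F x) < \<epsilon> / 3"
      by (intro eventually_ball_finite ballI N tendstoD[OF lim]) (use N \<epsilon> in auto)
    then show "\<forall>\<^sub>F k in sequentially. \<forall>x\<in>K. dist (f k x) (F x) < \<epsilon>"
    proof eventually_elim
      case (elim k)
      show ?case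
      proof
        fix x assume x: "x \<in> K"
        then obtain y where y: "y \<in> N" "dist y x < \<rho>" using N(3) by auto
        have "L * dist y x \<le> L * \<rho>" using y L0 by (intro mult_left_mono) auto
        then have "\<bar>F x - F y\<bar> < \<epsilon> / 3" "\<bar>f k x - f k y\<bar> < \<epsilon> / 3"
          using lipF[of x y] lipschitz_onD[OF lip, of x y k] x y N(2) \<rho>(2)
          by (auto simp: dist_commute dist_real_def subset_eq intro: order_le_less_trans)
        moreover have "\<bar>f k y - F y\<bar> < \<epsilon> / 3" using elim y by (simp add: dist_real_def)
        ultimately show "dist (f k x) (F x) < \<epsilon>" unfolding dist_real_def by linarith
      qed
    qed
  qed
  have "L-lipschitz_on K F" using lipF L0 by (auto simp: lipschitz_on_def dist_real_def)
  then show "continuous_on K (\<lambda>x. SUP k. f k x)"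
    unfolding F_def[symmetric] by (rule lipschitz_on_continuous_on)
  show "f k x \<le> (SUP k. f k x)" if "x \<in> K" for x k using le[OF that] by (simp add: F_def)
qed

lemma limsup_ereal_le:
  assumes "\<And>\<eta>. \<eta> > 0 \<Longrightarrow> \<forall>\<^sub>F k in sequentially. u k \<le> ereal (c + \<eta>)"
  shows "limsup u \<le> ereal c"
proof (rule ereal_le_epsilon2[rule_format])
  fix \<eta> :: real assume "0 < \<eta>"
  then show "limsup u \<le> ereal c + ereal \<eta>"
    using Limsup_bounded[OF assms[of \<eta>]] by simp
qed

lemma le_liminf_ereal:
  assumes "\<And>\<eta>. \<eta> > 0 \<Longrightarrow> \<forall>\<^sub>F k in sequentially. ereal (c - \<eta>) \<le> u k"
  shows "ereal c \<le> liminf u"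
proof (rule ereal_le_epsilon2[rule_format])
  fix \<eta> :: real assume "0 < \<eta>"
  then have "ereal (c - \<eta>) \<le> liminf u"
    using Liminf_bounded[OF assms[of \<eta>]] by simp
  then show "ereal c \<le> liminf u + ereal \<eta>" by (cases "liminf u") auto
qed
lemma convex_on_max:
  assumes "convex_on S f" "convex_on S g"
  shows "convex_on S (\<lambda>x. max (f x) (g x :: real))"
  unfolding convex_on_def
proof (intro conjI ballI allI impI)
  show "convex S" using assms by (simp add: convex_on_def)
  fix x y and u v :: real assume a: "x \<in> S" "y \<in> S" "0 \<le> u" "0 \<le> v" "u + v = 1"
  have "u * f x + v * f y \<le> u * max (f x) (g x) + v * max (f y) (g y)"
    "u * g x + v * g y \<le> u * max (f x) (g x) + v * max (f y) (g y)"
    using a by (auto intro!: add_mono mult_left_mono)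
  moreover have "f (u *\<^sub>R x + v *\<^sub>R y) \<le> u * f x + v * f y" "g (u *\<^sub>R x + v *\<^sub>R y) \<le> u * g x + v * g y"
    using assms a by (auto simp: convex_on_def)
  ultimately show "max (f (u *\<^sub>R x + v *\<^sub>R y)) (g (u *\<^sub>R x + v *\<^sub>R y)) \<le> u * max (f x) (g x) + v * max (f y) (g y)"
    by linarith
qed

lemma convex_on_affine:
  assumes "convex S"
  shows "convex_on S (\<lambda>x. c + v \<bullet> x :: real)"
  unfolding convex_on_def
proof (intro conjI ballI allI impI assms)
  fix x y and a b :: real assume "a + b = 1"
  then have "a * c + b * c = c" by (metis distrib_right mult_1)
  then show "c + v \<bullet> (a *\<^sub>R x + b *\<^sub>R y) \<le> a * (c + v \<bullet> x) + b * (c + v \<bullet> y)"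
    by (simp add: inner_add_right algebra_simps)
qed

lemma lipschitz_on_affine:
  assumes "norm v \<le> L"
  shows "L-lipschitz_on S (\<lambda>x. c + v \<bullet> x :: real)"
proof (rule lipschitz_onI)
  show "0 \<le> L" using assms norm_ge_zero order_trans by blast
  fix x y
  have "\<bar>v \<bullet> (x - y)\<bar> \<le> norm v * norm (x - y)" by (rule Cauchy_Schwarz_ineq2)
  also have "\<dots> \<le> L * norm (x - y)" using assms by (intro mult_right_mono) auto
  finally show "dist (c + v \<bullet> x) (c + v \<bullet> y) \<le> L * dist x y"
    by (simp add: dist_real_def dist_norm inner_diff_right)
qed

lemma lipschitz_on_max:
  assumes "L-lipschitz_on S f" "L-lipschitz_on S g"
  shows "L-lipschitz_on S (\<lambda>x. max (f x) (g x) :: real)"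
proof (rule lipschitz_onI)
  show "0 \<le> L" using assms lipschitz_on_nonneg by blast
  fix x y assume "x \<in> S" "y \<in> S"
  then show "dist (max (f x) (g x)) (max (f y) (g y)) \<le> L * dist x y"
    using lipschitz_onD[OF assms(1), of x y] lipschitz_onD[OF assms(2), of x y] unfolding dist_real_def
    by linarith
qed


section \<open>A conditional Borel--Cantelli argument\<close>

text \<open>
  Here \<open>A k\<close> is an opportunity that is known before the experiment \<open>E k\<close>, and the experiment
  succeeds with probability \<open>p\<close> independently of that knowledge. Infinitely many opportunities then
  almost surely include infinitely many successes: that there are more than \<open>r\<close> opportunities and
  the first \<open>r\<close> of them fail has probability at most \<open>(1 - p) ^ r\<close>, since each opportunity
  contributes a fresh factor.
\<close>

lemma (in prob_space) infinitely_often_hit: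
  fixes A E :: "nat \<Rightarrow> 'a set" and p :: real
  assumes p: "p > 0"
    and filt: "\<And>k. k \<ge> 1 \<Longrightarrow> \<exists>F. subalgebra M F \<and> (\<forall>j\<in>{1..<k}. E j \<in> sets F)
        \<and> (\<forall>j\<in>{1..k}. A j \<in> sets F) \<and> (\<forall>D\<in>sets F. prob (D \<inter> E k) = prob D * p)"
    and E: "\<And>k. k \<ge> 1 \<Longrightarrow> E k \<in> events"
  shows "AE \<omega> in M. (\<exists>\<^sub>F k in sequentially. \<omega> \<in> A k) \<longrightarrow> (\<exists>\<^sub>F k in sequentially. \<omega> \<in> A k \<inter> E k)"
proof -
  have A: "A k \<in> events" if "k \<ge> 1" for k
    using filt[OF that] that by (auto simp: subalgebra_def)
  have p1: "p \<le> 1"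
  proof -
    obtain F where F: "subalgebra M F" "\<forall>D\<in>sets F. prob (D \<inter> E 1) = prob D * p"
      using filt[of 1] by auto
    have "space M \<in> sets F" using F(1) sets.top[of F] by (simp add: subalgebra_def)
    then have "p = prob (space M \<inter> E 1)" using F(2) by (auto simp: prob_space)
    then show ?thesis by simp
  qed
  have "AE \<omega> in M. \<not> ((\<exists>\<^sub>F k in sequentially. \<omega> \<in> A k) \<and> (\<forall>k\<ge>m. \<omega> \<notin> A k \<inter> E k))" if m: "m \<ge> 1" for m
  proof -
    \<comment> \<open>\<open>k\<close> is opportunity number \<open>r + 1\<close> from time \<open>m\<close> on, and the first \<open>r\<close> opportunities failed\<close>
    define D where "D r k = {\<omega> \<in> A k. card {j\<in>{m..<k}. \<omega> \<in> A j} = r \<and> (\<forall>j\<in>{m..<k}. \<omega> \<in> A j \<longrightarrow> \<omega> \<notin> E j)}" for r k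
    have DF: "\<exists>F. subalgebra M F \<and> D r k \<in> sets F \<and> (\<forall>D\<in>sets F. prob (D \<inter> E k) = prob D * p)"
      if k: "k \<ge> m" for r k
    proof -
      have "k \<ge> 1" using k m by simp
      obtain F where F: "subalgebra M F" "\<forall>j\<in>{1..<k}. E j \<in> sets F" "\<forall>j\<in>{1..k}. A j \<in> sets F"
         "\<forall>D\<in>sets F. prob (D \<inter> E k) = prob D * p" using filt[OF \<open>k \<ge> 1\<close>] by blast
      have sF: "space F = space M" using F(1) by (simp add: subalgebra_def)
      have [measurable]: "Measurable.pred F (\<lambda>\<omega>. \<omega> \<in> A j)" if "j \<in> {1..k}" for j
        using F(3) that by measurable
      have [measurable]: "Measurable.pred F (\<lambda>\<omega>. \<omega> \<in> E j)" if "j \<in> {1..<k}" for j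
        using F(2) that by measurable
      have eq: "card {j\<in>{m..<k}. \<omega> \<in> A j} = (\<Sum>j\<in>{m..<k}. if \<omega> \<in> A j then 1 else 0)" for \<omega>
        by (simp add: sum.If_cases Int_def)
      have [measurable]: "(\<lambda>\<omega>. \<Sum>j\<in>{m..<k}. if \<omega> \<in> A j then 1 else (0::nat)) \<in> measurable F (count_space UNIV)"
        using m k by (intro measurable_sum_nat measurable_If) auto
      have Ak: "A k \<in> sets F" using F(3) \<open>k \<ge> 1\<close> by auto
      have "Measurable.pred F (\<lambda>\<omega>. \<omega> \<in> A k \<and> (\<Sum>j\<in>{m..<k}. if \<omega> \<in> A j then 1 else (0::nat)) = r
          \<and> (\<forall>j\<in>{m..<k}. \<omega> \<in> A j \<longrightarrow> \<omega> \<notin> E j))"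
        using m k by (intro pred_intros_logic pred_intros_finite) (auto intro: measurable_compose)
      then have "{\<omega> \<in> space F. \<omega> \<in> A k \<and> (\<Sum>j\<in>{m..<k}. if \<omega> \<in> A j then 1 else (0::nat)) = r
          \<and> (\<forall>j\<in>{m..<k}. \<omega> \<in> A j \<longrightarrow> \<omega> \<notin> E j)} \<in> sets F" by measurable
      also have "{\<omega> \<in> space F. \<omega> \<in> A k \<and> (\<Sum>j\<in>{m..<k}. if \<omega> \<in> A j then 1 else (0::nat)) = r
          \<and> (\<forall>j\<in>{m..<k}. \<omega> \<in> A j \<longrightarrow> \<omega> \<notin> E j)} = D r k"
        unfolding D_def eq using sets.sets_into_space[OF Ak] by auto
      finally show ?thesis using F by blast
    qed
    have Dev: "D r k \<in> events" if "k \<ge> m" for r k using DF[OF that, of r] by (auto simp: subalgebra_def)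
    have Eev: "E k \<in> events" if "k \<ge> m" for k using E that m by simp
    define U where "U r = (\<Union>k. D r (m + k))" for r
    have Uev: "U r \<in> events" for r unfolding U_def using Dev by auto
    have disj: "disjoint_family (\<lambda>k. D r (m + k))" for r
    proof -
      have *: "D r (m + i) \<inter> D r (m + j) = {}" if "i < j" for i j
      proof -
        have False if "\<omega> \<in> D r (m + i)" "\<omega> \<in> D r (m + j)" for \<omega>
        proof -
          have "insert (m + i) {j\<in>{m..<m + i}. \<omega> \<in> A j} \<subseteq> {n\<in>{m..<m + j}. \<omega> \<in> A n}"
            using that \<open>i < j\<close> by (auto simp: D_def)
          then have "card (insert (m + i) {j\<in>{m..<m + i}. \<omega> \<in> A j}) \<le> card {n\<in>{m..<m + j}. \<omega> \<in> A n}"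
            by (intro card_mono) auto
          then show False using that by (auto simp: D_def)
        qed
        then show ?thesis by blast
      qed
      show ?thesis unfolding disjoint_family_on_def
        using * by (metis Int_commute linorder_neqE_nat)
    qed
    have step: "prob (U (Suc r)) \<le> (1 - p) * prob (U r)" for r
    proof -
      have sub: "U (Suc r) \<subseteq> (\<Union>k. D r (m + k) - E (m + k))"
      proof
        fix \<omega> assume "\<omega> \<in> U (Suc r)"
        then obtain k where k: "\<omega> \<in> D (Suc r) (m + k)" by (auto simp: U_def)
        let ?J = "{j\<in>{m..<m + k}. \<omega> \<in> A j}"
        have c: "card ?J = Suc r" and no: "\<forall>j\<in>{m..<m + k}. \<omega> \<in> A j \<longrightarrow> \<omega> \<notin> E j" using k by (auto simp: D_def)
        then have ne: "?J \<noteq> {}" by (metis card.empty nat.distinct(1))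
        \<comment> \<open>the last opportunity before \<open>m + k\<close>; it failed too\<close>
        define i where "i = Max ?J"
        have i: "i \<in> ?J" unfolding i_def by (rule Max_in) (use ne in auto)
        have "?J = insert i {j\<in>{m..<i}. \<omega> \<in> A j}"
        proof (intro equalityI subsetI)
          fix j assume j: "j \<in> ?J"
          then have "j \<le> i" unfolding i_def by (intro Max_ge) auto
          then show "j \<in> insert i {j\<in>{m..<i}. \<omega> \<in> A j}" using j by auto
        qed (use i in auto)
        then have "card {j\<in>{m..<i}. \<omega> \<in> A j} = r" using c by simp
        then have "\<omega> \<in> D r i - E i" using i no by (auto simp: D_def)
        moreover obtain k' where "i = m + k'" using i le_Suc_ex by auto
        ultimately show "\<omega> \<in> (\<Union>k. D r (m + k) - E (m + k))" by blast
      qed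
      have diff: "prob (D r (m + k) - E (m + k)) = (1 - p) * prob (D r (m + k))" for k
      proof -
        obtain F where F: "D r (m + k) \<in> sets F" "\<forall>D\<in>sets F. prob (D \<inter> E (m + k)) = prob D * p"
          using DF[of "m + k" r] by auto
        have "prob (D r (m + k) - E (m + k)) = prob (D r (m + k)) - prob (D r (m + k) \<inter> E (m + k))"
          using finite_measure_Diff'[of "D r (m + k)" "E (m + k)"] Dev Eev by auto
        then show ?thesis using F by (simp add: algebra_simps)
      qed
      have s1: "(\<lambda>k. prob (D r (m + k))) sums prob (U r)"
        unfolding U_def by (rule finite_measure_UNION) (use Dev disj in auto)
      have s2: "(\<lambda>k. prob (D r (m + k) - E (m + k))) sums prob (\<Union>k. D r (m + k) - E (m + k))"
        by (rule finite_measure_UNION)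
           (use Dev Eev disjoint_family_subset[OF disj[of r], of "\<lambda>k. D r (m + k) - E (m + k)"] in auto)
      have "prob (U (Suc r)) \<le> prob (\<Union>k. D r (m + k) - E (m + k))"
        by (rule finite_measure_mono[OF sub]) (use Dev Eev in auto)
      also have "\<dots> = (1 - p) * prob (U r)"
        using sums_unique2[OF s2] sums_mult[OF s1, of "1 - p"] by (simp add: diff)
      finally show ?thesis .
    qed
    have pow: "prob (U r) \<le> (1 - p) ^ r" for r
    proof (induction r)
      case (Suc r)
      have "prob (U (Suc r)) \<le> (1 - p) * prob (U r)" by (rule step)
      also have "\<dots> \<le> (1 - p) * (1 - p) ^ r" using Suc p1 by (intro mult_left_mono) auto
      finally show ?case by simp
    qed simp
    define N where "N = (\<Inter>r. U r)"
    have "prob N \<le> (1 - p) ^ r" for r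
      using finite_measure_mono[OF _ Uev, of N r] pow[of r] by (force simp: N_def)
    moreover have "(\<lambda>r. (1 - p) ^ r) \<longlonglongrightarrow> 0" using p p1 by (intro LIMSEQ_realpow_zero) auto
    ultimately have "prob N \<le> 0" by (intro LIMSEQ_le_const) auto
    moreover have Nev: "N \<in> events" unfolding N_def using Uev by auto
    ultimately have "N \<in> null_sets M" by (simp add: null_setsI emeasure_eq_measure measure_le_0_iff)
    moreover have "\<omega> \<in> N" if io: "\<exists>\<^sub>F k in sequentially. \<omega> \<in> A k" and no: "\<forall>k\<ge>m. \<omega> \<notin> A k \<inter> E k" for \<omega>
    proof -
      have inf: "infinite {k. m \<le> k \<and> \<omega> \<in> A k}"
      proof -
        have "\<exists>\<^sub>F k in sequentially. m \<le> k \<and> \<omega> \<in> A k"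
          by (rule frequently_eventually_conj[OF io eventually_ge_at_top])
        then show ?thesis unfolding cofinite_eq_sequentially[symmetric] frequently_cofinite .
      qed
      have "\<omega> \<in> U r" for r
      proof -
        let ?e = "enumerate {k. m \<le> k \<and> \<omega> \<in> A k}"
        have mem: "?e i \<in> {k. m \<le> k \<and> \<omega> \<in> A k}" for i by (rule enumerate_in_set[OF inf])
        have sm: "strict_mono ?e" by (rule strict_mono_enumerate[OF inf])
        have "{j\<in>{m..<?e r}. \<omega> \<in> A j} = ?e ` {..<r}"
        proof (intro equalityI subsetI)
          fix j assume j: "j \<in> {j\<in>{m..<?e r}. \<omega> \<in> A j}"
          then obtain i where "?e i = j" using enumerate_Ex[OF inf, of j] by auto
          then show "j \<in> ?e ` {..<r}" using j sm by (auto simp: strict_mono_less)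
        next
          fix j assume "j \<in> ?e ` {..<r}"
          then show "j \<in> {j\<in>{m..<?e r}. \<omega> \<in> A j}" using mem sm by (auto simp: strict_mono_less)
        qed
        then have "card {j\<in>{m..<?e r}. \<omega> \<in> A j} = r"
          using sm by (simp add: card_image strict_mono_imp_inj_on inj_on_subset)
        then have "\<omega> \<in> D r (?e r)" using mem[of r] no by (auto simp: D_def)
        moreover obtain k where "?e r = m + k" using mem[of r] le_Suc_ex by auto
        ultimately show ?thesis unfolding U_def by auto
      qed
      then show ?thesis by (simp add: N_def)
    qed
    ultimately show ?thesis by (intro AE_I'[of N]) auto
  qed
  then have "AE \<omega> in M. \<forall>m\<ge>1. \<not> ((\<exists>\<^sub>F k in sequentially. \<omega> \<in> A k) \<and> (\<forall>k\<ge>m. \<omega> \<notin> A k \<inter> E k))"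
    by (subst AE_all_countable) auto
  then show ?thesis
  proof eventually_elim
    case (elim \<omega>)
    show ?case
    proof
      assume io: "\<exists>\<^sub>F k in sequentially. \<omega> \<in> A k"
      show "\<exists>\<^sub>F k in sequentially. \<omega> \<in> A k \<inter> E k" unfolding frequently_sequentially
      proof
        fix N :: nat
        have "\<exists>k\<ge>max 1 N. \<omega> \<in> A k \<inter> E k" using elim io by (metis max.cobounded1)
        then show "\<exists>k\<ge>N. \<omega> \<in> A k \<inter> E k" by auto
      qed
    qed
  qed
qed

section \<open>Stage problems and cost-to-go functions\<close>

text \<open>
  The hypotheses on the problem, with the radius \<open>e\<close> of the fattening made explicit.
\<close>

locale regular_msp =
  fixes P :: "('n::finite, 'q::finite, 'k::finite, 'w) msp" and e :: real
  assumes process: "process_assms P"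
    and T1: "1 \<le> horizon P"
    and e: "e > 0"
    and dec: "\<And>t. t \<in> {1..horizon P} \<Longrightarrow> dec_set P t \<noteq> {} \<and> compact (dec_set P t) \<and> convex (dec_set P t)"
    and cost_convex: "\<And>t \<zeta>. t \<in> {1..horizon P} \<Longrightarrow> \<zeta> \<in> Theta P t \<Longrightarrow> convex_fun (\<lambda>(y, z). cost P t y z \<zeta>)"
    and cost_proper: "\<And>t \<zeta>. t \<in> {1..horizon P} \<Longrightarrow> \<zeta> \<in> Theta P t \<Longrightarrow> proper_fun (\<lambda>(y, z). cost P t y z \<zeta>)"
    and cost_lsc: "\<And>t \<zeta>. t \<in> {1..horizon P} \<Longrightarrow> \<zeta> \<in> Theta P t
        \<Longrightarrow> lsc_on (dec_set P t \<times> dec_set P (t - 1)) (\<lambda>(y, z). cost P t y z \<zeta>)"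
    and cost_fin: "\<And>t \<zeta> y z. t \<in> {1..horizon P} \<Longrightarrow> \<zeta> \<in> Theta P t \<Longrightarrow> z \<in> fatten e (dec_set P (t - 1))
        \<Longrightarrow> y \<in> dec_set P t \<Longrightarrow> cost P t y z \<zeta> < \<infinity>"
    and cons_convex: "\<And>t \<zeta> i. t \<in> {1..horizon P} \<Longrightarrow> \<zeta> \<in> Theta P t \<Longrightarrow> i \<in> {1..ncons P}
        \<Longrightarrow> convex_fun (\<lambda>(y, z). cons P t i y z \<zeta>)"
    and feas_first: "feas P 1 (x_init P) (xi_first P) \<noteq> {}"
    and feas_ne: "\<And>t \<zeta> z. t \<in> {2..horizon P} \<Longrightarrow> \<zeta> \<in> Theta P t \<Longrightarrow> z \<in> fatten e (dec_set P (t - 1))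
        \<Longrightarrow> feas P t z \<zeta> \<noteq> {}"

lemma regular_msp_if_regularity_assms:
  assumes "process_assms P" "1 \<le> horizon P" "regularity_assms P"
  obtains e where "regular_msp P e"
proof -
  obtain e where e: "e > 0" and a: "\<forall>t\<in>{1..horizon P}.
         dec_set P t \<noteq> {} \<and> compact (dec_set P t) \<and> convex (dec_set P t)
       \<and> (\<forall>\<zeta>\<in>Theta P t.
             convex_fun (\<lambda>(y, z). cost P t y z \<zeta>)
           \<and> proper_fun (\<lambda>(y, z). cost P t y z \<zeta>)
           \<and> lsc_on (dec_set P t \<times> dec_set P (t - 1)) (\<lambda>(y, z). cost P t y z \<zeta>)
           \<and> (\<forall>z\<in>fatten e (dec_set P (t - 1)). dec_set P t \<subseteq> {y. cost P t y z \<zeta> < \<infinity>})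
           \<and> (\<forall>i\<in>{1..ncons P}.
                 convex_fun (\<lambda>(y, z). cons P t i y z \<zeta>)
               \<and> lsc_on (dec_set P t \<times> dec_set P (t - 1)) (\<lambda>(y, z). cons P t i y z \<zeta>)
               \<and> (\<forall>y\<in>dec_set P t. \<forall>z\<in>dec_set P (t - 1). \<bar>cons P t i y z \<zeta>\<bar> \<noteq> \<infinity>)))"
    and b: "feas P 1 (x_init P) (xi_first P) \<noteq> {}"
    and c: "\<forall>t\<in>{2..horizon P}. \<forall>\<zeta>\<in>Theta P t.
         (\<forall>z\<in>fatten e (dec_set P (t - 1)). rel_interior (dec_set P t) \<inter> feas P t z \<zeta> \<noteq> {})
       \<and> (\<exists>y\<in>rel_interior (dec_set P t). \<exists>z\<in>dec_set P (t - 1).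
             \<forall>i\<in>{1..ncons P}. cons P t i y z \<zeta> < 0)"
    using assms(3) unfolding regularity_assms_def by (elim exE conjE) (rule that)
  have "regular_msp P e"
  proof
    show "e > 0" by (rule e)
    show "cost P t y z \<zeta> < \<infinity>" if "t \<in> {1..horizon P}" "\<zeta> \<in> Theta P t"
      "z \<in> fatten e (dec_set P (t - 1))" "y \<in> dec_set P t" for t \<zeta> y z using a that by blast
    show "feas P t z \<zeta> \<noteq> {}" if "t \<in> {2..horizon P}" "\<zeta> \<in> Theta P t"
      "z \<in> fatten e (dec_set P (t - 1))" for t \<zeta> z using c that by blast
  qed (use a assms b in blast)+
  then show thesis by (rule that)
qed

context regular_msp
begin

lemma dec_set_regular:
  assumes "t \<le> horizon P"
  shows "dec_set P t \<noteq> {}" "compact (dec_set P t)" "convex (dec_set P t)"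
  using dec[of t] assms by (cases "t = 0"; auto simp: dec_set_def)+

lemma dec_set_in_fatten: "x \<in> dec_set P t \<Longrightarrow> x \<in> fatten e (dec_set P t)"
  using e unfolding fatten_def mem_Collect_eq by (intro exI[of _ x] exI[of _ 0]) auto

lemma feas_subset: "feas P t x \<zeta> \<subseteq> dec_set P t"
  by (auto simp: feas_def joint_feas_def)

lemma cost_not_MInf: "t \<in> {1..horizon P} \<Longrightarrow> \<zeta> \<in> Theta P t \<Longrightarrow> cost P t y z \<zeta> \<noteq> -\<infinity>"
  using cost_proper[of t \<zeta>] by (auto simp: proper_fun_def)

lemma cost_real:
  assumes "t \<in> {1..horizon P}" "\<zeta> \<in> Theta P t" "y \<in> dec_set P t" "z \<in> dec_set P (t - 1)"
  shows "cost P t y z \<zeta> = ereal (real_of_ereal (cost P t y z \<zeta>))"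
  using cost_fin[OF assms(1,2) dec_set_in_fatten[OF assms(4)] assms(3)] cost_not_MInf[OF assms(1,2), of y z]
  by (cases "cost P t y z \<zeta>") auto

lemma cost_bounded_below:
  assumes "t \<in> {1..horizon P}" "\<zeta> \<in> Theta P t"
  obtains b where "\<And>y z. y \<in> dec_set P t \<Longrightarrow> z \<in> dec_set P (t - 1) \<Longrightarrow> ereal b \<le> cost P t y z \<zeta>"
proof -
  have "compact (dec_set P t \<times> dec_set P (t - 1))"
    using assms by (intro compact_Times dec_set_regular) auto
  then obtain b where b: "\<And>x. x \<in> dec_set P t \<times> dec_set P (t - 1) \<Longrightarrow> ereal b \<le> (case x of (y, z) \<Rightarrow> cost P t y z \<zeta>)"
    using lsc_on_compact_bounded_below[OF cost_lsc[OF assms]] cost_not_MInf[OF assms] by (metis (no_types, lifting) case_prod_beta')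
  show thesis
  proof (rule that)
    fix y z assume "y \<in> dec_set P t" "z \<in> dec_set P (t - 1)"
    then show "ereal b \<le> cost P t y z \<zeta>" using b[of "(y, z)"] by simp
  qed
qed

lemma joint_feas_convex:
  assumes t: "t \<in> {1..horizon P}" and z: "\<zeta> \<in> Theta P t"
  shows "convex (joint_feas P t \<zeta>)"
proof (rule convexI)
  fix a b and u w :: real
  assume a: "a \<in> joint_feas P t \<zeta>" and b: "b \<in> joint_feas P t \<zeta>" and uw: "0 \<le> u" "0 \<le> w" "u + w = 1"
  obtain y z y' z' where ab: "a = (y, z)" "b = (y', z')" by (cases a, cases b)
  have "matA P t \<zeta> *v (u *\<^sub>R y + w *\<^sub>R y') + matB P t \<zeta> *v (u *\<^sub>R z + w *\<^sub>R z')
      = u *\<^sub>R (matA P t \<zeta> *v y + matB P t \<zeta> *v z) + w *\<^sub>R (matA P t \<zeta> *v y' + matB P t \<zeta> *v z')"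
    by (simp add: matrix_vector_right_distrib matrix_vector_mult_scaleR algebra_simps)
  also have "\<dots> = u *\<^sub>R rhs P t \<zeta> + w *\<^sub>R rhs P t \<zeta>" using a b ab by (simp add: joint_feas_def)
  also have "\<dots> = rhs P t \<zeta>" using uw by (metis scaleR_add_left scaleR_one)
  finally have lin: "matA P t \<zeta> *v (u *\<^sub>R y + w *\<^sub>R y') + matB P t \<zeta> *v (u *\<^sub>R z + w *\<^sub>R z') = rhs P t \<zeta>" .
  have "cons P t i (u *\<^sub>R y + w *\<^sub>R y') (u *\<^sub>R z + w *\<^sub>R z') \<zeta> \<le> 0" if "i \<in> {1..ncons P}" for i
    using convex_funD[OF cons_convex[OF t assms(2) that], of "(y, z)" 0 "(y', z')" 0 u w] a b ab that uw
    by (auto simp: joint_feas_def zero_ereal_def)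
  moreover have "u *\<^sub>R y + w *\<^sub>R y' \<in> dec_set P t"
    using a b ab uw dec_set_regular(3)[of t] t by (auto simp: joint_feas_def convexD)
  ultimately show "u *\<^sub>R a + w *\<^sub>R b \<in> joint_feas P t \<zeta>" using lin ab by (simp add: joint_feas_def)
qed

text \<open>
  Partial minimization of a jointly convex objective over a convex set. The infimum may fail to be
  attained or be \<open>-\<infinity>\<close>, so points within \<open>\<eta>\<close> of a real upper bound are used.
\<close>

lemma stage_val_convex:
  assumes t: "t \<in> {1..horizon P}" and \<zeta>: "\<zeta> \<in> Theta P t" and W: "convex_on (dec_set P t) W"
  shows "convex_fun (\<lambda>z. stage_val P t (\<lambda>y. ereal (W y)) z \<zeta>)"
proof (rule convex_funI, rule ereal_le_epsilon2)
  let ?v = "\<lambda>z. stage_val P t (\<lambda>y. ereal (W y)) z \<zeta>"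
  have ex: "\<exists>y\<in>feas P t z \<zeta>. cost P t y z \<zeta> \<le> ereal (r + \<eta> - W y)" if "?v z \<le> ereal r" "\<eta> > 0" for z r \<eta>
  proof -
    have "?v z < ereal (r + \<eta>)" using that by (metis ereal_less_eq(3) less_add_same_cancel1 less_ereal.simps(1) order_le_less_trans)
    then obtain y where "y \<in> feas P t z \<zeta>" "cost P t y z \<zeta> + ereal (W y) < ereal (r + \<eta>)"
      unfolding stage_val_def stage_obj_def INF_less_iff by blast
    then show ?thesis by (intro bexI[of _ y]) (cases "cost P t y z \<zeta>"; auto)
  qed
  fix z z' and r r' u w \<eta> :: real
  assume a: "?v z \<le> ereal r" "?v z' \<le> ereal r'" "0 \<le> u" "0 \<le> w" "u + w = 1" "0 < \<eta>"
  obtain y where y: "y \<in> feas P t z \<zeta>" "cost P t y z \<zeta> \<le> ereal (r + \<eta> - W y)" using ex a by blast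
  obtain y' where y': "y' \<in> feas P t z' \<zeta>" "cost P t y' z' \<zeta> \<le> ereal (r' + \<eta> - W y')" using ex a by blast
  let ?y = "u *\<^sub>R y + w *\<^sub>R y'" let ?z = "u *\<^sub>R z + w *\<^sub>R z'"
  have "?y \<in> feas P t ?z \<zeta>"
    using convexD[OF joint_feas_convex[OF t \<zeta>], of "(y, z)" "(y', z')" u w] y y' a by (simp add: feas_def)
  then have "?v ?z \<le> cost P t ?y ?z \<zeta> + ereal (W ?y)"
    unfolding stage_val_def stage_obj_def by (rule INF_lower)
  also have "\<dots> \<le> ereal (u * (r + \<eta> - W y) + w * (r' + \<eta> - W y')) + ereal (u * W y + w * W y')"
  proof (rule add_mono)
    show "cost P t ?y ?z \<zeta> \<le> ereal (u * (r + \<eta> - W y) + w * (r' + \<eta> - W y'))"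
      using convex_funD[OF cost_convex[OF t \<zeta>], of "(y, z)" _ "(y', z')" _ u w] y y' a by auto
    show "ereal (W ?y) \<le> ereal (u * W y + w * W y')"
      using W a subsetD[OF feas_subset y(1)] subsetD[OF feas_subset y'(1)] by (simp add: convex_on_def)
  qed
  also have "\<dots> = ereal (u * r + w * r' + (u + w) * \<eta>)" by (simp add: algebra_simps)
  also have "\<dots> = ereal (u * r + w * r') + ereal \<eta>" using a by simp
  finally show "?v ?z \<le> ereal (u * r + w * r') + ereal \<eta>" .
qed

lemma stage_val_mono:
  assumes "\<And>y. y \<in> dec_set P t \<Longrightarrow> V y \<le> V' y"
  shows "stage_val P t V x \<zeta> \<le> stage_val P t V' x \<zeta>"
  unfolding stage_val_def stage_obj_def
  by (rule INF_mono) (use assms feas_subset in \<open>blast intro: add_left_mono\<close>)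

lemma stage_val_cong:
  assumes "\<And>y. y \<in> dec_set P t \<Longrightarrow> V y = V' y"
  shows "stage_val P t V x \<zeta> = stage_val P t V' x \<zeta>"
  by (intro antisym stage_val_mono) (use assms in auto)

lemma stage_val_less_PInf:
  assumes "t \<in> {1..horizon P}" "\<zeta> \<in> Theta P t" "z \<in> fatten e (dec_set P (t - 1))" "feas P t z \<zeta> \<noteq> {}"
  shows "stage_val P t (\<lambda>y. ereal (W y)) z \<zeta> < \<infinity>"
proof -
  obtain y where y: "y \<in> feas P t z \<zeta>" using assms(4) by blast
  then have "cost P t y z \<zeta> < \<infinity>" using cost_fin[OF assms(1-3)] feas_subset by blast
  then have "stage_obj P t (\<lambda>y. ereal (W y)) z \<zeta> y < \<infinity>" by (simp add: stage_obj_def)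
  then show ?thesis unfolding stage_val_def INF_less_iff using y by blast
qed

lemma stage_val_ge:
  assumes "\<And>y. y \<in> dec_set P t \<Longrightarrow> ereal b \<le> cost P t y z \<zeta>" "\<And>y. y \<in> dec_set P t \<Longrightarrow> w \<le> W y"
  shows "ereal (b + w) \<le> stage_val P t (\<lambda>y. ereal (W y)) z \<zeta>"
  unfolding stage_val_def stage_obj_def
proof (rule INF_greatest)
  fix y assume "y \<in> feas P t z \<zeta>"
  then have "y \<in> dec_set P t" using feas_subset by blast
  then show "ereal (b + w) \<le> cost P t y z \<zeta> + ereal (W y)"
    unfolding plus_ereal.simps(1)[symmetric] by (intro add_mono) (use assms in auto)
qed

definition rval :: "nat \<Rightarrow> (real^'n \<Rightarrow> real) \<Rightarrow> real^'n \<Rightarrow> real^'k \<Rightarrow> real" where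
  "rval t W x \<zeta> = real_of_ereal (stage_val P t (\<lambda>y. ereal (W y)) x \<zeta>)"

lemma continuous_on_dec_set_bounded_below:
  assumes "t \<le> horizon P" "continuous_on (dec_set P t) (W :: real^'n \<Rightarrow> real)"
  obtains w where "\<And>y. y \<in> dec_set P t \<Longrightarrow> w \<le> W y"
  using continuous_attains_inf[OF dec_set_regular(2,1)[OF assms(1)] assms(2)] by blast

lemma stage_val_real:
  assumes "t \<in> {1..horizon P}" "\<zeta> \<in> Theta P t" "continuous_on (dec_set P t) W"
    "x \<in> dec_set P (t - 1)" "feas P t x \<zeta> \<noteq> {}"
  shows "stage_val P t (\<lambda>y. ereal (W y)) x \<zeta> = ereal (rval t W x \<zeta>)"
proof -
  obtain b where b: "\<And>y z. y \<in> dec_set P t \<Longrightarrow> z \<in> dec_set P (t - 1) \<Longrightarrow> ereal b \<le> cost P t y z \<zeta>"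
    using cost_bounded_below[OF assms(1,2)] by blast
  obtain w where w: "\<And>y. y \<in> dec_set P t \<Longrightarrow> w \<le> W y"
    using continuous_on_dec_set_bounded_below[of t W] assms by auto
  have "ereal (b + w) \<le> stage_val P t (\<lambda>y. ereal (W y)) x \<zeta>"
    by (rule stage_val_ge) (use b w assms in auto)
  moreover have "stage_val P t (\<lambda>y. ereal (W y)) x \<zeta> < \<infinity>"
    using stage_val_less_PInf[OF assms(1,2) dec_set_in_fatten assms(5)] assms(4) by blast
  ultimately show ?thesis unfolding rval_def by (cases "stage_val P t (\<lambda>y. ereal (W y)) x \<zeta>") auto
qed

lemma feas_ne_dec: "t \<in> {2..horizon P} \<Longrightarrow> \<zeta> \<in> Theta P t \<Longrightarrow> x \<in> dec_set P (t - 1) \<Longrightarrow> feas P t x \<zeta> \<noteq> {}"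
  using feas_ne dec_set_in_fatten by blast

text \<open>
  The effect of the fattening: the stage value is below \<open>\<infinity>\<close> around the decision set and
  above \<open>-\<infinity>\<close> on it, so it is continuous there and bounded above on a smaller fattening.
\<close>

lemma rval_continuous_convex:
  assumes t: "t \<in> {2..horizon P}" and \<zeta>: "\<zeta> \<in> Theta P t"
    and W: "convex_on (dec_set P t) W" "continuous_on (dec_set P t) W"
  shows "continuous_on (dec_set P (t - 1)) (\<lambda>x. rval t W x \<zeta>)"
    and "convex_on (dec_set P (t - 1)) (\<lambda>x. rval t W x \<zeta>)"
    and "\<exists>B. \<forall>z\<in>fatten (e / 2) (dec_set P (t - 1)). stage_val P t (\<lambda>y. ereal (W y)) z \<zeta> \<le> ereal B"
proof -
  have t1: "t \<in> {1..horizon P}" using t by auto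
  have cvx: "convex_fun (\<lambda>z. stage_val P t (\<lambda>y. ereal (W y)) z \<zeta>)" using stage_val_convex t1 \<zeta> W by blast
  have real: "stage_val P t (\<lambda>y. ereal (W y)) x \<zeta> = ereal (rval t W x \<zeta>)" if "x \<in> dec_set P (t - 1)" for x
    using stage_val_real[OF t1 \<zeta> W(2) that feas_ne_dec[OF t \<zeta> that]] .
  have D: "dec_set P (t - 1) \<noteq> {}" "compact (dec_set P (t - 1))" "convex (dec_set P (t - 1))"
    by (intro dec_set_regular; use t in auto)+
  have fin: "stage_val P t (\<lambda>y. ereal (W y)) z \<zeta> < \<infinity>" if "z \<in> fatten e (dec_set P (t - 1))" for z
    using stage_val_less_PInf[OF t1 \<zeta> that feas_ne[OF t \<zeta> that]] .
  have low: "stage_val P t (\<lambda>y. ereal (W y)) x \<zeta> > -\<infinity>" if "x \<in> dec_set P (t - 1)" for x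
    using real[OF that] by simp
  show "continuous_on (dec_set P (t - 1)) (\<lambda>x. rval t W x \<zeta>)"
    unfolding rval_def by (rule convex_fun_near_compact(1)[OF cvx D(2,3,1) e fin low])
  show "\<exists>B. \<forall>z\<in>fatten (e / 2) (dec_set P (t - 1)). stage_val P t (\<lambda>y. ereal (W y)) z \<zeta> \<le> ereal B"
    by (rule convex_fun_near_compact(2)[OF cvx D(2,3,1) e fin low])
  show "convex_on (dec_set P (t - 1)) (\<lambda>x. rval t W x \<zeta>)"
    unfolding rval_def by (rule convex_on_real_of_ereal[OF cvx D(3)]) (use real in auto)
qed

lemma rprob_nonneg: "0 \<le> rprob P t \<zeta>" by (simp add: rprob_def)

definition expected :: "nat \<Rightarrow> (real^'n \<Rightarrow> real) \<Rightarrow> real^'n \<Rightarrow> real" where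
  "expected t W x = (\<Sum>\<zeta>\<in>Theta P t. rprob P t \<zeta> * rval t W x \<zeta>)"

definition ctg :: "nat \<Rightarrow> real^'n \<Rightarrow> real" where
  "ctg t x = real_of_ereal (cost_to_go P t x)"

lemma finite_Theta: "t \<in> {2..horizon P} \<Longrightarrow> finite (Theta P t)"
  using process by (auto simp: process_assms_def)

lemma expected_continuous_convex:
  assumes t: "t \<in> {2..horizon P}" and W: "convex_on (dec_set P t) W" "continuous_on (dec_set P t) W"
  shows "continuous_on (dec_set P (t - 1)) (expected t W)" "convex_on (dec_set P (t - 1)) (expected t W)"
proof -
  show "continuous_on (dec_set P (t - 1)) (expected t W)" unfolding expected_def
    by (intro continuous_intros rval_continuous_convex(1) assms)
  have D: "convex (dec_set P (t - 1))" by (rule dec_set_regular) (use t in auto)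
  have "convex_on (dec_set P (t - 1)) (\<lambda>x. \<Sum>\<zeta>\<in>A. rprob P t \<zeta> * rval t W x \<zeta>)"
    if "finite A" "A \<subseteq> Theta P t" for A
    using that
  proof (induction A)
    case (insert a A)
    then have "convex_on (dec_set P (t - 1)) (\<lambda>x. rprob P t a * rval t W x a)"
      by (intro convex_on_cmul rprob_nonneg rval_continuous_convex(2)[OF t _ W]) auto
    then show ?case using insert by (auto intro: convex_on_add)
  qed (use D in \<open>simp add: convex_on_def\<close>)
  then show "convex_on (dec_set P (t - 1)) (expected t W)" unfolding expected_def[abs_def]
    using finite_Theta[OF t] by blast
qed

text \<open>
  Backward induction from the last stage. Continuity of the next cost-to-go function bounds it below
  on the compact decision set, which keeps the stage values of the current stage finite.
\<close>

lemma cost_to_go_regular: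
  assumes "t \<in> {2..Suc (horizon P)}"
  shows "(\<forall>x\<in>dec_set P (t - 1). cost_to_go P t x = ereal (ctg t x))
     \<and> convex_on (dec_set P (t - 1)) (ctg t) \<and> continuous_on (dec_set P (t - 1)) (ctg t)
     \<and> (t \<le> horizon P \<longrightarrow> (\<forall>x\<in>dec_set P (t - 1). ctg t x = expected t (ctg (Suc t)) x))"
proof -
  have "t \<le> Suc (horizon P)" using assms by auto
  then show ?thesis using assms
  proof (induction t rule: inc_induct)
    case base
    have "cost_to_go P (Suc (horizon P)) x = 0" for x by (simp add: cost_to_go.simps)
    then show ?case using dec_set_regular[of "horizon P"] by (auto simp: ctg_def convex_on_def)
  next
    case (step t)
    have t: "t \<in> {2..horizon P}" "t \<in> {1..horizon P}" using step by auto
    have W: "\<And>y. y \<in> dec_set P t \<Longrightarrow> cost_to_go P (Suc t) y = ereal (ctg (Suc t) y)"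
       "convex_on (dec_set P t) (ctg (Suc t))" "continuous_on (dec_set P t) (ctg (Suc t))"
      using step by auto
    have eq: "cost_to_go P t x = ereal (expected t (ctg (Suc t)) x)" if "x \<in> dec_set P (t - 1)" for x
    proof -
      have "cost_to_go P t x = (\<Sum>\<zeta>\<in>Theta P t. ereal (rprob P t \<zeta>) * stage_val P t (cost_to_go P (Suc t)) x \<zeta>)"
        using t by (subst cost_to_go.simps) auto
      also have "\<dots> = (\<Sum>\<zeta>\<in>Theta P t. ereal (rprob P t \<zeta> * rval t (ctg (Suc t)) x \<zeta>))"
      proof (rule sum.cong[OF refl])
        fix \<zeta> assume \<zeta>: "\<zeta> \<in> Theta P t"
        have "stage_val P t (cost_to_go P (Suc t)) x \<zeta> = stage_val P t (\<lambda>y. ereal (ctg (Suc t) y)) x \<zeta>"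
          by (rule stage_val_cong) (rule W)
        also have "\<dots> = ereal (rval t (ctg (Suc t)) x \<zeta>)"
          by (rule stage_val_real[OF t(2) \<zeta> W(3) that feas_ne_dec[OF t(1) \<zeta> that]])
        finally show "ereal (rprob P t \<zeta>) * stage_val P t (cost_to_go P (Suc t)) x \<zeta>
           = ereal (rprob P t \<zeta> * rval t (ctg (Suc t)) x \<zeta>)" by simp
      qed
      also have "\<dots> = ereal (expected t (ctg (Suc t)) x)" by (simp add: expected_def)
      finally show ?thesis .
    qed
    then have ctg: "ctg t x = expected t (ctg (Suc t)) x" if "x \<in> dec_set P (t - 1)" for x
      using that by (simp add: ctg_def)
    have "convex_on (dec_set P (t - 1)) (ctg t)" "continuous_on (dec_set P (t - 1)) (ctg t)"
      using expected_continuous_convex[OF t(1) W(2,3)] ctg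
      by (auto simp: convex_on_def convexD cong: continuous_on_cong)
    then show ?case using eq ctg by auto
  qed
qed

lemma expected_mono:
  assumes t: "t \<in> {2..horizon P}" and "continuous_on (dec_set P t) W" "continuous_on (dec_set P t) W'"
    and le: "\<And>y. y \<in> dec_set P t \<Longrightarrow> W y \<le> W' y" and x: "x \<in> dec_set P (t - 1)"
  shows "expected t W x \<le> expected t W' x"
  unfolding expected_def
proof (intro sum_mono mult_left_mono rprob_nonneg)
  fix \<zeta> assume \<zeta>: "\<zeta> \<in> Theta P t"
  have "stage_val P t (\<lambda>y. ereal (W y)) x \<zeta> \<le> stage_val P t (\<lambda>y. ereal (W' y)) x \<zeta>"
    by (rule stage_val_mono) (use le in simp)
  then show "rval t W x \<zeta> \<le> rval t W' x \<zeta>"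
    using stage_val_real[OF _ \<zeta> _ x feas_ne_dec[OF t \<zeta> x]] assms(1-3) by auto
qed

lemma approx_min_real:
  assumes t: "t \<in> {1..horizon P}" and \<zeta>: "\<zeta> \<in> Theta P t" and W: "continuous_on (dec_set P t) W"
    and x: "x \<in> dec_set P (t - 1)"
    and y: "approx_min d (feas P t x \<zeta>) (stage_obj P t (\<lambda>y. ereal (W y)) x \<zeta>) y"
  shows "y \<in> dec_set P t" "rval t W x \<zeta> \<le> real_of_ereal (cost P t y x \<zeta>) + W y"
    "real_of_ereal (cost P t y x \<zeta>) + W y \<le> rval t W x \<zeta> + d"
proof -
  have yf: "y \<in> feas P t x \<zeta>" using y by (simp add: approx_min_def)
  then show yd: "y \<in> dec_set P t" using feas_subset by blast
  have v: "stage_val P t (\<lambda>y. ereal (W y)) x \<zeta> = ereal (rval t W x \<zeta>)"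
    by (rule stage_val_real[OF t \<zeta> W x]) (use yf in blast)
  have o: "stage_obj P t (\<lambda>y. ereal (W y)) x \<zeta> y = ereal (real_of_ereal (cost P t y x \<zeta>) + W y)"
    unfolding stage_obj_def by (subst cost_real[OF t \<zeta> yd x]) simp
  have "stage_val P t (\<lambda>y. ereal (W y)) x \<zeta> \<le> stage_obj P t (\<lambda>y. ereal (W y)) x \<zeta> y"
    unfolding stage_val_def by (rule INF_lower[OF yf])
  then show "rval t W x \<zeta> \<le> real_of_ereal (cost P t y x \<zeta>) + W y" using v o by simp
  have "stage_obj P t (\<lambda>y. ereal (W y)) x \<zeta> y \<le> stage_val P t (\<lambda>y. ereal (W y)) x \<zeta> + ereal d"
    using y by (simp add: approx_min_def stage_val_def)
  then show "real_of_ereal (cost P t y x \<zeta>) + W y \<le> rval t W x \<zeta> + d" using v o by simp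
qed

lemma rval_le_feasible:
  assumes t: "t \<in> {1..horizon P}" and \<zeta>: "\<zeta> \<in> Theta P t" and W: "continuous_on (dec_set P t) W"
    and x: "x \<in> dec_set P (t - 1)" and y: "y \<in> feas P t x \<zeta>"
  shows "rval t W x \<zeta> \<le> real_of_ereal (cost P t y x \<zeta>) + W y"
proof -
  have v: "stage_val P t (\<lambda>y. ereal (W y)) x \<zeta> = ereal (rval t W x \<zeta>)"
    by (rule stage_val_real[OF t \<zeta> W x]) (use y in blast)
  have "stage_val P t (\<lambda>y. ereal (W y)) x \<zeta> \<le> cost P t y x \<zeta> + ereal (W y)"
    unfolding stage_val_def stage_obj_def by (rule INF_lower[OF y])
  also have "\<dots> = ereal (real_of_ereal (cost P t y x \<zeta>) + W y)"
    using feas_subset y by (subst cost_real[OF t \<zeta> _ x]) auto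
  finally show ?thesis using v by simp
qed

lemma fatten_ball: "x \<in> S \<Longrightarrow> z \<in> cball x r \<Longrightarrow> z \<in> fatten r S"
  unfolding fatten_def mem_Collect_eq
  by (intro exI[of _ x] exI[of _ "z - x"]) (auto simp: dist_norm norm_minus_commute)

text \<open>
  A subgradient of the stage value at \<open>x\<close> is feasible for the dual problem and attains the primal
  value there, so the dual optimum is not smaller than the primal one. The dual value at \<open>l\<close> is then
  at least the primal value minus \<open>d\<close>, and written out this is the subgradient inequality with the
  error \<open>d\<close>. It holds at every \<open>z\<close> of the whole space.
\<close>

lemma approx_dual_subgradient:
  assumes t: "t \<in> {2..horizon P}" and \<zeta>: "\<zeta> \<in> Theta P t"
    and W: "convex_on (dec_set P t) W" "continuous_on (dec_set P t) W"
    and x: "x \<in> dec_set P (t - 1)"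
    and l: "approx_max d (dual_fun P t (\<lambda>y. ereal (W y)) x \<zeta>) l"
  shows "ereal (rval t W x \<zeta> - d + l \<bullet> (z - x)) \<le> stage_val P t (\<lambda>y. ereal (W y)) z \<zeta>"
proof -
  have t1: "t \<in> {1..horizon P}" using t by auto
  let ?v = "\<lambda>z. stage_val P t (\<lambda>y. ereal (W y)) z \<zeta>"
  let ?d = "dual_fun P t (\<lambda>y. ereal (W y)) x \<zeta>"
  have v: "?v x = ereal (rval t W x \<zeta>)"
    by (rule stage_val_real[OF t1 \<zeta> W(2) x feas_ne_dec[OF t \<zeta> x]])
  have "?v z < \<infinity>" if "z \<in> ball x e" for z
    using stage_val_less_PInf[OF t1 \<zeta> _ feas_ne[OF t \<zeta>]] fatten_ball[OF x, of z e] that by simp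
  then obtain l0 where l0: "\<And>z. ereal (rval t W x \<zeta> + l0 \<bullet> (z - x)) \<le> ?v z"
    using convex_fun_subgradient[OF stage_val_convex[OF t1 \<zeta> W(1)] v e] by blast
  have "ereal (rval t W x \<zeta>) \<le> ?d l0"
    unfolding dual_fun_def
  proof (rule INF_greatest, clarify)
    fix y z assume "(y, z) \<in> joint_feas P t \<zeta>"
    then have "?v z \<le> stage_obj P t (\<lambda>y. ereal (W y)) z \<zeta> y"
      unfolding stage_val_def by (intro INF_lower) (simp add: feas_def)
    then have "ereal (rval t W x \<zeta> + l0 \<bullet> (z - x)) + ereal (l0 \<bullet> (x - z)) \<le> stage_obj P t (\<lambda>y. ereal (W y)) z \<zeta> y + ereal (l0 \<bullet> (x - z))"
      using l0[of z] by (intro add_right_mono) auto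
    then show "ereal (rval t W x \<zeta>) \<le> stage_obj P t (\<lambda>y. ereal (W y)) z \<zeta> y + ereal (l0 \<bullet> (x - z))"
      by (simp add: inner_diff_right)
  qed
  also have "\<dots> \<le> (SUP l. ?d l)" by (rule SUP_upper) simp
  also have "\<dots> \<le> ?d l + ereal d" using l by (simp add: approx_max_def)
  finally have dl: "ereal (rval t W x \<zeta> - d) \<le> ?d l" by (cases "?d l") auto
  show ?thesis unfolding stage_val_def
  proof (rule INF_greatest)
    fix y assume "y \<in> feas P t z \<zeta>"
    then have "?d l \<le> stage_obj P t (\<lambda>y. ereal (W y)) z \<zeta> y + ereal (l \<bullet> (x - z))"
      unfolding dual_fun_def by (intro INF_lower2[of "(y, z)"]) (auto simp: feas_def)
    then have "ereal (rval t W x \<zeta> - d) \<le> stage_obj P t (\<lambda>y. ereal (W y)) z \<zeta> y + ereal (l \<bullet> (x - z))"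
      using dl by (rule order_trans[rotated])
    then show "ereal (rval t W x \<zeta> - d + l \<bullet> (z - x)) \<le> stage_obj P t (\<lambda>y. ereal (W y)) z \<zeta> y"
      by (cases "stage_obj P t (\<lambda>y. ereal (W y)) z \<zeta> y") (auto simp: inner_diff_right)
  qed
qed

end

section \<open>The scenario tree and the sampled scenarios\<close>

context regular_msp
begin

lemma prob_space_base: "prob_space (base P)"
  using process by (simp add: process_assms_def)

lemma xi_measurable: "t \<in> {1..horizon P} \<Longrightarrow> xi P t \<in> borel_measurable (base P)"
  using process by (auto simp: process_assms_def prob_space.indep_vars_def[OF prob_space_base])

lemma Theta_first: "Theta P 1 = {xi_first P}" "rprob P 1 (xi_first P) = 1"
proof -
  interpret prob_space "base P" by (rule prob_space_base)
  have [measurable]: "xi P (Suc 0) \<in> borel_measurable (base P)" using xi_measurable[of 1] T1 by simp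
  have ae: "AE \<omega> in base P. xi P 1 \<omega> = xi_first P" using process by (simp add: process_assms_def)
  then show one: "rprob P 1 (xi_first P) = 1" unfolding rprob_def by (subst prob_Collect_eq_1) auto
  have "rprob P 1 \<zeta> = 0" if "\<zeta> \<noteq> xi_first P" for \<zeta>
    unfolding rprob_def by (subst prob_Collect_eq_0) (use ae that in auto)
  then show "Theta P 1 = {xi_first P}" using one unfolding Theta_def by force
qed

lemma finite_Theta': "t \<in> {1..horizon P} \<Longrightarrow> finite (Theta P t)"
  using finite_Theta[of t] Theta_first by (cases "t = 1") auto

lemma sum_rprob:
  assumes t: "t \<in> {1..horizon P}"
  shows "(\<Sum>\<zeta>\<in>Theta P t. rprob P t \<zeta>) = 1"
proof -
  interpret prob_space "base P" by (rule prob_space_base)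
  have [measurable]: "xi P t \<in> borel_measurable (base P)" using xi_measurable t by blast
  have ae: "AE \<omega> in base P. xi P t \<omega> \<in> Theta P t"
    using process t Theta_first by (cases "t = 1") (auto simp: process_assms_def)
  have "(\<Sum>\<zeta>\<in>Theta P t. rprob P t \<zeta>) = prob (\<Union>\<zeta>\<in>Theta P t. {\<omega> \<in> space (base P). xi P t \<omega> = \<zeta>})"
    unfolding rprob_def
    by (rule finite_measure_finite_Union[symmetric])
       (use finite_Theta'[OF t] in \<open>auto simp: disjoint_family_on_def\<close>)
  also have "(\<Union>\<zeta>\<in>Theta P t. {\<omega> \<in> space (base P). xi P t \<omega> = \<zeta>}) = {\<omega> \<in> space (base P). xi P t \<omega> \<in> Theta P t}"
    by auto
  also have "prob \<dots> = 1"
    by (subst prob_Collect_eq_1) (use ae finite_Theta'[OF t] in \<open>auto intro!: predE pred_sets2[of _ borel] finite_imp_closed borel_closed\<close>)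
  finally show ?thesis .
qed

lemma path_prob_eq_prod:
  assumes n: "length n \<le> horizon P"
  shows "path_prob P n = (\<Prod>i<length n. rprob P (Suc i) (n ! i))"
proof (cases "n = []")
  case True
  then show ?thesis using prob_space.prob_space[OF prob_space_base] by (simp add: path_prob_def)
next
  case False
  interpret prob_space "base P" by (rule prob_space_base)
  let ?E = "\<lambda>i. xi P i -` {n ! (i - 1)} \<inter> space (base P)"
  have "prob (\<Inter>i\<in>{1..length n}. ?E i) = (\<Prod>i\<in>{1..length n}. prob (?E i))"
    by (rule indep_varsD[of "\<lambda>_. borel" "xi P" "{1..horizon P}"])
       (use process n False in \<open>auto simp: process_assms_def Suc_le_eq\<close>)
  also have "(\<Inter>i\<in>{1..length n}. ?E i) = {\<omega> \<in> space (base P). \<forall>i<length n. xi P (Suc i) \<omega> = n ! i}"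
  proof -
    have *: "{1..length n} = Suc ` {..<length n}" by (simp add: image_Suc_lessThan)
    show ?thesis unfolding * using False by auto
  qed
  also have "(\<Prod>i\<in>{1..length n}. prob (?E i)) = (\<Prod>i<length n. prob (?E (Suc i)))"
    by (rule prod.reindex_bij_witness[of _ Suc "\<lambda>i. i - 1"]) auto
  also have "\<dots> = (\<Prod>i<length n. rprob P (Suc i) (n ! i))"
    unfolding rprob_def by (intro prod.cong refl arg_cong[of _ _ prob]) auto
  finally show ?thesis by (simp add: path_prob_def)
qed

lemma nodes_iff:
  assumes "t \<le> horizon P"
  shows "n \<in> nodes P t \<longleftrightarrow> length n = t \<and> (\<forall>i<t. n ! i \<in> Theta P (Suc i))"
proof (cases "length n = t")
  case True
  have "path_prob P n > 0 \<longleftrightarrow> (\<forall>i<t. rprob P (Suc i) (n ! i) > 0)"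
  proof
    assume "path_prob P n > 0"
    then have "(\<Prod>i<t. rprob P (Suc i) (n ! i)) \<noteq> 0" using path_prob_eq_prod[of n] True assms by (metis less_irrefl)
    then have "\<forall>i<t. rprob P (Suc i) (n ! i) \<noteq> 0" by (simp add: prod_zero_iff)
    then show "\<forall>i<t. rprob P (Suc i) (n ! i) > 0"
      using rprob_nonneg by (metis less_eq_real_def)
  next
    assume "\<forall>i<t. rprob P (Suc i) (n ! i) > 0"
    then show "path_prob P n > 0" using path_prob_eq_prod[of n] True assms by (auto intro: prod_pos)
  qed
  then show ?thesis using True by (simp add: nodes_def Theta_def)
qed (simp add: nodes_def)

lemma finite_nodes:
  assumes "t \<le> horizon P"
  shows "finite (nodes P t)"
proof (rule finite_subset)
  show "nodes P t \<subseteq> {n. set n \<subseteq> (\<Union>i\<in>{1..horizon P}. Theta P i) \<and> length n = t}"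
  proof
    fix n assume "n \<in> nodes P t"
    then have n: "length n = t" "\<forall>i<t. n ! i \<in> Theta P (Suc i)" using nodes_iff[OF assms] by auto
    have "a \<in> (\<Union>i\<in>{1..horizon P}. Theta P i)" if "a \<in> set n" for a
    proof -
      obtain i where "i < t" "a = n ! i" using \<open>a \<in> set n\<close> n(1) by (auto simp: in_set_conv_nth)
      then show ?thesis using n(2) assms by (intro UN_I[of "Suc i"]) auto
    qed
    then show "n \<in> {n. set n \<subseteq> (\<Union>i\<in>{1..horizon P}. Theta P i) \<and> length n = t}" using n by blast
  qed
  show "finite {n. set n \<subseteq> (\<Union>i\<in>{1..horizon P}. Theta P i) \<and> length n = t}"
    using finite_Theta' by (intro finite_lists_length_eq finite_UN_I) auto
qed

lemma append_in_nodes_iff: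
  assumes t: "t \<in> {1..horizon P}" and n: "n \<in> nodes P (t - 1)"
  shows "n @ [\<zeta>] \<in> nodes P t \<longleftrightarrow> \<zeta> \<in> Theta P t"
proof -
  obtain t' where t': "t = Suc t'" using t by (cases t) auto
  have "length n = t'" "\<forall>i<t'. n ! i \<in> Theta P (Suc i)"
    using n nodes_iff[of t' n] t t' by auto
  then show ?thesis using nodes_iff[of t "n @ [\<zeta>]"] t t' by (auto simp: nth_append less_Suc_eq)
qed

lemma children_eq:
  assumes t: "t \<in> {1..horizon P}" and n: "n \<in> nodes P (t - 1)"
  shows "children P n = (\<lambda>\<zeta>. n @ [\<zeta>]) ` Theta P t"
proof -
  have len: "Suc (length n) = t" using n t by (simp add: nodes_def)
  show ?thesis
  proof (intro equalityI subsetI)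
    fix m assume "m \<in> children P n"
    then have m: "m \<in> nodes P t" "butlast m = n" using len by (auto simp: children_def)
    then have "m \<noteq> []" using t by (auto simp: nodes_def)
    then have eq: "m = n @ [last m]" using m(2) by auto
    then have "last m \<in> Theta P t" using append_in_nodes_iff[OF t n, of "last m"] m(1) by simp
    then show "m \<in> (\<lambda>\<zeta>. n @ [\<zeta>]) ` Theta P t" using eq by blast
  next
    fix m assume "m \<in> (\<lambda>\<zeta>. n @ [\<zeta>]) ` Theta P t"
    then show "m \<in> children P n" using append_in_nodes_iff[OF t n] len by (auto simp: children_def)
  qed
qed

lemma trans_prob_append:
  assumes t: "t \<in> {1..horizon P}" and n: "n \<in> nodes P (t - 1)"
  shows "trans_prob P (n @ [\<zeta>]) = rprob P t \<zeta>"
proof -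
  have len: "Suc (length n) = t" and pos: "path_prob P n > 0" using n t by (auto simp: nodes_def)
  have "path_prob P (n @ [\<zeta>]) = path_prob P n * rprob P t \<zeta>"
    using path_prob_eq_prod[of "n @ [\<zeta>]"] path_prob_eq_prod[of n] len t
    by (auto simp: nth_append)
  then show ?thesis using pos by (simp add: trans_prob_def)
qed

lemma sum_children:
  assumes t: "t \<in> {1..horizon P}" and n: "n \<in> nodes P (t - 1)"
  shows "(\<Sum>m\<in>children P n. f m) = (\<Sum>\<zeta>\<in>Theta P t. f (n @ [\<zeta>]))"
  unfolding children_eq[OF assms] by (simp add: sum.reindex inj_on_def)

lemma node_first:
  assumes "t \<in> {1..horizon P}" "n \<in> nodes P t"
  shows "n ! 0 = xi_first P"
proof -
  have "n ! 0 \<in> Theta P (Suc 0)" using nodes_iff[of t n] assms by auto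
  then show ?thesis using Theta_first(1) by simp
qed

text \<open>
  For a set \<open>B\<close> of a countable base, a decision in \<open>B\<close> is the opportunity and a scenario through
  \<open>n\<close> the success in \<open>infinitely_often_hit\<close>. Countability allows one null set for all \<open>B\<close>, and
  small sets \<open>B\<close> around \<open>z\<close> give the claim for all points \<open>z\<close> at once.
\<close>

lemma accumulation_at_sampled_iterations:
  assumes sampling: "sampling_assms P M S" and before: "nonanticipative P M S X"
    and t: "t \<in> {1..horizon P}" and n: "n \<in> nodes P t"
  shows "AE \<omega> in M. \<forall>z. (\<forall>\<epsilon>>0. \<exists>\<^sub>F k in sequentially. dist (X k n \<omega>) z < \<epsilon>) \<longrightarrow>
     (\<forall>\<epsilon>>0. \<exists>\<^sub>F k in sequentially. dist (X k n \<omega>) z < \<epsilon> \<and> n = map (\<lambda>i. S k i \<omega>) [1..<Suc t])"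
proof -
  define N where "N = PiM {2..horizon P} (\<lambda>_. borel :: (real^'k) measure)"
  define G where "G = {f \<in> space N. \<forall>i\<in>{2..t}. f i = n ! (i - 1)}"
  interpret M: prob_space M using sampling by (simp add: sampling_assms_def)
  interpret b: prob_space "base P" by (rule prob_space_base)
  have comp [measurable]: "(\<lambda>f. f i) \<in> borel_measurable N" if "i \<in> {2..t}" for i
    unfolding N_def using that t by (intro measurable_component_singleton) auto
  have G: "G \<in> sets N" unfolding G_def by measurable
  have scen_M: "scenario P (S k) \<in> measurable M N" if "k \<ge> 1" for k
    using sampling that unfolding sampling_assms_def N_def M.indep_vars_def by auto
  have scen_b: "scenario P (xi P) \<in> measurable (base P) N"
    unfolding N_def scenario_def[abs_def] by (intro measurable_restrict xi_measurable) auto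
  \<comment> \<open>all iterations sample the node with the same probability, that of the node in the tree, up to the deterministic first stage\<close>
  define p where "p = b.prob (scenario P (xi P) -` G \<inter> space (base P))"
  define E where "E k = scenario P (S k) -` G \<inter> space M" for k
  have E_prob: "M.prob (E k) = p" if k: "k \<ge> 1" for k
  proof -
    have "M.prob (E k) = measure (distr M N (scenario P (S k))) G"
      unfolding E_def by (rule measure_distr[OF scen_M[OF k] G, symmetric])
    also have "distr M N (scenario P (S k)) = distr (base P) N (scenario P (xi P))"
      using sampling k by (simp add: sampling_assms_def N_def)
    also have "measure \<dots> G = p" unfolding p_def by (rule measure_distr[OF scen_b G])
    finally show ?thesis .
  qed
  have "0 < path_prob P n" using n by (simp add: nodes_def)
  also have "\<dots> \<le> p" unfolding path_prob_def p_def
  proof (rule b.finite_measure_mono)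
    have len: "length n = t" using n by (simp add: nodes_def)
    show "{\<omega> \<in> space (base P). \<forall>i<length n. xi P (Suc i) \<omega> = n ! i} \<subseteq> scenario P (xi P) -` G \<inter> space (base P)"
    proof
      fix \<omega> assume \<omega>: "\<omega> \<in> {\<omega> \<in> space (base P). \<forall>i<length n. xi P (Suc i) \<omega> = n ! i}"
      have "scenario P (xi P) \<omega> i = n ! (i - 1)" if "i \<in> {2..t}" for i
      proof -
        have "\<forall>j<length n. xi P (Suc j) \<omega> = n ! j" using \<omega> by blast
        moreover have "i - 1 < length n" "Suc (i - 1) = i" using that len by auto
        ultimately have "xi P i \<omega> = n ! (i - 1)" by metis
        then show ?thesis using that t by (simp add: scenario_def)
      qed
      then show "\<omega> \<in> scenario P (xi P) -` G \<inter> space (base P)"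
        using \<omega> measurable_space[OF scen_b] by (auto simp: G_def)
    qed
    show "scenario P (xi P) -` G \<inter> space (base P) \<in> b.events" using scen_b G by (rule measurable_sets)
  qed
  finally have p: "p > 0" .
  have E_events: "E k \<in> M.events" if "k \<ge> 1" for k
    unfolding E_def by (rule measurable_sets[OF scen_M[OF that] G])
  obtain \<B> :: "(real^'n) set set" where \<B>: "countable \<B>" "topological_basis \<B>"
    using ex_countable_basis by blast
  have "AE \<omega> in M. (\<exists>\<^sub>F k in sequentially. \<omega> \<in> X k n -` B \<inter> space M) \<longrightarrow>
      (\<exists>\<^sub>F k in sequentially. \<omega> \<in> (X k n -` B \<inter> space M) \<inter> E k)" if B: "B \<in> \<B>" for B
  proof (rule M.infinitely_often_hit[OF p])
    fix k :: nat assume k: "k \<ge> 1"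
    obtain F where F: "subalgebra M F"
      "\<forall>j\<in>{1..<k}. scenario P (S j) \<in> measurable F N"
      "\<forall>j\<in>{1..k}. \<forall>t\<in>{1..horizon P}. \<forall>n\<in>nodes P t. X j n \<in> borel_measurable F"
      "M.indep_set (sets F) (sets (vimage_algebra (space M) (scenario P (S k)) N))"
      using before k unfolding nonanticipative_def N_def by blast
    have sp: "space F = space M" using F(1) by (simp add: subalgebra_def)
    have Bs: "B \<in> sets borel" using topological_basis_open[OF \<B>(2) B] by auto
    have "E k \<in> sets (vimage_algebra (space M) (scenario P (S k)) N)"
      unfolding E_def using G by (rule in_vimage_algebra)
    then have "\<forall>D\<in>sets F. M.prob (D \<inter> E k) = M.prob D * p"
      using M.indep_setD[OF F(4)] E_prob[OF k] by simp
    moreover have "\<forall>j\<in>{1..<k}. E j \<in> sets F"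
      using F(2) measurable_sets[OF _ G] sp unfolding E_def by metis
    moreover have "\<forall>j\<in>{1..k}. X j n -` B \<inter> space M \<in> sets F"
      using F(3) t n measurable_sets[OF _ Bs] sp by metis
    ultimately show "\<exists>F. subalgebra M F \<and> (\<forall>j\<in>{1..<k}. E j \<in> sets F)
        \<and> (\<forall>j\<in>{1..k}. X j n -` B \<inter> space M \<in> sets F) \<and> (\<forall>D\<in>sets F. M.prob (D \<inter> E k) = M.prob D * p)"
      using F(1) by blast
  qed (rule E_events)
  then have hit: "AE \<omega> in M. \<forall>B\<in>\<B>. (\<exists>\<^sub>F k in sequentially. \<omega> \<in> X k n -` B \<inter> space M) \<longrightarrow>
      (\<exists>\<^sub>F k in sequentially. \<omega> \<in> (X k n -` B \<inter> space M) \<inter> E k)"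
    by (subst AE_ball_countable[OF \<B>(1)]) auto
  have "AE \<omega> in M. \<forall>k\<in>{1..}. S k 1 \<omega> = xi_first P"
    using sampling by (subst AE_ball_countable) (auto simp: sampling_assms_def)
  then show ?thesis using hit AE_space
  proof eventually_elim
    case (elim \<omega>)
    show ?case
    proof (intro allI impI)
      fix z and \<epsilon> :: real assume acc: "\<forall>\<epsilon>>0. \<exists>\<^sub>F k in sequentially. dist (X k n \<omega>) z < \<epsilon>" and \<epsilon>: "0 < \<epsilon>"
      obtain B where B: "B \<in> \<B>" "z \<in> B" "B \<subseteq> ball z \<epsilon>"
        using topological_basisE[OF \<B>(2) open_ball, of z z \<epsilon>] \<epsilon> by auto
      obtain r where r: "r > 0" "ball z r \<subseteq> B"
        using topological_basis_open[OF \<B>(2) B(1)] B(2) open_contains_ball by blast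
      have "\<exists>\<^sub>F k in sequentially. \<omega> \<in> X k n -` B \<inter> space M"
        by (rule frequently_elim1[OF acc[rule_format, OF r(1)]])
           (use r(2) elim(3) in \<open>auto simp: dist_commute subset_eq\<close>)
      then have "\<exists>\<^sub>F k in sequentially. \<omega> \<in> (X k n -` B \<inter> space M) \<inter> E k" using elim(2) B(1) by blast
      then have "\<exists>\<^sub>F k in sequentially. 1 \<le> k \<and> \<omega> \<in> (X k n -` B \<inter> space M) \<inter> E k"
        by (rule frequently_eventually_conj) (rule eventually_ge_at_top)
      then show "\<exists>\<^sub>F k in sequentially. dist (X k n \<omega>) z < \<epsilon> \<and> n = map (\<lambda>i. S k i \<omega>) [1..<Suc t]"
      proof (rule frequently_elim1)
        fix k assume k: "1 \<le> k \<and> \<omega> \<in> (X k n -` B \<inter> space M) \<inter> E k"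
        have "n ! i = S k (Suc i) \<omega>" if i: "i < t" for i
        proof (cases "i = 0")
          case True
          then show ?thesis using node_first[OF t n] elim(1) k by simp
        next
          case False
          then have "scenario P (S k) \<omega> (Suc i) = n ! i" using k i by (auto simp: E_def G_def)
          then show ?thesis using False i t by (simp add: scenario_def)
        qed
        then have "n = map (\<lambda>i. S k i \<omega>) [1..<Suc t]"
          using n by (intro nth_equalityI) (auto simp: nodes_def simp del: upt_Suc)
        then show "dist (X k n \<omega>) z < \<epsilon> \<and> n = map (\<lambda>i. S k i \<omega>) [1..<Suc t]"
          using k B(3) by (auto simp: dist_commute subset_eq)
      qed
    qed
  qed
qed

end

section \<open>Inexact cuts\<close>

context regular_msp
begin

lemma cut_expand:
  "cut P t d W x y l u = (\<Sum>\<zeta>\<in>Theta P t. rprob P t \<zeta> *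
      (real_of_ereal (cost P t (y \<zeta>) x \<zeta>) + W (y \<zeta>) + l \<zeta> \<bullet> (u - x))) - 2 * d"
  by (simp add: cut_def Let_def inner_sum_left sum.distrib[symmetric] algebra_simps)

lemma cut_affine:
  "cut P t d W x y l u = cut P t d W x y l 0 + (\<Sum>\<zeta>\<in>Theta P t. rprob P t \<zeta> *\<^sub>R l \<zeta>) \<bullet> u"
  by (simp add: cut_def Let_def)

lemma sum_rprob_add:
  assumes "t \<in> {1..horizon P}"
  shows "(\<Sum>\<zeta>\<in>Theta P t. rprob P t \<zeta> * (f \<zeta> + c)) = (\<Sum>\<zeta>\<in>Theta P t. rprob P t \<zeta> * f \<zeta>) + c"
  using sum_rprob[OF assms] by (simp add: distrib_left sum.distrib sum_distrib_right[symmetric])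

text \<open>
  The primal error and the dual error can each raise the cut by \<open>d\<close>; the subtraction of \<open>2 * d\<close>
  compensates exactly for both.
\<close>

lemma cut_le_expected:
  assumes t: "t \<in> {2..horizon P}" and W: "convex_on (dec_set P t) W" "continuous_on (dec_set P t) W"
    and x: "x \<in> dec_set P (t - 1)" and u: "u \<in> dec_set P (t - 1)"
    and y: "\<And>\<zeta>. \<zeta> \<in> Theta P t \<Longrightarrow>
        approx_min d (feas P t x \<zeta>) (stage_obj P t (\<lambda>w. ereal (W w)) x \<zeta>) (y \<zeta>)"
    and l: "\<And>\<zeta>. \<zeta> \<in> Theta P t \<Longrightarrow> approx_max d (dual_fun P t (\<lambda>w. ereal (W w)) x \<zeta>) (l \<zeta>)"
  shows "cut P t d W x y l u \<le> expected t W u"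
proof -
  have t1: "t \<in> {1..horizon P}" using t by auto
  have le: "real_of_ereal (cost P t (y \<zeta>) x \<zeta>) + W (y \<zeta>) + l \<zeta> \<bullet> (u - x) \<le> rval t W u \<zeta> + 2 * d"
    if \<zeta>: "\<zeta> \<in> Theta P t" for \<zeta>
  proof -
    have "ereal (rval t W x \<zeta> - d + l \<zeta> \<bullet> (u - x)) \<le> ereal (rval t W u \<zeta>)"
      using approx_dual_subgradient[OF t \<zeta> W x l[OF \<zeta>], of u]
        stage_val_real[OF t1 \<zeta> W(2) u feas_ne_dec[OF t \<zeta> u]] by simp
    then show ?thesis using approx_min_real(3)[OF t1 \<zeta> W(2) x y[OF \<zeta>]] by simp
  qed
  have "cut P t d W x y l u \<le> (\<Sum>\<zeta>\<in>Theta P t. rprob P t \<zeta> * (rval t W u \<zeta> + 2 * d)) - 2 * d"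
    unfolding cut_expand by (intro diff_right_mono sum_mono mult_left_mono rprob_nonneg le)
  then show ?thesis using sum_rprob_add[OF t1, of "\<lambda>\<zeta>. rval t W u \<zeta>" "2 * d"] by (simp add: expected_def)
qed

lemma expected_le_cut_at_trial_point:
  assumes t: "t \<in> {2..horizon P}" and W: "continuous_on (dec_set P t) W"
    and x: "x \<in> dec_set P (t - 1)"
    and y: "\<And>\<zeta>. \<zeta> \<in> Theta P t \<Longrightarrow>
        approx_min d (feas P t x \<zeta>) (stage_obj P t (\<lambda>w. ereal (W w)) x \<zeta>) (y \<zeta>)"
  shows "expected t W x - 2 * d \<le> cut P t d W x y l x"
proof -
  have t1: "t \<in> {1..horizon P}" using t by auto
  show ?thesis unfolding cut_expand expected_def
    using approx_min_real(2)[OF t1 _ W x y]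
    by (intro diff_right_mono sum_mono mult_left_mono rprob_nonneg) auto
qed

text \<open>
  Moving from \<open>x\<close> by \<open>e / 2\<close> in the direction of \<open>l\<close>, the approximate subgradient inequality
  forces the stage value up by \<open>norm l * e / 2\<close>, apart from the error. The stage value of \<open>W\<close> is
  below that of \<open>B\<close>, which is bounded on the fattening, and at \<open>x\<close> it is bounded below through
  \<open>A\<close>. The bound is thus uniform over all \<open>W\<close> between \<open>A\<close> and \<open>B\<close>, all trial points and all
  errors up to \<open>dbar\<close>.
\<close>

lemma dual_slope_bounded:
  assumes t: "t \<in> {2..horizon P}" and \<zeta>: "\<zeta> \<in> Theta P t"
    and B: "convex_on (dec_set P t) B" "continuous_on (dec_set P t) B"
    and A: "continuous_on (dec_set P t) A"
  shows "\<exists>L\<ge>0. \<forall>W x d l. convex_on (dec_set P t) W \<longrightarrow> continuous_on (dec_set P t) W \<longrightarrow>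
      (\<forall>y\<in>dec_set P t. A y \<le> W y \<and> W y \<le> B y) \<longrightarrow> x \<in> dec_set P (t - 1) \<longrightarrow> d \<le> dbar \<longrightarrow>
      approx_max d (dual_fun P t (\<lambda>y. ereal (W y)) x \<zeta>) l \<longrightarrow> norm l \<le> L"
proof -
  have t1: "t \<in> {1..horizon P}" using t by auto
  obtain U where U: "\<forall>z\<in>fatten (e / 2) (dec_set P (t - 1)). stage_val P t (\<lambda>y. ereal (B y)) z \<zeta> \<le> ereal U"
    using rval_continuous_convex(3)[OF t \<zeta> B] by blast
  obtain b where b: "\<And>y z. y \<in> dec_set P t \<Longrightarrow> z \<in> dec_set P (t - 1) \<Longrightarrow> ereal b \<le> cost P t y z \<zeta>"
    using cost_bounded_below[OF t1 \<zeta>] by blast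
  obtain a where a: "\<And>y. y \<in> dec_set P t \<Longrightarrow> a \<le> A y"
    using continuous_on_dec_set_bounded_below[of t A] t A by auto
  have "norm l \<le> max 0 ((U - (b + a) + dbar) / (e / 2))"
    if W: "convex_on (dec_set P t) W" "continuous_on (dec_set P t) W"
      and AB: "\<forall>y\<in>dec_set P t. A y \<le> W y \<and> W y \<le> B y" and x: "x \<in> dec_set P (t - 1)" and d: "d \<le> dbar"
      and l: "approx_max d (dual_fun P t (\<lambda>y. ereal (W y)) x \<zeta>) l" for W x d l
  proof (cases "l = 0")
    case False
    define z where "z = x + (e / 2 / norm l) *\<^sub>R l"
    have "z \<in> cball x (e / 2)" using e False by (simp add: z_def dist_norm)
    then have "z \<in> fatten (e / 2) (dec_set P (t - 1))" by (rule fatten_ball[OF x])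
    then have zU: "stage_val P t (\<lambda>y. ereal (B y)) z \<zeta> \<le> ereal U" using U by blast
    have low: "b + a \<le> rval t W x \<zeta>"
      using stage_val_ge[of t b x \<zeta> a W] stage_val_real[OF t1 \<zeta> W(2) x feas_ne_dec[OF t \<zeta> x]]
        b[OF _ x] a AB by (metis ereal_less_eq(3) order_trans)
    have "ereal (rval t W x \<zeta> - d + l \<bullet> (z - x)) \<le> stage_val P t (\<lambda>y. ereal (W y)) z \<zeta>"
      by (rule approx_dual_subgradient[OF t \<zeta> W x l])
    also have "\<dots> \<le> stage_val P t (\<lambda>y. ereal (B y)) z \<zeta>" by (rule stage_val_mono) (use AB in simp)
    also note zU
    finally have "rval t W x \<zeta> - d + l \<bullet> (z - x) \<le> U" by simp
    moreover have "l \<bullet> (z - x) = (e / 2) * norm l"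
      using False by (simp add: z_def power2_norm_eq_inner[symmetric] power2_eq_square)
    ultimately have "(e / 2) * norm l \<le> U - (b + a) + dbar" using low d by linarith
    then have "norm l \<le> (U - (b + a) + dbar) / (e / 2)" using e by (simp add: field_simps)
    then show ?thesis by simp
  qed simp
  then show ?thesis by (intro exI[of _ "max 0 ((U - (b + a) + dbar) / (e / 2))"]) auto
qed

lemma cut_slope_bounded:
  assumes t: "t \<in> {2..horizon P}"
    and B: "convex_on (dec_set P t) B" "continuous_on (dec_set P t) B"
    and A: "continuous_on (dec_set P t) A"
  shows "\<exists>L\<ge>0. \<forall>W x d l. convex_on (dec_set P t) W \<longrightarrow> continuous_on (dec_set P t) W \<longrightarrow>
      (\<forall>y\<in>dec_set P t. A y \<le> W y \<and> W y \<le> B y) \<longrightarrow> x \<in> dec_set P (t - 1) \<longrightarrow> d \<le> dbar \<longrightarrow>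
      (\<forall>\<zeta>\<in>Theta P t. approx_max d (dual_fun P t (\<lambda>y. ereal (W y)) x \<zeta>) (l \<zeta>)) \<longrightarrow>
      norm (\<Sum>\<zeta>\<in>Theta P t. rprob P t \<zeta> *\<^sub>R l \<zeta>) \<le> L"
proof -
  have "\<forall>\<zeta>\<in>Theta P t. \<exists>L\<ge>0. \<forall>W x d l. convex_on (dec_set P t) W \<longrightarrow> continuous_on (dec_set P t) W \<longrightarrow>
      (\<forall>y\<in>dec_set P t. A y \<le> W y \<and> W y \<le> B y) \<longrightarrow> x \<in> dec_set P (t - 1) \<longrightarrow> d \<le> dbar \<longrightarrow>
      approx_max d (dual_fun P t (\<lambda>y. ereal (W y)) x \<zeta>) l \<longrightarrow> norm l \<le> L"
    using dual_slope_bounded[OF t _ B A] by blast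
  then obtain L where L: "\<forall>\<zeta>\<in>Theta P t. L \<zeta> \<ge> 0 \<and> (\<forall>W x d l. convex_on (dec_set P t) W \<longrightarrow> continuous_on (dec_set P t) W \<longrightarrow>
      (\<forall>y\<in>dec_set P t. A y \<le> W y \<and> W y \<le> B y) \<longrightarrow> x \<in> dec_set P (t - 1) \<longrightarrow> d \<le> dbar \<longrightarrow>
      approx_max d (dual_fun P t (\<lambda>y. ereal (W y)) x \<zeta>) l \<longrightarrow> norm l \<le> L \<zeta>)"
    by (rule bchoice[THEN exE])
  show ?thesis
  proof (intro exI[of _ "\<Sum>\<zeta>\<in>Theta P t. rprob P t \<zeta> * L \<zeta>"] conjI allI impI)
    show "0 \<le> (\<Sum>\<zeta>\<in>Theta P t. rprob P t \<zeta> * L \<zeta>)" using L by (intro sum_nonneg mult_nonneg_nonneg rprob_nonneg) auto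
    fix W x d l
    assume a: "convex_on (dec_set P t) W" "continuous_on (dec_set P t) W"
      "\<forall>y\<in>dec_set P t. A y \<le> W y \<and> W y \<le> B y" "x \<in> dec_set P (t - 1)" "d \<le> dbar"
      "\<forall>\<zeta>\<in>Theta P t. approx_max d (dual_fun P t (\<lambda>y. ereal (W y)) x \<zeta>) (l \<zeta>)"
    show "norm (\<Sum>\<zeta>\<in>Theta P t. rprob P t \<zeta> *\<^sub>R l \<zeta>) \<le> (\<Sum>\<zeta>\<in>Theta P t. rprob P t \<zeta> * L \<zeta>)"
    proof (rule sum_norm_le)
      fix \<zeta> assume \<zeta>: "\<zeta> \<in> Theta P t"
      then have "norm (l \<zeta>) \<le> L \<zeta>" using L a by blast
      then show "norm (rprob P t \<zeta> *\<^sub>R l \<zeta>) \<le> rprob P t \<zeta> * L \<zeta>"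
        using rprob_nonneg by (simp add: mult_left_mono)
    qed
  qed
qed

end


section \<open>Runs of the algorithm\<close>

text \<open>
  One sample path of the algorithm. Everything in this locale is deterministic.
\<close>

locale isddp = regular_msp P e
  for P :: "('n::finite, 'q::finite, 'k::finite, 'w) msp" and e +
  fixes \<delta> \<epsilon> :: "nat \<Rightarrow> nat \<Rightarrow> real" and \<delta>bar \<epsilon>bar :: real and Q0 :: "nat \<Rightarrow> real^'n \<Rightarrow> real"
    and s :: "nat \<Rightarrow> nat \<Rightarrow> real^'k" and x :: "nat \<Rightarrow> nat \<Rightarrow> real^'n"
    and X :: "nat \<Rightarrow> (real^'k) list \<Rightarrow> real^'n"
    and y l :: "nat \<Rightarrow> nat \<Rightarrow> real^'k \<Rightarrow> real^'n"
    and Q :: "nat \<Rightarrow> nat \<Rightarrow> real^'n \<Rightarrow> real"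
  assumes \<delta>_bounds: "\<And>k t. k \<ge> 1 \<Longrightarrow> t \<in> {1..horizon P} \<Longrightarrow> 0 \<le> \<delta> k t \<and> \<delta> k t \<le> \<delta>bar"
    and \<epsilon>_bounds: "\<And>k t. k \<ge> 1 \<Longrightarrow> t \<in> {2..horizon P} \<Longrightarrow> 0 \<le> \<epsilon> k t \<and> \<epsilon> k t \<le> \<epsilon>bar"
    and initial: "initial_approx P Q0"
    and run: "isddp_run P \<delta> \<epsilon> Q0 s x X y l Q"
begin

lemma Q_start: "t \<in> {2..Suc (horizon P)} \<Longrightarrow> u \<in> dec_set P (t - 1) \<Longrightarrow> Q 0 t u = Q0 t u"
  using run by (simp add: isddp_run_def)

lemma Q_end: "u \<in> dec_set P (horizon P) \<Longrightarrow> Q k (Suc (horizon P)) u = 0"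
  using run by (simp add: isddp_run_def)

lemma forward: "k \<ge> 1 \<Longrightarrow> forward_pass P (\<delta> k) (Q (k - 1)) (s k) (x k)"
  using run by (simp add: isddp_run_def)

lemma backward: "k \<ge> 1 \<Longrightarrow> backward_pass P (\<epsilon> k) (x k) (y k) (l k) (Q (k - 1)) (Q k)"
  using run by (simp add: isddp_run_def)

lemma sim: "k \<ge> 1 \<Longrightarrow> simulation P (\<delta> k) (Q (k - 1)) (X k)"
  using run by (simp add: isddp_run_def)

lemma forward_eq_simulation:
  "k \<ge> 1 \<Longrightarrow> t \<in> {1..horizon P} \<Longrightarrow> n \<in> nodes P t \<Longrightarrow> n = map (s k) [1..<Suc t] \<Longrightarrow> x k t = X k n"
  using run unfolding isddp_run_def by blast

lemma simD:
  assumes "k \<ge> 1" "t \<in> {1..horizon P}" "n \<in> nodes P (t - 1)" "\<zeta> \<in> Theta P t"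
  shows "approx_min (\<delta> k t) (feas P t (X k n) \<zeta>)
     (stage_obj P t (\<lambda>y. ereal (Q (k - 1) (Suc t) y)) (X k n) \<zeta>) (X k (n @ [\<zeta>]))"
  using sim[OF assms(1)] assms(2-4) children_eq[OF assms(2,3)] unfolding simulation_def by fastforce

lemma X_in_dec_set:
  assumes k: "k \<ge> 1" and t: "t \<le> horizon P" and n: "n \<in> nodes P t"
  shows "X k n \<in> dec_set P t"
proof (cases t)
  case 0
  then show ?thesis using n sim[OF k] by (simp add: nodes_def simulation_def dec_set_def)
next
  case (Suc t')
  have "n \<noteq> []" using n Suc by (auto simp: nodes_def)
  then obtain n' \<zeta> where n': "n = n' @ [\<zeta>]" by (metis append_butlast_last_id)
  have "n' \<in> nodes P (t - 1)"
    using n Suc t nodes_iff[of t n] nodes_iff[of t' n'] n' by (auto simp: nth_append) (metis less_SucI)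
  moreover have tt: "t \<in> {1..horizon P}" using Suc t by auto
  ultimately have "\<zeta> \<in> Theta P t" using append_in_nodes_iff n n' by blast
  then have "X k n \<in> feas P t (X k n') \<zeta>"
    using simD[OF k tt \<open>n' \<in> nodes P (t - 1)\<close>] n' by (simp add: approx_min_def)
  then show ?thesis using feas_subset by blast
qed

lemma x_in_dec_set:
  assumes k: "k \<ge> 1" and t: "t \<le> horizon P"
  shows "x k t \<in> dec_set P t"
proof (cases "t = 0")
  case True
  then show ?thesis using forward[OF k] by (simp add: forward_pass_def dec_set_def)
next
  case False
  then have "x k t \<in> feas P t (x k (t - 1)) (s k t)"
    using forward[OF k] t by (simp add: forward_pass_def approx_min_def)
  then show ?thesis using feas_subset by blast
qed

abbreviation kcut :: "nat \<Rightarrow> nat \<Rightarrow> real^'n \<Rightarrow> real" where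
  "kcut k t \<equiv> cut P t (\<epsilon> k t) (Q k (Suc t)) (x k (t - 1)) (y k t) (l k t)"

lemma backwardD:
  assumes "k \<ge> 1" "t \<in> {2..horizon P}"
  shows "\<And>\<zeta>. \<zeta> \<in> Theta P t \<Longrightarrow> approx_min (\<epsilon> k t) (feas P t (x k (t - 1)) \<zeta>)
              (stage_obj P t (\<lambda>w. ereal (Q k (Suc t) w)) (x k (t - 1)) \<zeta>) (y k t \<zeta>)"
    "\<And>\<zeta>. \<zeta> \<in> Theta P t \<Longrightarrow> approx_max (\<epsilon> k t)
              (dual_fun P t (\<lambda>w. ereal (Q k (Suc t) w)) (x k (t - 1)) \<zeta>) (l k t \<zeta>)"
    "\<And>u. u \<in> dec_set P (t - 1) \<Longrightarrow> Q k t u = max (Q (k - 1) t u) (kcut k t u)"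
  using backward[OF assms(1)] assms(2) unfolding backward_pass_def by blast+

lemma cost_to_go_eq: "t \<in> {2..Suc (horizon P)} \<Longrightarrow> u \<in> dec_set P (t - 1) \<Longrightarrow> cost_to_go P t u = ereal (ctg t u)"
  using cost_to_go_regular by blast

lemma ctg_regular:
  assumes "t \<in> {2..Suc (horizon P)}"
  shows "convex_on (dec_set P (t - 1)) (ctg t)" "continuous_on (dec_set P (t - 1)) (ctg t)"
  using cost_to_go_regular[OF assms] by auto

lemma ctg_rec: "t \<in> {2..horizon P} \<Longrightarrow> u \<in> dec_set P (t - 1) \<Longrightarrow> ctg t u = expected t (ctg (Suc t)) u"
  using cost_to_go_regular[of t] by auto

lemma ctg_end: "ctg (Suc (horizon P)) u = 0"
  by (simp add: ctg_def cost_to_go.simps)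

lemma Q_start_affine:
  assumes "t \<in> {2..Suc (horizon P)}"
  obtains c v where "\<And>u. u \<in> dec_set P (t - 1) \<Longrightarrow> Q 0 t u = c + v \<bullet> u"
  using initial assms Q_start[OF assms] unfolding initial_approx_def by metis

lemma Q_start_le_ctg:
  assumes "t \<in> {2..Suc (horizon P)}" "u \<in> dec_set P (t - 1)"
  shows "Q 0 t u \<le> ctg t u"
  using initial assms Q_start[OF assms] cost_to_go_eq[OF assms] unfolding initial_approx_def
  by (metis ereal_less_eq(3))

text \<open>
  The invariant of the approximations. The lower bound by the initial approximation matters for the
  uniform bound on the slopes.
\<close>

definition valid_approx :: "nat \<Rightarrow> (real^'n \<Rightarrow> real) \<Rightarrow> bool" where
  "valid_approx t W \<longleftrightarrow> convex_on (dec_set P (t - 1)) W \<and> continuous_on (dec_set P (t - 1)) W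
     \<and> (\<forall>u\<in>dec_set P (t - 1). Q 0 t u \<le> W u \<and> W u \<le> ctg t u)"

lemma kcut_bounds:
  assumes k: "k \<ge> 1" and t: "t \<in> {2..horizon P}" and V: "valid_approx (Suc t) (Q k (Suc t))"
  shows "u \<in> dec_set P (t - 1) \<Longrightarrow> kcut k t u \<le> ctg t u"
    and "expected t (Q k (Suc t)) (x k (t - 1)) - 2 * \<epsilon> k t \<le> kcut k t (x k (t - 1))"
proof -
  have xd: "x k (t - 1) \<in> dec_set P (t - 1)" by (rule x_in_dec_set[OF k]) (use t in auto)
  have W: "convex_on (dec_set P t) (Q k (Suc t))" "continuous_on (dec_set P t) (Q k (Suc t))"
    using V by (auto simp: valid_approx_def)
  show "expected t (Q k (Suc t)) (x k (t - 1)) - 2 * \<epsilon> k t \<le> kcut k t (x k (t - 1))"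
    by (rule expected_le_cut_at_trial_point[OF t W(2) xd backwardD(1)[OF k t]])
  assume u: "u \<in> dec_set P (t - 1)"
  have "kcut k t u \<le> expected t (Q k (Suc t)) u"
    by (rule cut_le_expected[OF t W xd u backwardD(1,2)[OF k t]])
  also have "\<dots> \<le> expected t (ctg (Suc t)) u"
    by (rule expected_mono[OF t W(2) _ _ u])
       (use ctg_regular[of "Suc t"] t V in \<open>auto simp: valid_approx_def\<close>)
  finally show "kcut k t u \<le> ctg t u" using ctg_rec[OF t u] by simp
qed

lemma valid_approx_cong:
  assumes "\<And>u. u \<in> dec_set P (t - 1) \<Longrightarrow> W u = W' u" "valid_approx t W'"
  shows "valid_approx t W"
  using assms continuous_on_cong[OF refl assms(1)] unfolding valid_approx_def convex_on_def
  by (auto simp: convexD)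

text \<open>
  Outer induction over the iterations; within one iteration the backward pass builds the cut of a stage
  from the new approximation of the next stage, so the inner induction runs backward over the stages.
\<close>

lemma Q_valid:
  assumes "t \<in> {2..Suc (horizon P)}"
  shows "valid_approx t (Q k t)"
proof -
  have D: "convex (dec_set P (t - 1))" if "t \<in> {2..Suc (horizon P)}" for t
    by (rule dec_set_regular) (use that in auto)
  show ?thesis using assms
  proof (induction k arbitrary: t)
    case 0
    obtain c v where cv: "\<And>u. u \<in> dec_set P (t - 1) \<Longrightarrow> Q 0 t u = c + v \<bullet> u"
      using Q_start_affine[OF 0] by blast
    show ?case
    proof (rule valid_approx_cong[OF cv])
      show "valid_approx t (\<lambda>u. c + v \<bullet> u)" unfolding valid_approx_def
        using cv Q_start_le_ctg[OF 0] D[OF 0]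
        by (auto intro!: convex_on_affine continuous_intros)
    qed
  next
    case (Suc k)
    have "t \<le> Suc (horizon P)" using Suc.prems by auto
    then show ?case using Suc.prems
    proof (induction t rule: inc_induct)
      case base
      show ?case
      proof (rule valid_approx_cong)
        show "Q (Suc k) (Suc (horizon P)) u = Q k (Suc (horizon P)) u"
          if "u \<in> dec_set P (Suc (horizon P) - 1)" for u using that Q_end by simp
        show "valid_approx (Suc (horizon P)) (Q k (Suc (horizon P)))"
          by (rule Suc.IH) (use T1 in auto)
      qed
    next
      case (step t)
      have t: "t \<in> {2..horizon P}" using step by auto
      have V: "valid_approx (Suc t) (Q (Suc k) (Suc t))" using step by auto
      have IH: "valid_approx t (Q k t)" using Suc.IH step.prems by blast
      show ?case
      proof (rule valid_approx_cong)
        show "Q (Suc k) t u = max (Q k t u) (kcut (Suc k) t u)" if "u \<in> dec_set P (t - 1)" for u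
          using backwardD(3)[OF _ t that, of "Suc k"] by simp
        have "convex_on (dec_set P (t - 1)) (kcut (Suc k) t)" "continuous_on (dec_set P (t - 1)) (kcut (Suc k) t)"
          by (subst cut_affine[abs_def], intro convex_on_affine D step.prems continuous_intros)+
        then show "valid_approx t (\<lambda>u. max (Q k t u) (kcut (Suc k) t u))"
          using IH kcut_bounds(1)[OF _ t V] unfolding valid_approx_def
          by (auto intro!: convex_on_max continuous_on_max simp: le_max_iff_disj)
      qed
    qed
  qed
qed

lemma Q_le_ctg: "t \<in> {2..Suc (horizon P)} \<Longrightarrow> u \<in> dec_set P (t - 1) \<Longrightarrow> Q k t u \<le> ctg t u"
  using Q_valid by (auto simp: valid_approx_def)

lemma Q_continuous: "t \<in> {2..Suc (horizon P)} \<Longrightarrow> continuous_on (dec_set P (t - 1)) (Q k t)"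
  using Q_valid by (auto simp: valid_approx_def)

lemma Q_mono:
  assumes "t \<in> {2..Suc (horizon P)}" "u \<in> dec_set P (t - 1)"
  shows "Q k t u \<le> Q (Suc k) t u"
proof (cases "t = Suc (horizon P)")
  case True
  then show ?thesis using Q_end assms by simp
next
  case False
  then show ?thesis using backwardD(3)[of "Suc k" t u] assms by auto
qed

lemma Q_equi_lipschitz:
  assumes t: "t \<in> {2..Suc (horizon P)}"
  obtains L where "\<And>k. L-lipschitz_on (dec_set P (t - 1)) (Q k t)"
proof (cases "t = Suc (horizon P)")
  case True
  have "0-lipschitz_on (dec_set P (t - 1)) (Q k t)" for k
    by (rule lipschitz_onI) (use True Q_end in auto)
  then show thesis by (rule that)
next
  case False
  then have t2: "t \<in> {2..horizon P}" "Suc t \<in> {2..Suc (horizon P)}" using t by auto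
  obtain c v where cv: "\<And>u. u \<in> dec_set P (t - 1) \<Longrightarrow> Q 0 t u = c + v \<bullet> u"
    using Q_start_affine[OF t] by blast
  have r: "convex_on (dec_set P t) (ctg (Suc t))" "continuous_on (dec_set P t) (ctg (Suc t))"
    "continuous_on (dec_set P t) (Q 0 (Suc t))"
    using ctg_regular[OF t2(2)] Q_continuous[OF t2(2), of 0] by simp_all
  obtain L where "L \<ge> 0" and L: "\<forall>W x d l. convex_on (dec_set P t) W \<longrightarrow> continuous_on (dec_set P t) W \<longrightarrow>
      (\<forall>y\<in>dec_set P t. Q 0 (Suc t) y \<le> W y \<and> W y \<le> ctg (Suc t) y) \<longrightarrow> x \<in> dec_set P (t - 1) \<longrightarrow> d \<le> \<epsilon>bar \<longrightarrow>
      (\<forall>\<zeta>\<in>Theta P t. approx_max d (dual_fun P t (\<lambda>y. ereal (W y)) x \<zeta>) (l \<zeta>)) \<longrightarrow>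
      norm (\<Sum>\<zeta>\<in>Theta P t. rprob P t \<zeta> *\<^sub>R l \<zeta>) \<le> L"
    using cut_slope_bounded[OF t2(1) r, of \<epsilon>bar] by (elim exE conjE) (rule that)
  have slope: "norm (\<Sum>\<zeta>\<in>Theta P t. rprob P t \<zeta> *\<^sub>R l k t \<zeta>) \<le> L" if k: "k \<ge> 1" for k
    by (rule L[rule_format, of "Q k (Suc t)" "x k (t - 1)" "\<epsilon> k t"])
       (use Q_valid[OF t2(2), of k] x_in_dec_set[OF k, of "t - 1"] t2 \<epsilon>_bounds[OF k t2(1)] backwardD(2)[OF k t2(1)]
         in \<open>auto simp: valid_approx_def\<close>)
  have "(max L (norm v))-lipschitz_on (dec_set P (t - 1)) (Q k t)" for k
  proof (induction k)
    case 0
    have "(max L (norm v))-lipschitz_on (dec_set P (t - 1)) (\<lambda>u. c + v \<bullet> u)" by (rule lipschitz_on_affine) simp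
    then show ?case by (rule lipschitz_on_transform) (simp add: cv)
  next
    case (Suc k)
    have "(max L (norm v))-lipschitz_on (dec_set P (t - 1)) (kcut (Suc k) t)"
      by (subst cut_affine[abs_def], rule lipschitz_on_affine) (use slope[of "Suc k"] in simp)
    then have "(max L (norm v))-lipschitz_on (dec_set P (t - 1)) (\<lambda>u. max (Q k t u) (kcut (Suc k) t u))"
      by (rule lipschitz_on_max[OF Suc])
    then show ?case by (rule lipschitz_on_transform) (use backwardD(3)[of "Suc k" t] t2 in auto)
  qed
  then show thesis by (rule that)
qed

definition Qlim :: "nat \<Rightarrow> real^'n \<Rightarrow> real" where
  "Qlim t u = (SUP k. Q k t u)"

lemma Qlim:
  assumes t: "t \<in> {2..Suc (horizon P)}"
  shows "uniform_limit (dec_set P (t - 1)) (\<lambda>k. Q k t) (Qlim t) sequentially"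
    and "continuous_on (dec_set P (t - 1)) (Qlim t)"
    and "\<And>u k. u \<in> dec_set P (t - 1) \<Longrightarrow> Q k t u \<le> Qlim t u"
    and "\<And>u. u \<in> dec_set P (t - 1) \<Longrightarrow> Qlim t u \<le> ctg t u"
proof -
  obtain L where L: "\<And>k. L-lipschitz_on (dec_set P (t - 1)) (Q k t)" using Q_equi_lipschitz[OF t] by blast
  have K: "compact (dec_set P (t - 1))" by (rule dec_set_regular) (use t in auto)
  note lim = uniform_limit_mono_lipschitz[of "dec_set P (t - 1)" "\<lambda>k. Q k t" "ctg t" L,
      OF K Q_mono[OF t] Q_le_ctg[OF t] L, folded Qlim_def]
  show "uniform_limit (dec_set P (t - 1)) (\<lambda>k. Q k t) (Qlim t) sequentially"
    "continuous_on (dec_set P (t - 1)) (Qlim t)"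
    "\<And>u k. u \<in> dec_set P (t - 1) \<Longrightarrow> Q k t u \<le> Qlim t u" by (rule lim; simp)+
  show "Qlim t u \<le> ctg t u" if "u \<in> dec_set P (t - 1)" for u
    unfolding Qlim_def by (rule cSUP_least) (use Q_le_ctg[OF t that] in auto)
qed

end

section \<open>Convergence\<close>

context isddp
begin

definition gap_bound :: "nat \<Rightarrow> real" where
  "gap_bound t = (\<delta>bar + 2 * \<epsilon>bar) * (real (horizon P) - real t + 1)"

lemma gap_bound_Suc: "gap_bound t = \<delta>bar + 2 * \<epsilon>bar + gap_bound (Suc t)"
  by (simp add: gap_bound_def algebra_simps)

definition rcost :: "nat \<Rightarrow> nat \<Rightarrow> (real^'k) list \<Rightarrow> real^'k \<Rightarrow> real" where
  "rcost k t n \<zeta> = real_of_ereal (cost P t (X k (n @ [\<zeta>])) (X k n) \<zeta>)"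

lemma child_decision:
  assumes k: "k \<ge> 1" and t: "t \<in> {1..horizon P}" and n: "n \<in> nodes P (t - 1)" and \<zeta>: "\<zeta> \<in> Theta P t"
  shows "X k n \<in> dec_set P (t - 1)" "X k (n @ [\<zeta>]) \<in> dec_set P t"
    "cost P t (X k (n @ [\<zeta>])) (X k n) \<zeta> = ereal (rcost k t n \<zeta>)"
    "rcost k t n \<zeta> + Q (k - 1) (Suc t) (X k (n @ [\<zeta>])) \<le> rval t (Q (k - 1) (Suc t)) (X k n) \<zeta> + \<delta>bar"
    "rval t (ctg (Suc t)) (X k n) \<zeta> \<le> rcost k t n \<zeta> + ctg (Suc t) (X k (n @ [\<zeta>]))"
proof -
  have t2: "Suc t \<in> {2..Suc (horizon P)}" using t by auto
  show xn: "X k n \<in> dec_set P (t - 1)" by (rule X_in_dec_set[OF k _ n]) (use t in auto)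
  have a: "approx_min (\<delta> k t) (feas P t (X k n) \<zeta>)
     (stage_obj P t (\<lambda>y. ereal (Q (k - 1) (Suc t) y)) (X k n) \<zeta>) (X k (n @ [\<zeta>]))"
    by (rule simD[OF k t n \<zeta>])
  have Qc: "continuous_on (dec_set P t) (Q (k - 1) (Suc t))" using Q_continuous[OF t2] by simp
  have cc: "continuous_on (dec_set P t) (ctg (Suc t))" using ctg_regular[OF t2] by simp
  show xm: "X k (n @ [\<zeta>]) \<in> dec_set P t" by (rule approx_min_real(1)[OF t \<zeta> Qc xn a])
  show "cost P t (X k (n @ [\<zeta>])) (X k n) \<zeta> = ereal (rcost k t n \<zeta>)"
    unfolding rcost_def by (rule cost_real[OF t \<zeta> xm xn])
  show "rcost k t n \<zeta> + Q (k - 1) (Suc t) (X k (n @ [\<zeta>])) \<le> rval t (Q (k - 1) (Suc t)) (X k n) \<zeta> + \<delta>bar"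
    using approx_min_real(3)[OF t \<zeta> Qc xn a] \<delta>_bounds[OF k t] by (simp add: rcost_def)
  have "X k (n @ [\<zeta>]) \<in> feas P t (X k n) \<zeta>" using a by (simp add: approx_min_def)
  then show "rval t (ctg (Suc t)) (X k n) \<zeta> \<le> rcost k t n \<zeta> + ctg (Suc t) (X k (n @ [\<zeta>]))"
    unfolding rcost_def by (rule rval_le_feasible[OF t \<zeta> cc xn])
qed

definition policy_cost :: "nat \<Rightarrow> nat \<Rightarrow> (real^'k) list \<Rightarrow> real" where
  "policy_cost k t n = (\<Sum>\<zeta>\<in>Theta P t. rprob P t \<zeta> * (rcost k t n \<zeta> + ctg (Suc t) (X k (n @ [\<zeta>]))))"

text \<open>
  The index \<open>k - 1\<close> is that of the approximations with which the decisions of iteration \<open>k\<close> are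
  computed.
\<close>

definition child_gap :: "nat \<Rightarrow> nat \<Rightarrow> (real^'k) list \<Rightarrow> real" where
  "child_gap k t n = (\<Sum>\<zeta>\<in>Theta P t. rprob P t \<zeta> *
     (ctg (Suc t) (X k (n @ [\<zeta>])) - Q (k - 1) (Suc t) (X k (n @ [\<zeta>]))))"

lemma policy_cost_bounds:
  assumes k: "k \<ge> 1" and t: "t \<in> {2..horizon P}" and n: "n \<in> nodes P (t - 1)"
  shows "ctg t (X k n) \<le> policy_cost k t n"
    and "policy_cost k t n \<le> expected t (Q (k - 1) (Suc t)) (X k n) + \<delta>bar + child_gap k t n"
proof -
  have t1: "t \<in> {1..horizon P}" using t by auto
  have xn: "X k n \<in> dec_set P (t - 1)" by (rule X_in_dec_set[OF k _ n]) (use t in auto)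
  show "ctg t (X k n) \<le> policy_cost k t n"
    unfolding ctg_rec[OF t xn] expected_def policy_cost_def
    by (intro sum_mono mult_left_mono rprob_nonneg child_decision(5)[OF k t1 n])
  have "policy_cost k t n \<le> (\<Sum>\<zeta>\<in>Theta P t. rprob P t \<zeta> * ((rval t (Q (k - 1) (Suc t)) (X k n) \<zeta>
      + (ctg (Suc t) (X k (n @ [\<zeta>])) - Q (k - 1) (Suc t) (X k (n @ [\<zeta>])))) + \<delta>bar))"
    unfolding policy_cost_def
  proof (intro sum_mono mult_left_mono rprob_nonneg)
    fix \<zeta> assume "\<zeta> \<in> Theta P t"
    from child_decision(4)[OF k t1 n this]
    show "rcost k t n \<zeta> + ctg (Suc t) (X k (n @ [\<zeta>])) \<le> rval t (Q (k - 1) (Suc t)) (X k n) \<zeta>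
      + (ctg (Suc t) (X k (n @ [\<zeta>])) - Q (k - 1) (Suc t) (X k (n @ [\<zeta>]))) + \<delta>bar" by linarith
  qed
  also have "\<dots> = expected t (Q (k - 1) (Suc t)) (X k n) + \<delta>bar + child_gap k t n"
    unfolding sum_rprob_add[OF t1] expected_def child_gap_def by (simp add: distrib_left sum.distrib)
  finally show "policy_cost k t n \<le> expected t (Q (k - 1) (Suc t)) (X k n) + \<delta>bar + child_gap k t n" .
qed

text \<open>
  The cut of iteration \<open>k\<close> is built at the decision of the sampled node and is tight there up to
  \<open>2 * \<epsilon>bar\<close>. It uses the new approximation of the next stage, which dominates the old one that the
  decisions of the children minimize up to \<open>\<delta>bar\<close>.
\<close>

lemma gap_at_sampled_node:
  assumes k: "k \<ge> 1" and t: "t \<in> {2..horizon P}" and n: "n \<in> nodes P (t - 1)"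
    and sampled: "n = map (s k) [1..<t]"
  shows "ctg t (X k n) - Q k t (X k n) \<le> \<delta>bar + 2 * \<epsilon>bar + child_gap k t n"
proof -
  have t2: "Suc t \<in> {2..Suc (horizon P)}" "t - 1 \<in> {1..horizon P}" using t by auto
  have eq: "x k (t - 1) = X k n"
    by (rule forward_eq_simulation[OF k t2(2) n]) (use sampled t in simp)
  have xn: "X k n \<in> dec_set P (t - 1)" by (rule X_in_dec_set[OF k _ n]) (use t in auto)
  have Qc: "continuous_on (dec_set P t) (Q j (Suc t))" for j using Q_continuous[OF t2(1)] by simp
  have "expected t (Q (k - 1) (Suc t)) (X k n) \<le> expected t (Q k (Suc t)) (X k n)"
    by (rule expected_mono[OF t Qc Qc _ xn]) (use Q_mono[OF t2(1), of _ "k - 1"] k in auto)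
  also have "\<dots> \<le> kcut k t (X k n) + 2 * \<epsilon> k t"
    using kcut_bounds(2)[OF k t Q_valid[OF t2(1)]] eq by simp
  also have "\<dots> \<le> Q k t (X k n) + 2 * \<epsilon>bar"
    using backwardD(3)[OF k t xn] \<epsilon>_bounds[OF k t] by linarith
  finally show ?thesis using policy_cost_bounds[OF k t n] by linarith
qed

text \<open>
  Uniform convergence makes the limit interchangeable with the approximation of the previous iteration.
\<close>

lemma gap_eventually_le:
  assumes t: "t \<in> {2..Suc (horizon P)}" and n: "n \<in> nodes P (t - 1)" and \<eta>: "\<eta> > 0"
    and acc: "\<And>z. z \<in> dec_set P (t - 1) \<Longrightarrow> (\<And>r. r > 0 \<Longrightarrow> \<exists>\<^sub>F k in sequentially. dist (X k n) z < r)
        \<Longrightarrow> ctg t z - Qlim t z \<le> c"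
  shows "\<forall>\<^sub>F k in sequentially. ctg t (X k n) - Q (k - 1) t (X k n) \<le> c + \<eta>"
proof -
  have xd: "\<forall>\<^sub>F k in sequentially. X k n \<in> dec_set P (t - 1)"
    using eventually_ge_at_top[of 1]
    by eventually_elim (rule X_in_dec_set[OF _ _ n], use t in auto)
  have K: "compact (dec_set P (t - 1))" by (rule dec_set_regular) (use t in auto)
  have "continuous_on (dec_set P (t - 1)) (\<lambda>z. ctg t z - Qlim t z)"
    by (intro continuous_intros ctg_regular Qlim t)
  then have 1: "\<forall>\<^sub>F k in sequentially. ctg t (X k n) - Qlim t (X k n) \<le> c + \<eta> / 2"
    by (rule eventually_le_if_accumulation_le[OF K _ xd acc]) (use \<eta> in auto)
  have "\<forall>\<^sub>F k in sequentially. \<forall>u\<in>dec_set P (t - 1). dist (Q k t u) (Qlim t u) < \<eta> / 2"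
    by (rule uniform_limitD[OF Qlim(1)[OF t]]) (use \<eta> in simp)
  then obtain N where N: "\<And>k. k \<ge> N \<Longrightarrow> \<forall>u\<in>dec_set P (t - 1). dist (Q k t u) (Qlim t u) < \<eta> / 2"
    unfolding eventually_sequentially by blast
  show ?thesis using 1 xd eventually_ge_at_top[of "Suc N"]
  proof eventually_elim
    case (elim k)
    then have "dist (Q (k - 1) t (X k n)) (Qlim t (X k n)) < \<eta> / 2" using N[of "k - 1"] by simp
    then show ?case using elim(1) unfolding dist_real_def by linarith
  qed
qed

lemma child_gap_eventually_le:
  assumes t: "t \<in> {1..horizon P}" and n: "n \<in> nodes P (t - 1)" and \<eta>: "\<eta> > 0"
    and acc: "\<And>m z. m \<in> nodes P t \<Longrightarrow> z \<in> dec_set P t \<Longrightarrow>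
        (\<And>r. r > 0 \<Longrightarrow> \<exists>\<^sub>F k in sequentially. dist (X k m) z < r) \<Longrightarrow> ctg (Suc t) z - Qlim (Suc t) z \<le> c"
  shows "\<forall>\<^sub>F k in sequentially. child_gap k t n \<le> c + \<eta>"
proof -
  have "\<forall>\<^sub>F k in sequentially. \<forall>\<zeta>\<in>Theta P t.
      ctg (Suc t) (X k (n @ [\<zeta>])) - Q (k - 1) (Suc t) (X k (n @ [\<zeta>])) \<le> c + \<eta>"
  proof (intro eventually_ball_finite finite_Theta' t ballI)
    fix \<zeta> assume "\<zeta> \<in> Theta P t"
    then have m: "n @ [\<zeta>] \<in> nodes P t" using append_in_nodes_iff[OF t n] by simp
    show "\<forall>\<^sub>F k in sequentially. ctg (Suc t) (X k (n @ [\<zeta>])) - Q (k - 1) (Suc t) (X k (n @ [\<zeta>])) \<le> c + \<eta>"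
      by (rule gap_eventually_le[OF _ _ \<eta>]) (use t m acc[OF m] in auto)
  qed
  then show ?thesis
  proof eventually_elim
    case (elim k)
    then have "child_gap k t n \<le> (\<Sum>\<zeta>\<in>Theta P t. rprob P t \<zeta> * (c + \<eta>))"
      unfolding child_gap_def by (intro sum_mono mult_left_mono rprob_nonneg) auto
    also have "\<dots> = c + \<eta>" using sum_rprob[OF t] by (simp add: sum_distrib_right[symmetric])
    finally show ?case .
  qed
qed

end

text \<open>
  Sample paths on which accumulation points of the node decisions are seen by the sampled scenarios;
  almost every path has this property.
\<close>

locale recurrent_isddp = isddp +
  assumes recurrent: "\<And>t n z r. t \<in> {1..horizon P} \<Longrightarrow> n \<in> nodes P t \<Longrightarrow>
      (\<And>r. r > 0 \<Longrightarrow> \<exists>\<^sub>F k in sequentially. dist (X k n) z < r) \<Longrightarrow> r > 0 \<Longrightarrow>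
      \<exists>\<^sub>F k in sequentially. dist (X k n) z < r \<and> n = map (s k) [1..<Suc t]"
begin

text \<open>
  Backward induction over the stages. Near an accumulation point \<open>z\<close> there is a late iteration that
  samples the node with a decision close to \<open>z\<close>. The gap at this decision is controlled by the
  children, and continuity carries the bound to \<open>z\<close>.
\<close>

lemma limit_gap_at_accumulation_point:
  assumes "t \<in> {2..Suc (horizon P)}" "n \<in> nodes P (t - 1)" "z \<in> dec_set P (t - 1)"
    "\<And>r. r > 0 \<Longrightarrow> \<exists>\<^sub>F k in sequentially. dist (X k n) z < r"
  shows "ctg t z - Qlim t z \<le> gap_bound t"
proof -
  have "t \<le> Suc (horizon P)" using assms by auto
  then show ?thesis using assms
  proof (induction t arbitrary: n z rule: inc_induct)
    case base
    have "ctg (Suc (horizon P)) z = 0" by (rule ctg_end)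
    moreover have "Qlim (Suc (horizon P)) z = 0" using base Q_end by (simp add: Qlim_def)
    ultimately show ?case by (simp add: gap_bound_def)
  next
    case (step t)
    have t: "t \<in> {2..horizon P}" "t \<in> {1..horizon P}" "t - 1 \<in> {1..horizon P}" using step by auto
    have Suc_t: "Suc (t - 1) = t" using t by simp
    have IH: "ctg (Suc t) z - Qlim (Suc t) z \<le> gap_bound (Suc t)"
      if "m \<in> nodes P t" "z \<in> dec_set P t" "\<And>r. r > 0 \<Longrightarrow> \<exists>\<^sub>F k in sequentially. dist (X k m) z < r" for m z
      by (rule step.IH[of m]) (use t that in auto)
    show ?case
    proof (rule field_le_epsilon)
      fix \<eta> :: real assume \<eta>: "\<eta> > 0"
      have cont: "continuous_on (dec_set P (t - 1)) (\<lambda>z. ctg t z - Qlim t z)"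
        by (intro continuous_intros ctg_regular Qlim step.prems)
      obtain r where r: "r > 0" "\<And>u. u \<in> dec_set P (t - 1) \<Longrightarrow> dist u z < r \<Longrightarrow>
          dist (ctg t u - Qlim t u) (ctg t z - Qlim t z) < \<eta> / 2"
        using cont[unfolded continuous_on_iff, rule_format, OF step.prems(3), of "\<eta> / 2"] \<eta> by auto
      have often: "\<exists>\<^sub>F k in sequentially. dist (X k n) z < r \<and> n = map (s k) [1..<Suc (t - 1)]"
        by (rule recurrent[OF t(3) step.prems(2,4) r(1)])
      have "\<forall>\<^sub>F k in sequentially. child_gap k t n \<le> gap_bound (Suc t) + \<eta> / 2"
        by (rule child_gap_eventually_le[OF t(2) step.prems(2)], use \<eta> in simp, rule IH)
      then have "\<forall>\<^sub>F k in sequentially. 1 \<le> k \<and> child_gap k t n \<le> gap_bound (Suc t) + \<eta> / 2"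
        using eventually_ge_at_top[of 1] by eventually_elim simp
      then obtain k where k: "dist (X k n) z < r" "n = map (s k) [1..<Suc (t - 1)]" "1 \<le> k"
          "child_gap k t n \<le> gap_bound (Suc t) + \<eta> / 2"
        using frequently_ex[OF frequently_eventually_conj[OF often]] by blast
      have xn: "X k n \<in> dec_set P (t - 1)" by (rule X_in_dec_set[OF k(3) _ step.prems(2)]) (use t in auto)
      have "ctg t (X k n) - Qlim t (X k n) \<le> ctg t (X k n) - Q k t (X k n)"
        using Qlim(3)[OF step.prems(1) xn, of k] by simp
      also have "\<dots> \<le> \<delta>bar + 2 * \<epsilon>bar + child_gap k t n"
        by (rule gap_at_sampled_node[OF k(3) t(1) step.prems(2) k(2)[unfolded Suc_t]])
      also have "\<dots> \<le> gap_bound t + \<eta> / 2" using k(4) gap_bound_Suc[of t] by linarith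
      finally show "ctg t z - Qlim t z \<le> gap_bound t + \<eta>"
        using r(2)[OF xn k(1)] unfolding dist_real_def by linarith
    qed
  qed
qed

lemma child_gap_limit:
  assumes t: "t \<in> {1..horizon P}" and n: "n \<in> nodes P (t - 1)" and \<eta>: "\<eta> > 0"
  shows "\<forall>\<^sub>F k in sequentially. child_gap k t n \<le> gap_bound (Suc t) + \<eta>"
  by (rule child_gap_eventually_le[OF t n \<eta>], rule limit_gap_at_accumulation_point) (use t in auto)

lemma cost_to_go_gap:
  assumes t: "t \<in> {2..Suc (horizon P)}" and n: "n \<in> nodes P (t - 1)"
  shows "0 \<le> liminf (\<lambda>k. cost_to_go P t (X k n) - ereal (Q k t (X k n)))"
    and "limsup (\<lambda>k. cost_to_go P t (X k n) - ereal (Q k t (X k n))) \<le> ereal (gap_bound t)"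
proof -
  have xn: "X k n \<in> dec_set P (t - 1)" if "k \<ge> 1" for k by (rule X_in_dec_set[OF that _ n]) (use t in auto)
  have eq: "cost_to_go P t (X k n) - ereal (Q k t (X k n)) = ereal (ctg t (X k n) - Q k t (X k n))" if "k \<ge> 1" for k
    using cost_to_go_eq[OF t xn[OF that]] by simp
  show "0 \<le> liminf (\<lambda>k. cost_to_go P t (X k n) - ereal (Q k t (X k n)))"
  proof (rule Liminf_bounded)
    show "\<forall>\<^sub>F k in sequentially. 0 \<le> cost_to_go P t (X k n) - ereal (Q k t (X k n))"
      using eventually_ge_at_top[of 1] by eventually_elim (use eq Q_le_ctg[OF t xn] in simp)
  qed
  show "limsup (\<lambda>k. cost_to_go P t (X k n) - ereal (Q k t (X k n))) \<le> ereal (gap_bound t)"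
  proof (rule limsup_ereal_le)
    fix \<eta> :: real assume \<eta>: "\<eta> > 0"
    have "\<forall>\<^sub>F k in sequentially. ctg t (X k n) - Q (k - 1) t (X k n) \<le> gap_bound t + \<eta>"
      by (rule gap_eventually_le[OF t n \<eta>]) (rule limit_gap_at_accumulation_point[OF t n])
    then show "\<forall>\<^sub>F k in sequentially. cost_to_go P t (X k n) - ereal (Q k t (X k n)) \<le> ereal (gap_bound t + \<eta>)"
      using eventually_ge_at_top[of 1]
    proof eventually_elim
      case (elim k)
      then show ?case using eq[of k] Q_mono[OF t xn, of k "k - 1"] by simp
    qed
  qed
qed

text \<open>
  The decisions of the children are \<open>\<delta>bar\<close>-optimal for a lower approximation, so their true cost
  exceeds the cost-to-go function by at most \<open>\<delta>bar\<close> plus the expected gap at the children, in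
  every iteration.
\<close>

lemma policy_cost_gap:
  assumes t: "t \<in> {2..horizon P}" and n: "n \<in> nodes P (t - 1)"
  defines "G \<equiv> \<lambda>k. (\<Sum>m\<in>children P n. ereal (trans_prob P m) *
      (cost P t (X k m) (X k n) (last m) + cost_to_go P (t + 1) (X k m))) - cost_to_go P t (X k n)"
  shows "0 \<le> liminf G" and "limsup G \<le> ereal (gap_bound t)"
proof -
  have t1: "t \<in> {1..horizon P}" and t2: "t \<in> {2..Suc (horizon P)}" "Suc t \<in> {2..Suc (horizon P)}" using t by auto
  have xn: "X k n \<in> dec_set P (t - 1)" if "k \<ge> 1" for k by (rule X_in_dec_set[OF that _ n]) (use t in auto)
  have eq: "G k = ereal (policy_cost k t n - ctg t (X k n))" if k: "k \<ge> 1" for k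
  proof -
    have "(\<Sum>m\<in>children P n. ereal (trans_prob P m) *
      (cost P t (X k m) (X k n) (last m) + cost_to_go P (t + 1) (X k m))) = 
      (\<Sum>\<zeta>\<in>Theta P t. ereal (rprob P t \<zeta> * (rcost k t n \<zeta> + ctg (Suc t) (X k (n @ [\<zeta>])))))"
      unfolding sum_children[OF t1 n]
    proof (rule sum.cong[OF refl])
      fix \<zeta> assume \<zeta>: "\<zeta> \<in> Theta P t"
      have "cost_to_go P (Suc t) (X k (n @ [\<zeta>])) = ereal (ctg (Suc t) (X k (n @ [\<zeta>])))"
        by (rule cost_to_go_eq[OF t2(2)]) (use child_decision(2)[OF k t1 n \<zeta>] in simp)
      then show "ereal (trans_prob P (n @ [\<zeta>])) * (cost P t (X k (n @ [\<zeta>])) (X k n) (last (n @ [\<zeta>]))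
          + cost_to_go P (t + 1) (X k (n @ [\<zeta>])))
        = ereal (rprob P t \<zeta> * (rcost k t n \<zeta> + ctg (Suc t) (X k (n @ [\<zeta>]))))"
        using trans_prob_append[OF t1 n] child_decision(3)[OF k t1 n \<zeta>] by simp
    qed
    then show ?thesis using cost_to_go_eq[OF t2(1) xn[OF k]] by (simp add: G_def policy_cost_def)
  qed
  show "0 \<le> liminf G"
  proof (rule Liminf_bounded)
    show "\<forall>\<^sub>F k in sequentially. 0 \<le> G k"
      using eventually_ge_at_top[of 1] by eventually_elim (use eq policy_cost_bounds(1)[OF _ t n] in simp)
  qed
  have \<epsilon>0: "0 \<le> \<epsilon>bar" using \<epsilon>_bounds[of 1 t] t by auto
  show "limsup G \<le> ereal (gap_bound t)"
  proof (rule limsup_ereal_le)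
    fix \<eta> :: real assume \<eta>: "\<eta> > 0"
    show "\<forall>\<^sub>F k in sequentially. G k \<le> ereal (gap_bound t + \<eta>)"
      using child_gap_limit[OF t1 n \<eta>] eventually_ge_at_top[of 1]
    proof eventually_elim
      case (elim k)
      have "expected t (Q (k - 1) (Suc t)) (X k n) \<le> ctg t (X k n)"
        unfolding ctg_rec[OF t xn[OF elim(2)]]
        by (rule expected_mono[OF t]) (use Q_continuous[OF t2(2)] ctg_regular[OF t2(2)] Q_le_ctg[OF t2(2)] xn elim in auto)
      then have "policy_cost k t n - ctg t (X k n) \<le> gap_bound t + \<eta>"
        using policy_cost_bounds(2)[OF elim(2) t n] elim(1) gap_bound_Suc[of t] \<epsilon>0 by linarith
      then show ?case using eq[OF elim(2)] by simp
    qed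
  qed
qed

lemma optimal_value_gap:
  defines "v \<equiv> \<lambda>k. stage_val P 1 (\<lambda>u. ereal (Q (k - 1) 2 u)) (x_init P) (xi_first P)"
  shows "v k \<le> opt_value P"
    and "opt_value P - ereal (\<delta>bar * real (horizon P)) - ereal (2 * \<epsilon>bar * (real (horizon P) - 1)) \<le> liminf v"
    and "limsup v \<le> opt_value P"
proof -
  have t1: "1 \<in> {1..horizon P}" and t2: "2 \<in> {2..Suc (horizon P)}" using T1 by auto
  have \<zeta>: "xi_first P \<in> Theta P 1" using Theta_first by simp
  have x0: "x_init P \<in> dec_set P (1 - 1)" by (simp add: dec_set_def)
  have two: "Suc 1 = (2 :: nat)" by simp
  have root: "[] \<in> nodes P (1 - 1)" using nodes_iff[of 0 "[]"] by simp
  have Qc: "continuous_on (dec_set P 1) (Q k 2)" for k using Q_continuous[OF t2, of k] by simp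
  have cc: "continuous_on (dec_set P 1) (ctg 2)" using ctg_regular(2)[OF t2] by simp
  have v: "v k = ereal (rval 1 (Q (k - 1) 2) (x_init P) (xi_first P))" for k
    unfolding v_def by (rule stage_val_real[OF t1 \<zeta> Qc x0 feas_first])
  have "opt_value P = stage_val P 1 (\<lambda>u. ereal (ctg 2 u)) (x_init P) (xi_first P)"
    unfolding opt_value_def by (rule stage_val_cong) (use cost_to_go_eq[OF t2] in simp)
  also have "\<dots> = ereal (rval 1 (ctg 2) (x_init P) (xi_first P))"
    by (rule stage_val_real[OF t1 \<zeta> cc x0 feas_first])
  finally have opt: "opt_value P = ereal (rval 1 (ctg 2) (x_init P) (xi_first P))" .
  show le: "v k \<le> opt_value P" for k
    unfolding v_def opt_value_def
    by (rule stage_val_mono) (use cost_to_go_eq[OF t2] Q_le_ctg[OF t2] in simp)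
  then show "limsup v \<le> opt_value P" by (intro Limsup_bounded always_eventually allI)
  have "ereal (rval 1 (ctg 2) (x_init P) (xi_first P) - (\<delta>bar + gap_bound 2)) \<le> liminf v"
  proof (rule le_liminf_ereal)
    fix \<eta> :: real assume "\<eta> > 0"
    from child_gap_limit[OF t1 root this] eventually_ge_at_top[of 1]
    show "\<forall>\<^sub>F k in sequentially. ereal (rval 1 (ctg 2) (x_init P) (xi_first P) - (\<delta>bar + gap_bound 2) - \<eta>) \<le> v k"
    proof eventually_elim
      case (elim k)
      have X0: "X k [] = x_init P" using sim[OF elim(2)] by (simp add: simulation_def)
      have "child_gap k 1 [] = ctg 2 (X k [xi_first P]) - Q (k - 1) 2 (X k [xi_first P])"
        unfolding child_gap_def Theta_first(1) two using Theta_first(2) by simp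
      then show ?case
        using child_decision(4,5)[OF elim(2) t1 root \<zeta>] elim(1) X0 unfolding two v by simp
    qed
  qed
  then show "opt_value P - ereal (\<delta>bar * real (horizon P)) - ereal (2 * \<epsilon>bar * (real (horizon P) - 1)) \<le> liminf v"
    unfolding opt by (simp add: gap_bound_def algebra_simps)
qed

lemma limit_approximation:
  assumes t: "t \<in> {2..horizon P}" and n: "n \<in> nodes P (t - 1)"
    and r: "strict_mono (r :: nat \<Rightarrow> nat)" "(\<lambda>i. X (r i) n) \<longlonglongrightarrow> z"
  shows "\<bar>ereal (Qlim t z) - cost_to_go P t z\<bar> \<le> ereal (gap_bound t)"
proof -
  have t2: "t \<in> {2..Suc (horizon P)}" using t by auto
  have "closed (dec_set P (t - 1))" using dec_set_regular(2)[of "t - 1"] t by (auto intro: compact_imp_closed)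
  then have z: "z \<in> dec_set P (t - 1)"
  proof (rule Lim_in_closed_set[OF _ _ _ r(2)])
    show "\<forall>\<^sub>F i in sequentially. X (r i) n \<in> dec_set P (t - 1)"
      using eventually_ge_at_top[of 1]
    proof eventually_elim
      case (elim i)
      then have "1 \<le> r i" using seq_suble[OF r(1), of i] by simp
      then show ?case by (rule X_in_dec_set[OF _ _ n]) (use t in auto)
    qed
  qed simp
  have "ctg t z - Qlim t z \<le> gap_bound t"
    by (rule limit_gap_at_accumulation_point[OF t2 n z]) (rule frequently_dist_subseq[OF r])
  then show ?thesis using cost_to_go_eq[OF t2 z] Qlim(4)[OF t2 z] by simp
qed

end

theorem theorem5p3:
  fixes P :: "('n::finite, 'q::finite, 'k::finite, 'w) msp"
    and T :: nat
    and M :: "'v measure"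
    and S :: "nat \<Rightarrow> nat \<Rightarrow> 'v \<Rightarrow> real^'k"
    and \<delta> \<epsilon> :: "nat \<Rightarrow> nat \<Rightarrow> real"
    and \<delta>bar \<epsilon>bar :: real
    and Q0 :: "nat \<Rightarrow> real^'n \<Rightarrow> real"
    and x :: "nat \<Rightarrow> nat \<Rightarrow> 'v \<Rightarrow> real^'n"
    and X :: "nat \<Rightarrow> (real^'k) list \<Rightarrow> 'v \<Rightarrow> real^'n"
    and y l :: "nat \<Rightarrow> nat \<Rightarrow> real^'k \<Rightarrow> 'v \<Rightarrow> real^'n"
    and Q :: "nat \<Rightarrow> nat \<Rightarrow> 'v \<Rightarrow> real^'n \<Rightarrow> real"
  assumes T: "T = horizon P" "T \<ge> 1"
    and process: "process_assms P"
    and regular: "regularity_assms P"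
    and sampling: "sampling_assms P M S"
    and errors:
      "\<And>k t. k \<ge> 1 \<Longrightarrow> t \<in> {1..T} \<Longrightarrow> 0 \<le> \<delta> k t \<and> \<delta> k t \<le> \<delta>bar"
      "\<And>k t. k \<ge> 1 \<Longrightarrow> t \<in> {2..T} \<Longrightarrow> 0 \<le> \<epsilon> k t \<and> \<epsilon> k t \<le> \<epsilon>bar"
    and initial: "initial_approx P Q0"
    and run: "AE \<omega> in M. isddp_run P \<delta> \<epsilon> Q0 (\<lambda>k t. S k t \<omega>) (\<lambda>k t. x k t \<omega>)
        (\<lambda>k n. X k n \<omega>) (\<lambda>k t \<zeta>. y k t \<zeta> \<omega>) (\<lambda>k t \<zeta>. l k t \<zeta> \<omega>) (\<lambda>k t. Q k t \<omega>)"
    and before: "nonanticipative P M S X"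
  shows "(\<forall>t\<in>{2..T + 1}. \<forall>n\<in>nodes P (t - 1). AE \<omega> in M.
           0 \<le> liminf (\<lambda>k. cost_to_go P t (X k n \<omega>) - ereal (Q k t \<omega> (X k n \<omega>)))
         \<and> liminf (\<lambda>k. cost_to_go P t (X k n \<omega>) - ereal (Q k t \<omega> (X k n \<omega>)))
             \<le> limsup (\<lambda>k. cost_to_go P t (X k n \<omega>) - ereal (Q k t \<omega> (X k n \<omega>)))
         \<and> limsup (\<lambda>k. cost_to_go P t (X k n \<omega>) - ereal (Q k t \<omega> (X k n \<omega>)))
             \<le> ereal ((\<delta>bar + 2 * \<epsilon>bar) * (real T - real t + 1)))
     \<and> (\<forall>t\<in>{2..T}. \<forall>n\<in>nodes P (t - 1). AE \<omega> in M.
           0 \<le> liminf (\<lambda>k. (\<Sum>m\<in>children P n. ereal (trans_prob P m) *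
                  (cost P t (X k m \<omega>) (X k n \<omega>) (last m) + cost_to_go P (t + 1) (X k m \<omega>)))
                - cost_to_go P t (X k n \<omega>))
         \<and> limsup (\<lambda>k. (\<Sum>m\<in>children P n. ereal (trans_prob P m) *
                  (cost P t (X k m \<omega>) (X k n \<omega>) (last m) + cost_to_go P (t + 1) (X k m \<omega>)))
                - cost_to_go P t (X k n \<omega>))
             \<le> ereal ((\<delta>bar + 2 * \<epsilon>bar) * (real T - real t + 1)))
     \<and> (AE \<omega> in M.
           (\<forall>k\<ge>1. stage_val P 1 (\<lambda>u. ereal (Q (k - 1) 2 \<omega> u)) (x_init P) (xi_first P) \<le> opt_value P)
         \<and> opt_value P - ereal (\<delta>bar * real T) - ereal (2 * \<epsilon>bar * (real T - 1))
             \<le> liminf (\<lambda>k. stage_val P 1 (\<lambda>u. ereal (Q (k - 1) 2 \<omega> u)) (x_init P) (xi_first P))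
         \<and> liminf (\<lambda>k. stage_val P 1 (\<lambda>u. ereal (Q (k - 1) 2 \<omega> u)) (x_init P) (xi_first P))
             \<le> limsup (\<lambda>k. stage_val P 1 (\<lambda>u. ereal (Q (k - 1) 2 \<omega> u)) (x_init P) (xi_first P))
         \<and> limsup (\<lambda>k. stage_val P 1 (\<lambda>u. ereal (Q (k - 1) 2 \<omega> u)) (x_init P) (xi_first P))
             \<le> opt_value P)
     \<and> (\<forall>t\<in>{2..T}. AE \<omega> in M. \<exists>Qstar :: real^'n \<Rightarrow> real.
           uniform_limit (dec_set P (t - 1)) (\<lambda>k. Q k t \<omega>) Qstar sequentially
         \<and> continuous_on (dec_set P (t - 1)) Qstar
         \<and> (\<forall>n\<in>nodes P (t - 1). \<forall>xbar.
               (\<exists>r::nat \<Rightarrow> nat. strict_mono r \<and> (\<lambda>i. X (r i) n \<omega>) \<longlonglongrightarrow> xbar) \<longrightarrow>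
               \<bar>ereal (Qstar xbar) - cost_to_go P t xbar\<bar>
                 \<le> ereal ((\<delta>bar + 2 * \<epsilon>bar) * (real T - real t + 1))))"
proof -
  note T(1) [simp]
  have T1: "1 \<le> horizon P" using T by simp
  obtain e where reg: "regular_msp P e" using regular_msp_if_regularity_assms[OF process T1 regular] .
  interpret regular_msp P e by (rule reg)
  have "AE \<omega> in M. \<forall>t\<in>{1..horizon P}. \<forall>n\<in>nodes P t. \<forall>z.
      (\<forall>r>0. \<exists>\<^sub>F k in sequentially. dist (X k n \<omega>) z < r) \<longrightarrow>
      (\<forall>r>0. \<exists>\<^sub>F k in sequentially. dist (X k n \<omega>) z < r \<and> n = map (\<lambda>i. S k i \<omega>) [1..<Suc t])"
    by (intro AE_finite_allI finite_nodes accumulation_at_sampled_iterations[OF sampling before]) auto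
  with run have main: "AE \<omega> in M. recurrent_isddp P e \<delta> \<epsilon> \<delta>bar \<epsilon>bar Q0 (\<lambda>k t. S k t \<omega>) (\<lambda>k t. x k t \<omega>)
      (\<lambda>k n. X k n \<omega>) (\<lambda>k t \<zeta>. y k t \<zeta> \<omega>) (\<lambda>k t \<zeta>. l k t \<zeta> \<omega>) (\<lambda>k t. Q k t \<omega>)"
  proof eventually_elim
    case (elim \<omega>)
    show ?case
    proof (unfold_locales, goal_cases)
      case (1 k t) then show ?case using errors(1) by simp
    next
      case (2 k t) then show ?case using errors(2) by simp
    next
      case 3 show ?case by (rule initial)
    next
      case 4 show ?case by (rule elim(1))
    next
      case (5 t n z r) then show ?case using elim(2) by blast
    qed
  qed
  have part1: "AE \<omega> in M.
           0 \<le> liminf (\<lambda>k. cost_to_go P t (X k n \<omega>) - ereal (Q k t \<omega> (X k n \<omega>)))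
         \<and> liminf (\<lambda>k. cost_to_go P t (X k n \<omega>) - ereal (Q k t \<omega> (X k n \<omega>)))
             \<le> limsup (\<lambda>k. cost_to_go P t (X k n \<omega>) - ereal (Q k t \<omega> (X k n \<omega>)))
         \<and> limsup (\<lambda>k. cost_to_go P t (X k n \<omega>) - ereal (Q k t \<omega> (X k n \<omega>)))
             \<le> ereal ((\<delta>bar + 2 * \<epsilon>bar) * (real T - real t + 1))"
    if t: "t \<in> {2..T + 1}" and n: "n \<in> nodes P (t - 1)" for t n
    using main
  proof eventually_elim
    case (elim \<omega>)
    from elim interpret recurrent_isddp P e \<delta> \<epsilon> \<delta>bar \<epsilon>bar Q0 "\<lambda>k t. S k t \<omega>" "\<lambda>k t. x k t \<omega>"
      "\<lambda>k n. X k n \<omega>" "\<lambda>k t \<zeta>. y k t \<zeta> \<omega>" "\<lambda>k t \<zeta>. l k t \<zeta> \<omega>" "\<lambda>k t. Q k t \<omega>" .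
    show ?case using cost_to_go_gap[of t n] t n by (simp add: gap_bound_def Liminf_le_Limsup)
  qed
  have part2: "AE \<omega> in M.
           0 \<le> liminf (\<lambda>k. (\<Sum>m\<in>children P n. ereal (trans_prob P m) *
                  (cost P t (X k m \<omega>) (X k n \<omega>) (last m) + cost_to_go P (t + 1) (X k m \<omega>)))
                - cost_to_go P t (X k n \<omega>))
         \<and> limsup (\<lambda>k. (\<Sum>m\<in>children P n. ereal (trans_prob P m) *
                  (cost P t (X k m \<omega>) (X k n \<omega>) (last m) + cost_to_go P (t + 1) (X k m \<omega>)))
                - cost_to_go P t (X k n \<omega>))
             \<le> ereal ((\<delta>bar + 2 * \<epsilon>bar) * (real T - real t + 1))"
    if t: "t \<in> {2..T}" and n: "n \<in> nodes P (t - 1)" for t n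
    using main
  proof eventually_elim
    case (elim \<omega>)
    from elim interpret recurrent_isddp P e \<delta> \<epsilon> \<delta>bar \<epsilon>bar Q0 "\<lambda>k t. S k t \<omega>" "\<lambda>k t. x k t \<omega>"
      "\<lambda>k n. X k n \<omega>" "\<lambda>k t \<zeta>. y k t \<zeta> \<omega>" "\<lambda>k t \<zeta>. l k t \<zeta> \<omega>" "\<lambda>k t. Q k t \<omega>" .
    show ?case using policy_cost_gap[of t n] t n unfolding gap_bound_def T(1) by blast
  qed
  have part3: "AE \<omega> in M.
           (\<forall>k\<ge>1. stage_val P 1 (\<lambda>u. ereal (Q (k - 1) 2 \<omega> u)) (x_init P) (xi_first P) \<le> opt_value P)
         \<and> opt_value P - ereal (\<delta>bar * real T) - ereal (2 * \<epsilon>bar * (real T - 1))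
             \<le> liminf (\<lambda>k. stage_val P 1 (\<lambda>u. ereal (Q (k - 1) 2 \<omega> u)) (x_init P) (xi_first P))
         \<and> liminf (\<lambda>k. stage_val P 1 (\<lambda>u. ereal (Q (k - 1) 2 \<omega> u)) (x_init P) (xi_first P))
             \<le> limsup (\<lambda>k. stage_val P 1 (\<lambda>u. ereal (Q (k - 1) 2 \<omega> u)) (x_init P) (xi_first P))
         \<and> limsup (\<lambda>k. stage_val P 1 (\<lambda>u. ereal (Q (k - 1) 2 \<omega> u)) (x_init P) (xi_first P))
             \<le> opt_value P"
    using main
  proof eventually_elim
    case (elim \<omega>)
    from elim interpret recurrent_isddp P e \<delta> \<epsilon> \<delta>bar \<epsilon>bar Q0 "\<lambda>k t. S k t \<omega>" "\<lambda>k t. x k t \<omega>"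
      "\<lambda>k n. X k n \<omega>" "\<lambda>k t \<zeta>. y k t \<zeta> \<omega>" "\<lambda>k t \<zeta>. l k t \<zeta> \<omega>" "\<lambda>k t. Q k t \<omega>" .
    show ?case unfolding T(1)
      by (intro conjI allI impI optimal_value_gap Liminf_le_Limsup) simp
  qed
  have part4: "AE \<omega> in M. \<exists>Qstar :: real^'n \<Rightarrow> real.
           uniform_limit (dec_set P (t - 1)) (\<lambda>k. Q k t \<omega>) Qstar sequentially
         \<and> continuous_on (dec_set P (t - 1)) Qstar
         \<and> (\<forall>n\<in>nodes P (t - 1). \<forall>xbar.
               (\<exists>r::nat \<Rightarrow> nat. strict_mono r \<and> (\<lambda>i. X (r i) n \<omega>) \<longlonglongrightarrow> xbar) \<longrightarrow>
               \<bar>ereal (Qstar xbar) - cost_to_go P t xbar\<bar>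
                 \<le> ereal ((\<delta>bar + 2 * \<epsilon>bar) * (real T - real t + 1)))"
    if t: "t \<in> {2..T}" for t
    using main
  proof eventually_elim
    case (elim \<omega>)
    from elim interpret recurrent_isddp P e \<delta> \<epsilon> \<delta>bar \<epsilon>bar Q0 "\<lambda>k t. S k t \<omega>" "\<lambda>k t. x k t \<omega>"
      "\<lambda>k n. X k n \<omega>" "\<lambda>k t \<zeta>. y k t \<zeta> \<omega>" "\<lambda>k t \<zeta>. l k t \<zeta> \<omega>" "\<lambda>k t. Q k t \<omega>" .
    have t': "t \<in> {2..horizon P}" "t \<in> {2..Suc (horizon P)}" using t by auto
    show ?case unfolding T(1)
    proof (intro exI[of _ "Qlim t"] conjI ballI allI impI)
      fix n z assume "n \<in> nodes P (t - 1)" "\<exists>r::nat \<Rightarrow> nat. strict_mono r \<and> (\<lambda>i. X (r i) n \<omega>) \<longlonglongrightarrow> z"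
      then show "\<bar>ereal (Qlim t z) - cost_to_go P t z\<bar>
          \<le> ereal ((\<delta>bar + 2 * \<epsilon>bar) * (real (horizon P) - real t + 1))"
        using limit_approximation[OF t'(1)] unfolding gap_bound_def by blast
    qed (rule Qlim(1,2)[OF t'(2)])+
  qed
  show ?thesis using part1 part2 part3 part4 by (intro conjI ballI)
qed

end
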